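(* Let $K$ be a number field, $v$ a finite place of $K$, and $\boldsymbol\alpha\in V_K$ such that $\|\boldsymbol\alpha\|_w=1$ for every finite place $w\ne v$ of $K$. Let $W\subseteq V_K$ be the $\mathbb Q$-span of the classes of the units of $K$. Then there exists $\boldsymbol\beta\in W$ such that \[ h_1(\boldsymbol\alpha\boldsymbol\beta^{-1})=\inf_{\boldsymbol\gamma\in W}h_1(\boldsymbol\alpha\boldsymbol\gamma^{-1})=\frac{1}{[K:\mathbb Q]}\Big(\big|d_v\log\|\boldsymbol\alpha\|_v\big|+\Big|\sum_{w\mid\infty}d_w\log\|\boldsymbol\alpha\|_w\Big|\Big), \] where $d_u=[K_u:\mathbb Q_u]$ and the last sum is over the archimedean places of $K$.
   Context: $\mathcal{G}=\overline{\mathbb{Q}}^\times/\operatorname{Tor}(\overline{\mathbb{Q}}^\times)$ is a $\mathbb Q$-vector space written multiplicatively. For a place $u$ of $K$, $\|\cdot\|_u$ extends the usual $p$-adic or archimedean absolute value of $\mathbb Q$; it is extended to $V_K$ by $\|\boldsymbol\beta^r\|_u=\|\beta\|_u^r$. $V_K=\{\boldsymbol\beta^r:r\in\mathbb Q,\ \boldsymbol\beta\in K^\times/\operatorname{Tor}(K^\times)\}$. $h_1(\boldsymbol\gamma)=\sum_u\frac{[K_u:\mathbb Q_u]}{[K:\mathbb Q]}|\log\|\boldsymbol\gamma\|_u|$ for $\boldsymbol\gamma\in V_K$. *)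

theory Defs
  imports
    "HOL-Algebra.Algebraic_Closure_Type"
    "HOL-Analysis.Infinite_Sum"
begin

text \<open>
  Number fields are taken inside the complex numbers, and the algebraic closure of the rationals is
  the field of algebraic complex numbers.
\<close>

abbreviation complex_ring :: "complex ring" where
  "complex_ring \<equiv> ring_of_type_algebra"

definition number_field :: "complex set \<Rightarrow> bool" where
  "number_field K \<longleftrightarrow>
     subfield K complex_ring \<and> ring.finite_dimension complex_ring \<rat> K"

definition field_degree :: "complex set \<Rightarrow> nat" where
  "field_degree K = ring.dim complex_ring \<rat> K"

definition Qbar_units :: "complex monoid" where
  "Qbar_units = mult_of (complex_ring\<lparr>carrier := {x. algebraic x}\<rparr>)"

definition Tor :: "complex set" where
  "Tor = {x \<in> carrier Qbar_units. \<exists>n::nat. n > 0 \<and> x [^]\<^bsub>Qbar_units\<^esub> n = \<one>\<^bsub>Qbar_units\<^esub>}"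

definition GG :: "complex set monoid" where
  "GG = Qbar_units Mod Tor"

definition cls :: "complex \<Rightarrow> complex set" where
  "cls x = Tor #>\<^bsub>Qbar_units\<^esub> x"

text \<open>
  Scalar multiplication by a rational number: if \<open>r = a / b\<close> in lowest terms with \<open>b > 0\<close>, then
  \<open>\<beta>\<^sup>r\<close> is the unique element whose \<open>b\<close>-th power is \<open>\<beta>\<^sup>a\<close>.
\<close>

definition rat_pow :: "complex set \<Rightarrow> rat \<Rightarrow> complex set" where
  "rat_pow \<beta> r = (THE \<gamma>. \<gamma> \<in> carrier GG \<and>
     \<gamma> [^]\<^bsub>GG\<^esub> snd (quotient_of r) = \<beta> [^]\<^bsub>GG\<^esub> fst (quotient_of r))"

definition rat_subspace :: "complex set set \<Rightarrow> bool" where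
  "rat_subspace U \<longleftrightarrow> subgroup U GG \<and> (\<forall>\<beta>\<in>U. \<forall>r. rat_pow \<beta> r \<in> U)"

definition rat_span :: "complex set set \<Rightarrow> complex set set" where
  "rat_span S = rat_subspace hull S"

text \<open>
  The group of nonzero elements of \<open>K\<close> modulo torsion is identified with its image in \<^const>\<open>GG\<close>.
\<close>

definition VV :: "complex set \<Rightarrow> complex set set" where
  "VV K = {rat_pow (cls b) r | b r. b \<in> K \<and> b \<noteq> 0}"

definition integer_units :: "complex set \<Rightarrow> complex set" where
  "integer_units K = {x \<in> K. x \<noteq> 0 \<and> algebraic_int x \<and> algebraic_int (inverse x)}"

definition unit_span :: "complex set \<Rightarrow> complex set set" where
  "unit_span K = rat_span (cls ` integer_units K)"

text \<open>
  Absolute values on \<open>K\<close> are extensional functions, so that equality of absolute values is equality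
  on \<open>K\<close>.
\<close>

definition abs_values :: "complex set \<Rightarrow> (complex \<Rightarrow> real) set" where
  "abs_values K = {f \<in> extensional K.
     (\<forall>x\<in>K. f x \<ge> 0 \<and> (f x = 0 \<longleftrightarrow> x = 0)) \<and>
     (\<forall>x\<in>K. \<forall>y\<in>K. f (x * y) = f x * f y \<and> f (x + y) \<le> f x + f y)}"

definition nontrivial_abs_values :: "complex set \<Rightarrow> (complex \<Rightarrow> real) set" where
  "nontrivial_abs_values K = {f \<in> abs_values K. \<exists>x\<in>K. x \<noteq> 0 \<and> f x \<noteq> 1}"

definition abs_value_equiv :: "complex set \<Rightarrow> ((complex \<Rightarrow> real) \<times> (complex \<Rightarrow> real)) set" where
  "abs_value_equiv K = {(f, g). f \<in> nontrivial_abs_values K \<and> g \<in> nontrivial_abs_values K \<and>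
     (\<exists>s>0. \<forall>x\<in>K. g x = f x powr s)}"

definition places :: "complex set \<Rightarrow> (complex \<Rightarrow> real) set set" where
  "places K = nontrivial_abs_values K // abs_value_equiv K"

definition padic_abs :: "nat \<Rightarrow> rat \<Rightarrow> real" where
  "padic_abs p q = (if q = 0 then 0 else
     real p powi (int (multiplicity (int p) (snd (quotient_of q)))
                - int (multiplicity (int p) (fst (quotient_of q)))))"

definition extends_padic :: "nat \<Rightarrow> (complex \<Rightarrow> real) \<Rightarrow> bool" where
  "extends_padic p f \<longleftrightarrow> (\<forall>q. f (of_rat q) = padic_abs p q)"

definition extends_real_abs :: "(complex \<Rightarrow> real) \<Rightarrow> bool" where
  "extends_real_abs f \<longleftrightarrow> (\<forall>q. f (of_rat q) = \<bar>of_rat q\<bar>)"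

text \<open>
  By Ostrowski's theorem, for a number field \<open>K\<close> every place contains exactly one absolute value
  that extends a \<open>p\<close>-adic or the archimedean absolute value of the rationals in its usual
  normalisation.
\<close>

definition place_norm :: "complex set \<Rightarrow> (complex \<Rightarrow> real) set \<Rightarrow> complex \<Rightarrow> real" where
  "place_norm K u = (THE f. f \<in> u \<and>
     (extends_real_abs f \<or> (\<exists>p::nat. Factorial_Ring.prime p \<and> extends_padic p f)))"

definition finite_places :: "complex set \<Rightarrow> (complex \<Rightarrow> real) set set" where
  "finite_places K =
     {u \<in> places K. \<exists>p::nat. Factorial_Ring.prime p \<and> extends_padic p (place_norm K u)}"

definition infinite_places :: "complex set \<Rightarrow> (complex \<Rightarrow> real) set set" where
  "infinite_places K = {u \<in> places K. extends_real_abs (place_norm K u)}"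

text \<open>
  For a number field \<open>K\<close> and \<open>\<gamma> \<in> VV K\<close>, the value does not depend on the representation
  \<open>\<gamma> = \<beta>\<^sup>r\<close>, so the description below is proper.
\<close>

definition V_norm :: "complex set \<Rightarrow> (complex \<Rightarrow> real) set \<Rightarrow> complex set \<Rightarrow> real" where
  "V_norm K u \<gamma> = (THE t. \<exists>b r. b \<in> K \<and> b \<noteq> 0 \<and> \<gamma> = rat_pow (cls b) r \<and>
     t = place_norm K u b powr of_rat r)"

definition cauchy_seqs :: "complex set \<Rightarrow> (complex \<Rightarrow> real) \<Rightarrow> (nat \<Rightarrow> complex) set" where
  "cauchy_seqs K f = {s. range s \<subseteq> K \<and>
     (\<forall>e>0. \<exists>N. \<forall>m\<ge>N. \<forall>n\<ge>N. f (s m - s n) < e)}"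

definition null_seqs :: "complex set \<Rightarrow> (complex \<Rightarrow> real) \<Rightarrow> (nat \<Rightarrow> complex) set" where
  "null_seqs K f = {s. range s \<subseteq> K \<and> (\<lambda>n. f (s n)) \<longlonglongrightarrow> 0}"

definition cauchy_ring :: "complex set \<Rightarrow> (complex \<Rightarrow> real) \<Rightarrow> (nat \<Rightarrow> complex) ring" where
  "cauchy_ring K f = \<lparr>carrier = cauchy_seqs K f, monoid.mult = (\<lambda>s t n. s n * t n), one = (\<lambda>_. 1),
     ring.zero = (\<lambda>_. 0), add = (\<lambda>s t n. s n + t n)\<rparr>"

definition completion :: "complex set \<Rightarrow> (complex \<Rightarrow> real) set \<Rightarrow> (nat \<Rightarrow> complex) set ring" where
  "completion K u = cauchy_ring K (place_norm K u) Quot null_seqs K (place_norm K u)"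

text \<open>
  The completion of the rationals at the place below \<open>u\<close>, as a subfield of the completion of \<open>K\<close>:
  the classes of the Cauchy sequences of rational numbers.
\<close>

definition rat_completion :: "complex set \<Rightarrow> (complex \<Rightarrow> real) set \<Rightarrow> (nat \<Rightarrow> complex) set set" where
  "rat_completion K u =
     {null_seqs K (place_norm K u) +>\<^bsub>cauchy_ring K (place_norm K u)\<^esub> s | s.
        s \<in> cauchy_seqs K (place_norm K u) \<and> range s \<subseteq> \<rat>}"

definition local_degree :: "complex set \<Rightarrow> (complex \<Rightarrow> real) set \<Rightarrow> nat" where
  "local_degree K u =
     ring.dim (completion K u) (rat_completion K u) (carrier (completion K u))"

definition h1 :: "complex set \<Rightarrow> complex set \<Rightarrow> real" where
  "h1 K \<gamma> = (\<Sum>\<^sub>\<infinity>u\<in>places K.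
     real (local_degree K u) / real (field_degree K) * \<bar>ln (V_norm K u \<gamma>)\<bar>)"

end

theory Submission
  imports Defs
begin

text \<open>
  Units have trivial finite norms, and the product of all conjugates of a unit is \<open>\<plusminus>1\<close>, so the triangle
  inequality over the archimedean places bounds \<open>h\<^sub>1(\<alpha>/\<gamma>)\<close> from below by the right-hand side. The
  bound is attained as soon as all archimedean logarithms of \<open>\<alpha>/\<beta>\<close> have the same sign.

  If \<open>\<parallel>\<alpha>\<parallel>\<^sub>v = 1\<close>, then some power of \<open>\<alpha>\<close> is the class of a unit and \<open>\<beta> = \<alpha>\<close> works. Otherwise a power of
  \<open>\<alpha>\<close> or of its inverse is the class of an algebraic integer \<open>b\<close> that is not a unit. Let \<open>n\<close> be its
  degree and \<open>c \<ge> 2\<close> the absolute value of its norm. Since \<open>\<int>[b]/b\<^sup>m\<close> has at most \<open>c\<^sup>m\<close> elements,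
  the pigeonhole principle applied to polynomials in \<open>b\<close> with coefficients of size about \<open>c\<^bsup>m/n\<^esup>\<close>
  gives a nonzero \<open>x\<^sub>m \<in> \<int>[b]\<close> for which the conjugates of \<open>b\<^sup>m x\<^sub>m\<close> are all \<open>O(c\<^bsup>m/n\<^esup>)\<close>. The norm
  of \<open>x\<^sub>m\<close> is then bounded, which forces the reverse estimate for every conjugate. Two of the \<open>x\<^sub>m\<close>
  with the same norm \<open>N\<close> that are congruent modulo \<open>N\<close> differ by a unit \<open>\<epsilon>\<close>, and for a suitable
  \<open>k > 0\<close> all conjugates of \<open>b\<^sup>k \<epsilon>\<close> exceed one in absolute value.
\<close>

section \<open>Rational polynomials and their conjugate roots\<close>

text \<open>In logarithmic coordinates the conjugates of the integer b form a vector with coordinate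
  sum log c > 0, while units lie in the hyperplane of sum zero. What is wanted is a unit that moves
  a multiple m of this vector to within a bounded distance of the diagonal point with all
  coordinates (m/n) log c. If the distance is bounded independently of m, the growing diagonal wins
  and all coordinates become positive. The x_m achieve this up to their bounded norm, and quotients
  of two of them at indices far enough apart are honest units. All of this happens in Q(b), whose
  degree is n; embeddings of K only enter through their restriction to Q(b). The definitions speak
  of classes of absolute values, completions and roots modulo torsion, so a dictionary comes first.
  Ostrowski's theorem fixes the norm of a place, archimedean places are conjugate pairs of
  embeddings whose size is the local degree, and integrality is detected by finite places. The hard
  direction of the last point produces a place from a non-integral element: a valuation ring of the
  complex numbers that omits it has rational valuations on algebraic numbers, and these give a
  p-adic absolute value.\<close>

definition rpoly :: "rat poly \<Rightarrow> complex \<Rightarrow> complex" where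
  "rpoly p x = poly (map_poly of_rat p) x"

lemma map_poly_of_rat_mult:
  "map_poly of_rat (p * q) = map_poly of_rat p * (map_poly of_rat q :: 'a::field_char_0 poly)"
  by (rule poly_eqI) (simp add: coeff_map_poly coeff_mult of_rat_sum of_rat_mult)

lemma map_poly_of_rat_add:
  "map_poly of_rat (p + q) = map_poly of_rat p + (map_poly of_rat q :: 'a::field_char_0 poly)"
  by (rule poly_eqI) (simp add: coeff_map_poly of_rat_add)

lemma rpoly_0 [simp]: "rpoly 0 x = 0"
  and rpoly_1 [simp]: "rpoly 1 x = 1"
  and rpoly_add: "rpoly (p + q) x = rpoly p x + rpoly q x"
  and rpoly_mult: "rpoly (p * q) x = rpoly p x * rpoly q x"
  and rpoly_pCons [simp]: "rpoly (pCons a p) x = of_rat a + x * rpoly p x"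
  by (simp_all add: rpoly_def map_poly_of_rat_mult map_poly_of_rat_add map_poly_pCons one_pCons)

lemma rpoly_smult: "rpoly (smult c p) x = of_rat c * rpoly p x"
  using rpoly_mult[of "[:c:]" p x] by simp

lemma rpoly_uminus: "rpoly (- p) x = - rpoly p x"
  using rpoly_smult[of "-1" p x] by (simp add: of_rat_minus)

lemma rpoly_diff: "rpoly (p - q) x = rpoly p x - rpoly q x"
  using rpoly_add[of p "- q" x] by (simp add: rpoly_uminus)

lemma rpoly_sum: "rpoly (\<Sum>i\<in>A. f i) x = (\<Sum>i\<in>A. rpoly (f i) x)"
  by (induction A rule: infinite_finite_induct) (simp_all add: rpoly_add)

lemma rpoly_monom: "rpoly (monom c n) x = of_rat c * x ^ n"
  by (simp add: rpoly_def map_poly_monom poly_monom)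

lemma rpoly_altdef: "rpoly p x = (\<Sum>i\<le>degree p. of_rat (coeff p i) * x ^ i)"
  unfolding rpoly_def poly_altdef by (simp add: coeff_map_poly degree_map_poly)

lemma cnj_rpoly: "cnj (rpoly p x) = rpoly p (cnj x)"
proof -
  have "cnj (of_rat q) = of_rat q" for q
    by (cases q) (simp add: of_rat_rat)
  thus ?thesis by (simp add: rpoly_altdef)
qed

text \<open>Otherwise \<open>P\<close> and \<open>g\<close> are coprime, and a Bezout identity
  evaluated at the common root reads 0 = 1.\<close>

lemma irreducible_root_dvd:
  assumes "irreducible P" "rpoly P x = 0" "rpoly g x = 0"
  shows "P dvd g"
proof (rule ccontr)
  assume "\<not> P dvd g"
  with assms(1) have "coprime P g"
    using prime_elem_imp_coprime[of P g] by (simp add: irreducible_imp_prime_elem)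
  hence "gcd P g = 1" by simp
  hence "fst (bezout_coefficients P g) * P + snd (bezout_coefficients P g) * g = 1"
    by (simp add: bezout_coefficients_fst_snd)
  hence "rpoly (fst (bezout_coefficients P g) * P + snd (bezout_coefficients P g) * g) x = 1"
    by simp
  with assms show False by (simp add: rpoly_add rpoly_mult)
qed

lemma rpoly_dvd_0: "P dvd g \<Longrightarrow> rpoly P x = 0 \<Longrightarrow> rpoly g x = 0"
  by (auto simp: rpoly_mult elim!: dvdE)

text \<open>Conjugates satisfy the same rational relations; this later makes the map that sends a
  generator to one of its conjugates well defined.\<close>

lemma irreducible_root_root:
  assumes "irreducible P" "rpoly P x = 0" "rpoly P y = 0" "rpoly g x = 0"
  shows "rpoly g y = 0"
  using irreducible_root_dvd[OF assms(1,2,4)] assms(3) by (rule rpoly_dvd_0)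

lemma rpoly_degree_0: "degree p = 0 \<Longrightarrow> rpoly p x = of_rat (coeff p 0)"
  by (auto elim!: degree_eq_zeroE)

lemma irreducible_factor_of_root:
  assumes "p \<noteq> 0" "rpoly p x = 0"
  shows "\<exists>P. irreducible P \<and> rpoly P x = 0"
  using assms
proof (induction "degree p" arbitrary: p rule: less_induct)
  case less
  have nu: "\<not> is_unit p"
    using less.prems by (auto simp: is_unit_poly_iff)
  show ?case
  proof (cases "irreducible p")
    case True
    thus ?thesis using less.prems by blast
  next
    case False
    then obtain a b where ab: "p = a * b" "\<not> is_unit a" "\<not> is_unit b"
      using less.prems nu by (auto simp: irreducible_def)
    have nz: "a \<noteq> 0" "b \<noteq> 0" using ab less.prems by auto
    have "degree a > 0" "degree b > 0"
      using ab nz by (auto simp: is_unit_iff_degree)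
    hence lt: "degree a < degree p" "degree b < degree p"
      using ab nz by (auto simp: degree_mult_eq)
    have "rpoly a x = 0 \<or> rpoly b x = 0"
      using less.prems ab by (simp add: rpoly_mult)
    thus ?thesis using less.hyps lt nz by blast
  qed
qed

lemma algebraic_iff_rpoly: "algebraic x \<longleftrightarrow> (\<exists>p. p \<noteq> 0 \<and> rpoly p x = 0)"
proof -
  have "algebraic x \<longleftrightarrow> (\<exists>p. (\<forall>i. coeff p i \<in> \<rat>) \<and> p \<noteq> 0 \<and> poly p x = 0)"
    by (rule algebraic_altdef)
  also have "\<dots> \<longleftrightarrow> (\<exists>p. p \<noteq> 0 \<and> rpoly p x = 0)"
  proof safe
    fix p :: "complex poly"
    assume p: "\<forall>i. coeff p i \<in> \<rat>" "p \<noteq> 0" "poly p x = 0"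
    have "\<forall>i. \<exists>q. coeff p i = of_rat q"
      using p(1) by (auto elim: Rats_cases)
    then obtain f where f: "\<And>i. coeff p i = of_rat (f i)"
      by (auto dest: choice)
    define q where "q = Poly (map f [0..<Suc (degree p)])"
    have "map_poly of_rat q = p"
    proof (rule poly_eqI)
      fix i
      show "coeff (map_poly of_rat q) i = coeff p i"
        using f[of i] coeff_eq_0[of p i]
        by (cases "i \<le> degree p") (auto simp: coeff_map_poly q_def nth_default_def simp del: upt_Suc)
    qed
    thus "\<exists>p. p \<noteq> 0 \<and> rpoly p x = 0"
      using p by (intro exI[of _ q]) (auto simp: rpoly_def)
  next
    fix p assume "p \<noteq> 0" "rpoly p x = 0"
    thus "\<exists>p. (\<forall>i. coeff p i \<in> \<rat>) \<and> p \<noteq> 0 \<and> poly p x = 0"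
      by (intro exI[of _ "map_poly of_rat p"])
         (auto simp: rpoly_def coeff_map_poly map_poly_eq_0_iff)
  qed
  finally show ?thesis .
qed

text \<open>Phrased by irreducibility instead of least degree, so that the predicate passes at once
  to every other root of \<open>P\<close>.\<close>

definition min_rpoly :: "rat poly \<Rightarrow> complex \<Rightarrow> bool" where
  "min_rpoly P x \<longleftrightarrow> irreducible P \<and> lead_coeff P = 1 \<and> rpoly P x = 0"

lemma min_rpoly_exists:
  assumes "algebraic x"
  obtains P where "min_rpoly P x"
proof -
  obtain P where P: "irreducible P" "rpoly P x = 0"
    using assms irreducible_factor_of_root algebraic_iff_rpoly by blast
  have [simp]: "P \<noteq> 0" using P by auto
  define c where "c = inverse (lead_coeff P)"
  have "irreducible (smult c P)"
    using P(1) irreducible_mult_unit_left[of "[:c:]" P]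
    by (simp add: c_def is_unit_const_poly_iff dvd_field_iff)
  moreover have "lead_coeff (smult c P) = 1"
    by (simp add: c_def)
  moreover have "rpoly (smult c P) x = 0"
    using P by (simp add: rpoly_smult)
  ultimately show ?thesis using that unfolding min_rpoly_def by blast
qed

lemma min_rpoly_degree_pos: "min_rpoly P x \<Longrightarrow> degree P > 0"
  by (rule ccontr) (auto simp: min_rpoly_def elim!: degree_eq_zeroE)

lemma min_rpoly_conj: "min_rpoly P x \<Longrightarrow> rpoly P y = 0 \<Longrightarrow> min_rpoly P y"
  by (simp add: min_rpoly_def)

lemma min_rpoly_dvd: "min_rpoly P x \<Longrightarrow> rpoly g x = 0 \<Longrightarrow> P dvd g"
  using irreducible_root_dvd by (auto simp: min_rpoly_def)

text \<open>Separability in characteristic zero: the derivative is nonzero and of smaller degree, so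
  \<open>P\<close> cannot divide it.\<close>

lemma min_rpoly_simple_root:
  assumes "min_rpoly P x"
  shows "rpoly (pderiv P) x \<noteq> 0"
proof
  assume "rpoly (pderiv P) x = 0"
  hence "P dvd pderiv P" using assms by (rule min_rpoly_dvd[rotated])
  moreover have "pderiv P \<noteq> 0"
    using min_rpoly_degree_pos[OF assms] by (simp add: pderiv_eq_0_iff)
  ultimately have "degree P \<le> degree (pderiv P)"
    by (rule dvd_imp_degree_le)
  thus False using min_rpoly_degree_pos[OF assms] by (simp add: degree_pderiv)
qed

definition rroots :: "rat poly \<Rightarrow> complex set" where
  "rroots P = {z. rpoly P z = 0}"

lemma finite_rroots: "P \<noteq> 0 \<Longrightarrow> finite (rroots P)"
  unfolding rroots_def rpoly_def by (intro poly_roots_finite) (simp add: map_poly_eq_0_iff)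

lemma map_poly_of_rat_pderiv: "map_poly of_rat (pderiv p) = pderiv (map_poly of_rat p :: 'a::field_char_0 poly)"
  by (rule poly_eqI) (simp add: coeff_map_poly coeff_pderiv of_rat_mult of_rat_add)

text \<open>The roots are simple, so the set of conjugates loses no multiplicity and products over
  \<open>rroots P\<close> are norms.\<close>

lemma min_rpoly_factor:
  assumes "min_rpoly P x"
  shows "map_poly of_rat P = (\<Prod>z\<in>rroots P. [:-z, 1:])"
    and "card (rroots P) = degree P"
proof -
  let ?P = "map_poly of_rat P :: complex poly"
  have "rsquarefree ?P"
    unfolding rsquarefree_roots
  proof (intro allI notI)
    fix a assume "poly ?P a = 0 \<and> poly (pderiv ?P) a = 0"
    thus False
      using min_rpoly_simple_root[OF min_rpoly_conj[OF assms]]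
      by (metis map_poly_of_rat_pderiv rpoly_def)
  qed
  have lc: "lead_coeff ?P = 1"
    using assms by (simp add: min_rpoly_def degree_map_poly coeff_map_poly)
  from complex_poly_decompose_rsquarefree[OF \<open>rsquarefree ?P\<close>] lc
  show 1: "?P = (\<Prod>z\<in>rroots P. [:-z, 1:])"
    unfolding rroots_def rpoly_def by simp
  have "degree ?P = (\<Sum>z\<in>rroots P. degree [:-z, 1:])"
    unfolding 1 by (rule degree_prod_eq_sum_degree) simp
  thus "card (rroots P) = degree P" by (simp add: degree_map_poly)
qed

text \<open>The product is the resultant of the two polynomials up to sign, and the induction is the
  Euclidean algorithm.\<close>
lemma prod_rpoly_roots_rational:
  assumes "(\<Prod>x\<in>#A. [:-x, 1:]) = map_poly of_rat P"
  shows "(\<Prod>x\<in>#A. rpoly Q x) \<in> \<rat>"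
  using assms
proof (induction "degree Q" arbitrary: A P Q rule: less_induct)
  case less
  show ?case
  proof (cases "degree Q = 0")
    case True
    hence "rpoly Q = (\<lambda>_. of_rat (coeff Q 0))"
      by (intro ext rpoly_degree_0)
    thus ?thesis by simp
  next
    case False
    define c where "c = lead_coeff Q"
    have c: "c \<noteq> 0" using False by (auto simp: c_def)
    \<comment> \<open>\<open>Q\<close> may have repeated roots, so they come as a multiset; the
      statement uses a multiset \<open>A\<close> because the roots of \<open>Q\<close> take its
      place in the induction.\<close>
    obtain B where B: "map_poly of_rat Q = smult (lead_coeff (map_poly of_rat Q)) (\<Prod>x\<in>#B. [:- x, 1:] :: complex poly)"
      using alg_closed_imp_factorization[of "map_poly of_rat Q :: complex poly"] False
      by (metis degree_0 degree_map_poly of_rat_eq_0_iff)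
    have lc: "lead_coeff (map_poly of_rat Q :: complex poly) = of_rat c"
      by (simp add: c_def coeff_map_poly degree_map_poly)
    have Qx: "rpoly Q x = of_rat c * (\<Prod>y\<in>#B. x - y)" for x
      unfolding rpoly_def by (subst B) (simp add: lc poly_prod_mset)
    have Px: "rpoly P y = (\<Prod>x\<in>#A. y - x)" for y
      unfolding rpoly_def by (subst less.prems[symmetric]) (simp add: poly_prod_mset)
    have sw: "(\<Prod>x\<in>#A. \<Prod>y\<in>#B. x - y) = (-1) ^ (size A * size B) * (\<Prod>y\<in>#B. \<Prod>x\<in>#A. y - x)"
    proof -
      have 1: "(\<Prod>y\<in>#B. x - y) = (-1) ^ size B * (\<Prod>y\<in>#B. y - x)" for x :: complex
        by (induction B) (simp_all add: algebra_simps)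
      have 2: "(\<Prod>x\<in>#A. \<Prod>y\<in>#B. y - x) = (\<Prod>y\<in>#B. \<Prod>x\<in>#A. y - x)"
        by (induction A) (simp_all add: prod_mset.distrib)
      have "(\<Prod>x\<in>#A. \<Prod>y\<in>#B. x - y) = ((-1) ^ size B) ^ size A * (\<Prod>x\<in>#A. \<Prod>y\<in>#B. y - x)"
        unfolding 1 by (induction A) simp_all
      thus ?thesis by (simp add: 2 power_mult mult.commute[of "size A"])
    qed
    have root: "rpoly Q y = 0" if "y \<in># B" for y
      using that unfolding Qx by (auto simp: prod_mset_zero_iff)
    \<comment> \<open>The Euclidean step: once the two products are exchanged, \<open>P\<close> is
      only evaluated at roots of \<open>Q\<close>, where its remainder of smaller degree has the
      same values.\<close>
    have PR: "rpoly P y = rpoly (P mod Q) y" if "y \<in># B" for y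
    proof -
      have "rpoly P y = rpoly (P div Q * Q) y + rpoly (P mod Q) y"
        by (metis div_mult_mod_eq rpoly_add)
      thus ?thesis using root[OF that] by (simp add: rpoly_mult)
    qed
    have "degree (P mod Q) < degree Q"
      using False by (metis degree_mod_less' degree_0 neq0_conv)
    moreover have "(\<Prod>x\<in>#B. [:-x, 1:]) = map_poly of_rat (smult (inverse c) Q)"
    proof -
      have "map_poly of_rat (smult (inverse c) Q) = smult (of_rat (inverse c)) (map_poly of_rat Q)"
        by (rule poly_eqI) (simp add: coeff_map_poly of_rat_mult)
      thus ?thesis using c by (subst (asm) B) (simp add: lc of_rat_inverse)
    qed
    ultimately have IH: "(\<Prod>y\<in>#B. rpoly (P mod Q) y) \<in> \<rat>"
      by (rule less.hyps)
    have "(\<Prod>y\<in>#B. rpoly (P mod Q) y) = (\<Prod>y\<in>#B. \<Prod>x\<in>#A. y - x)"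
      unfolding Px[symmetric] using PR by (metis (mono_tags, lifting) image_mset_cong)
    with IH have "(\<Prod>x\<in>#A. \<Prod>y\<in>#B. x - y) \<in> \<rat>"
      by (simp add: sw)
    moreover have "(\<Prod>x\<in>#A. rpoly Q x) = of_rat c ^ size A * (\<Prod>x\<in>#A. \<Prod>y\<in>#B. x - y)"
      unfolding Qx by (induction A) simp_all
    ultimately show ?thesis by simp
  qed
qed

lemma prod_conjugates_rational:
  assumes "min_rpoly P x"
  shows "(\<Prod>z\<in>rroots P. rpoly Q z) \<in> \<rat>"
proof -
  have "P \<noteq> 0" using assms by (auto simp: min_rpoly_def)
  hence "finite (rroots P)" by (rule finite_rroots)
  have "(\<Prod>z\<in>#mset_set (rroots P). [:-z, 1:]) = map_poly of_rat P"
    using min_rpoly_factor(1)[OF assms] by (simp add: prod_unfold_prod_mset)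
  from prod_rpoly_roots_rational[OF this, of Q] show ?thesis
    by (simp add: prod_unfold_prod_mset)
qed

section \<open>Valuation rings and algebraic integers\<close>

definition is_subring :: "'a::field set \<Rightarrow> bool" where
  "is_subring A \<longleftrightarrow> 1 \<in> A \<and> (\<forall>x\<in>A. \<forall>y\<in>A. x - y \<in> A \<and> x * y \<in> A)"

lemma is_subringD:
  assumes "is_subring A"
  shows "1 \<in> A" "0 \<in> A" "x \<in> A \<Longrightarrow> y \<in> A \<Longrightarrow> x - y \<in> A" "x \<in> A \<Longrightarrow> y \<in> A \<Longrightarrow> x * y \<in> A"
    "x \<in> A \<Longrightarrow> -x \<in> A" "x \<in> A \<Longrightarrow> y \<in> A \<Longrightarrow> x + y \<in> A" "x \<in> A \<Longrightarrow> x ^ n \<in> A"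
proof -
  have *: "1 \<in> A" "\<And>x y. x \<in> A \<Longrightarrow> y \<in> A \<Longrightarrow> x - y \<in> A" "\<And>x y. x \<in> A \<Longrightarrow> y \<in> A \<Longrightarrow> x * y \<in> A"
    using assms by (auto simp: is_subring_def)
  have 0: "0 \<in> A" using *(2)[OF *(1) *(1)] by simp
  have neg: "-x \<in> A" if "x \<in> A" for x using *(2)[OF 0 that] by simp
  have add: "x + y \<in> A" if "x \<in> A" "y \<in> A" for x y using *(2)[OF that(1) neg[OF that(2)]] by simp
  have pow: "x ^ n \<in> A" if "x \<in> A" for x n using that * by (induction n) auto
  show "1 \<in> A" "0 \<in> A" "x \<in> A \<Longrightarrow> y \<in> A \<Longrightarrow> x - y \<in> A" "x \<in> A \<Longrightarrow> y \<in> A \<Longrightarrow> x * y \<in> A"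
    "x \<in> A \<Longrightarrow> -x \<in> A" "x \<in> A \<Longrightarrow> y \<in> A \<Longrightarrow> x + y \<in> A" "x \<in> A \<Longrightarrow> x ^ n \<in> A"
    by (simp_all add: * 0 neg add pow)
qed

lemma is_subring_sum: "is_subring A \<Longrightarrow> (\<And>i. i \<in> I \<Longrightarrow> f i \<in> A) \<Longrightarrow> (\<Sum>i\<in>I. f i) \<in> A"
  by (induction I rule: infinite_finite_induct) (auto intro: is_subringD)

lemma is_subring_of_nat: "is_subring A \<Longrightarrow> of_nat n \<in> A"
  by (induction n) (auto intro: is_subringD)

lemma is_subring_of_int: "is_subring A \<Longrightarrow> of_int n \<in> A"
  by (cases n rule: int_cases2) (auto intro: is_subringD is_subring_of_nat)

lemma is_subring_Ints: "is_subring \<int>"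
  by (auto simp: is_subring_def)

definition adjoin :: "'a::field set \<Rightarrow> 'a \<Rightarrow> 'a set" where
  "adjoin A x = {poly p x | p. \<forall>i. coeff p i \<in> A}"

lemma adjoinI: "(\<And>i. coeff p i \<in> A) \<Longrightarrow> poly p x \<in> adjoin A x"
  by (auto simp: adjoin_def)

lemma adjoin_self:
  assumes "is_subring A"
  shows "x \<in> adjoin A x"
proof -
  have "coeff [:0, 1:] i \<in> A" for i
    using is_subringD(1,2)[OF assms] by (simp add: coeff_pCons split: nat.splits)
  from adjoinI[OF this, of x] show ?thesis by simp
qed

lemma subset_adjoin:
  assumes "is_subring A"
  shows "A \<subseteq> adjoin A x"
proof
  fix a assume "a \<in> A"
  hence "coeff [:a:] i \<in> A" for i
    using is_subringD(2)[OF assms] by (simp add: coeff_pCons split: nat.splits)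
  from adjoinI[OF this, of x] show "a \<in> adjoin A x" by simp
qed

lemma is_subring_adjoin:
  assumes "is_subring A"
  shows "is_subring (adjoin A x)"
  unfolding is_subring_def
proof (intro conjI ballI)
  show "1 \<in> adjoin A x" using subset_adjoin[OF assms] is_subringD(1)[OF assms] by blast
  fix a b assume "a \<in> adjoin A x" "b \<in> adjoin A x"
  then obtain p q where pq: "a = poly p x" "b = poly q x" "\<And>i. coeff p i \<in> A" "\<And>i. coeff q i \<in> A"
    by (auto simp: adjoin_def)
  have "coeff (p - q) i \<in> A" for i
    using is_subringD(3)[OF assms pq(3,4)] by simp
  from adjoinI[OF this, of x] show "a - b \<in> adjoin A x" by (simp add: pq(1,2))
  have "coeff (p * q) i \<in> A" for i
    unfolding coeff_mult by (intro is_subring_sum[OF assms] is_subringD(4)[OF assms] pq(3,4))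
  from adjoinI[OF this, of x] show "a * b \<in> adjoin A x" by (simp add: pq(1,2))
qed

text \<open>A valuation ring of the whole type, so for complex numbers it lies above all number
  fields; it is restricted to algebraic numbers only later.\<close>

definition valuation_ring :: "'a::field set \<Rightarrow> bool" where
  "valuation_ring A \<longleftrightarrow> is_subring A \<and> (\<forall>x. x \<in> A \<or> inverse x \<in> A)"

text \<open>Valuation rings are integrally closed: if 1/x is in \<open>A\<close>, the monic equation
  of degree n divided by x^(n-1) expresses x through powers of 1/x.\<close>

lemma algebraic_int_valuation_ring:
  assumes "valuation_ring A" "algebraic_int x"
  shows "x \<in> A"
proof (rule ccontr)
  assume "x \<notin> A"
  have A: "is_subring A" using assms by (simp add: valuation_ring_def)
  have y: "inverse x \<in> A" using \<open>x \<notin> A\<close> assms by (auto simp: valuation_ring_def)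
  have "x \<noteq> 0" using \<open>x \<notin> A\<close> is_subringD(2)[OF A] by auto
  obtain p where p: "lead_coeff p = 1" "\<forall>i. coeff p i \<in> \<int>" "poly p x = 0"
    using assms(2) by (auto simp: algebraic_int.simps)
  define n where "n = degree p"
  have "n > 0"
  proof (rule ccontr)
    assume "\<not> n > 0"
    then obtain c where "p = [:c:]" by (auto simp: n_def elim!: degree_eq_zeroE)
    thus False using p by auto
  qed
  have "0 = (\<Sum>i<n. coeff p i * x ^ i) + x ^ n"
    using p(1,3) by (simp add: poly_altdef n_def[symmetric] lessThan_Suc_atMost[symmetric])
  hence "x ^ n = -(\<Sum>i<n. coeff p i * x ^ i)" by (simp add: eq_neg_iff_add_eq_0 add.commute)
  hence "x ^ n * inverse x ^ (n - 1) = -(\<Sum>i<n. coeff p i * x ^ i * inverse x ^ (n - 1))"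
    by (simp add: sum_distrib_right)
  also have "x ^ n * inverse x ^ (n - 1) = x"
    using \<open>n > 0\<close> \<open>x \<noteq> 0\<close> by (cases n) (simp_all add: power_inverse field_simps)
  also have "(\<Sum>i<n. coeff p i * x ^ i * inverse x ^ (n - 1)) = (\<Sum>i<n. coeff p i * inverse x ^ (n - 1 - i))"
  proof (rule sum.cong)
    fix i assume "i \<in> {..<n}"
    hence "inverse x ^ (n - 1) = inverse x ^ i * inverse x ^ (n - 1 - i)"
      by (simp add: power_add[symmetric])
    thus "coeff p i * x ^ i * inverse x ^ (n - 1) = coeff p i * inverse x ^ (n - 1 - i)"
      using \<open>x \<noteq> 0\<close> by (simp add: power_inverse)
  qed simp
  also have "- \<dots> \<in> A"
  proof (intro is_subringD(5)[OF A] is_subring_sum[OF A] is_subringD(4,7)[OF A] y)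
    fix i show "coeff p i \<in> A"
      using p(2) by (metis A Ints_cases is_subring_of_int)
  qed
  finally show False using \<open>x \<notin> A\<close> by simp
qed

text \<open>Multiplying b = p(1/b) by b^n, with n the degree of p, gives a monic equation of degree
  n + 1. Hence a non-integral b is missing from Z[1/b], which starts the Zorn argument
  below.\<close>

lemma algebraic_int_if_in_adjoin_inverse:
  fixes b :: "'a::field_char_0"
  assumes "b \<in> adjoin \<int> (inverse b)"
  shows "algebraic_int b"
proof (cases "b = 0")
  case False
  obtain p where p: "b = poly p (inverse b)" "\<forall>i. coeff p i \<in> \<int>"
    using assms by (auto simp: adjoin_def)
  define n where "n = degree p"
  \<comment> \<open>The reversed polynomial X^n p(1/X).\<close>
  define r where "r = (\<Sum>i\<le>n. monom (coeff p i) (n - i))"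
  define q where "q = monom 1 (Suc n) - r"
  have "degree r \<le> n" unfolding r_def
    by (intro degree_sum_le) (auto intro: order.trans[OF degree_monom_le])
  hence deg: "degree q = Suc n" and lc: "lead_coeff q = 1"
  proof -
    assume r: "degree r \<le> n"
    hence "degree q = degree (monom (1::'a) (Suc n))"
      unfolding q_def diff_conv_add_uminus
      by (intro degree_add_eq_left) (simp add: degree_monom_eq)
    thus 1: "degree q = Suc n" by (simp add: degree_monom_eq)
    show "lead_coeff q = 1" unfolding 1 using r by (simp add: q_def coeff_eq_0)
  qed
  have "coeff q i \<in> \<int>" for i
    unfolding q_def r_def using p(2) by (auto simp: coeff_sum coeff_monom intro!: Ints_sum)
  moreover have "poly q b = 0"
  proof -
    have "b ^ Suc n = b ^ n * poly p (inverse b)" using p(1) by simp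
    also have "\<dots> = (\<Sum>i\<le>n. coeff p i * b ^ (n - i))"
      unfolding poly_altdef n_def[symmetric] sum_distrib_left
    proof (rule sum.cong)
      fix i assume "i \<in> {..n}"
      hence "b ^ n = b ^ i * b ^ (n - i)" by (simp add: power_add[symmetric])
      thus "b ^ n * (coeff p i * inverse b ^ i) = coeff p i * b ^ (n - i)"
        using False by (simp add: power_inverse)
    qed simp
    finally show ?thesis by (simp add: q_def r_def poly_sum poly_monom)
  qed
  ultimately show ?thesis using lc by (intro algebraic_int.intros[of q]) auto
qed auto

text \<open>A subring maximal among those that contain \<open>1/b\<close> but not \<open>b\<close> is a valuation ring.\<close>
lemma valuation_ring_exists:
  fixes b :: "'a::field_char_0"
  assumes "\<not> algebraic_int b"
  obtains A where "valuation_ring A" "b \<notin> A"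
proof -
  define c where "c = inverse b"
  have "b \<noteq> 0" using assms by auto
  hence bc: "b * c = 1" by (simp add: c_def)
  define F where "F = {A. is_subring A \<and> c \<in> A \<and> b \<notin> A}"
  have "adjoin \<int> c \<in> F"
    using algebraic_int_if_in_adjoin_inverse[of b] assms
    by (auto simp: F_def c_def intro: is_subring_adjoin is_subring_Ints adjoin_self)
  have "\<exists>M\<in>F. \<forall>S\<in>F. M \<subseteq> S \<longrightarrow> S = M"
  proof (rule subset_Zorn_nonempty)
    show "F \<noteq> {}" using \<open>adjoin \<int> c \<in> F\<close> by blast
    fix C assume C: "C \<noteq> {}" "subset.chain F C"
    have CF: "C \<subseteq> F" using C(2) by (auto simp: subset.chain_def)
    have tot: "S \<subseteq> T \<or> T \<subseteq> S" if "S \<in> C" "T \<in> C" for S T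
      using C(2) that by (auto simp: subset.chain_def)
    have "is_subring (\<Union>C)"
      unfolding is_subring_def
    proof (intro conjI ballI)
      show "1 \<in> \<Union>C" using C(1) CF by (auto simp: F_def dest: is_subringD(1))
      fix x y assume "x \<in> \<Union>C" "y \<in> \<Union>C"
      then obtain S where S: "S \<in> C" "x \<in> S" "y \<in> S" using tot by blast
      hence "is_subring S" using CF by (auto simp: F_def)
      from is_subringD(3,4)[OF this S(2,3)] S(1)
      show "x - y \<in> \<Union>C" "x * y \<in> \<Union>C" by blast+
    qed
    thus "\<Union>C \<in> F" using C(1) CF by (auto simp: F_def)
  qed
  then obtain A where "A \<in> F" and max: "\<And>S. S \<in> F \<Longrightarrow> A \<subseteq> S \<Longrightarrow> S = A" by blast
  hence A: "is_subring A" "c \<in> A" "b \<notin> A" by (auto simp: F_def)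
  have b_adjoin: "b \<in> adjoin A x" if "x \<notin> A" for x
  proof (rule ccontr)
    assume "b \<notin> adjoin A x"
    hence "adjoin A x \<in> F"
      using A subset_adjoin[OF A(1)] is_subring_adjoin[OF A(1)] by (auto simp: F_def)
    from max[OF this subset_adjoin[OF A(1)]] that adjoin_self[OF A(1)] show False by blast
  qed
  have one_minus: "\<exists>a'\<in>A. (1 - c * a) ^ n = 1 - c * a'" if "a \<in> A" for a n
  proof (induction n)
    case 0
    show ?case using is_subringD(2)[OF A(1)] by (auto intro!: bexI[of _ 0])
  next
    case (Suc n)
    then obtain a' where a': "a' \<in> A" "(1 - c * a) ^ n = 1 - c * a'" by blast
    have "(1 - c * a) ^ Suc n = 1 - c * (a + a' - c * a * a')"
      unfolding power_Suc a'(2) by (simp add: algebra_simps)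
    moreover have "a + a' - c * a * a' \<in> A"
      using A that a' by (auto intro!: is_subringD)
    ultimately show ?case by blast
  qed
  \<comment> \<open>Elements of 1 + cA are units of \<open>A\<close>. If u is one and 1/u is
    missing, then b is a polynomial in 1/u over \<open>A\<close>, so b u^n lies in \<open>A\<close>
    for some n. But u^n is again of the form 1 - c a', and b (1 - c a') = b - a' is outside
    \<open>A\<close>.\<close>
  have unit: "inverse (1 - c * a) \<in> A" "1 - c * a \<noteq> 0" if a: "a \<in> A" for a
  proof -
    have no: "b * (1 - c * a') \<notin> A" if "a' \<in> A" for a'
    proof
      assume "b * (1 - c * a') \<in> A"
      also have "b * (1 - c * a') = b - a'"
        using bc by (simp add: algebra_simps mult.assoc[symmetric])
      finally have "(b - a') + a' \<in> A" using that A(1) by (blast intro: is_subringD(6))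
      thus False using A(3) by simp
    qed
    show nz: "1 - c * a \<noteq> 0" using no[OF a] is_subringD(2)[OF A(1)] by auto
    show "inverse (1 - c * a) \<in> A"
    proof (rule ccontr)
      define u where "u = 1 - c * a"
      assume "inverse (1 - c * a) \<notin> A"
      then obtain p where p: "b = poly p (inverse u)" "\<forall>i. coeff p i \<in> A"
        using b_adjoin[of "inverse u"] by (auto simp: adjoin_def u_def)
      define n where "n = degree p"
      have uA: "u \<in> A" using A a by (auto simp: u_def intro: is_subringD)
      have "u \<noteq> 0" using nz by (simp add: u_def)
      have "b * u ^ n = (\<Sum>i\<le>n. coeff p i * u ^ (n - i))"
        unfolding p(1) poly_altdef n_def[symmetric] sum_distrib_right
      proof (rule sum.cong)
        fix i assume "i \<in> {..n}"
        hence "u ^ n = u ^ i * u ^ (n - i)" by (simp add: power_add[symmetric])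
        thus "coeff p i * inverse u ^ i * u ^ n = coeff p i * u ^ (n - i)"
          using \<open>u \<noteq> 0\<close> by (simp add: power_inverse)
      qed simp
      also have "\<dots> \<in> A" using p(2) uA by (intro is_subring_sum is_subringD A) auto
      finally have "b * u ^ n \<in> A" .
      moreover obtain a' where "a' \<in> A" "u ^ n = 1 - c * a'"
        using one_minus[OF a, of n] by (auto simp: u_def)
      ultimately show False using no by auto
    qed
  qed
  \<comment> \<open>Chevalley's descent on the total degree. Multiplying b = q(y) by c = 1/b shows
    that the unit 1 - c q_0 is c times the non-constant part of q(y). Times x^n, with n at least the
    degree of q, this writes x^n as a combination of lower powers of x over \<open>A\<close>, and
    the leading term of p can be replaced. The roles of x and y are symmetric, so the longer
    polynomial is the one shortened.\<close>
  have key: False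
    if "x * y = 1" "\<forall>i. coeff p i \<in> A" "\<forall>i. coeff q i \<in> A" "degree p + degree q = N"
      "b = poly p x" "b = poly q y" for x y p q N
    using that
  proof (induction N arbitrary: x y p q rule: less_induct)
    case (less N)
    have main: False
      if xy: "x * y = 1" and p: "\<forall>i. coeff p i \<in> A" and q: "\<forall>i. coeff q i \<in> A"
        and N: "degree p + degree q = N" and bp: "b = poly p x" and bq: "b = poly q y"
        and le: "degree q \<le> degree p" for p q x y
    proof (cases "degree p = 0")
      case True
      hence "b = coeff p 0" using bp by (auto elim!: degree_eq_zeroE)
      thus False using p A(3) by auto
    next
      case False
      define n m where "n = degree p" and "m = degree q"
      define u where "u = inverse (1 - c * coeff q 0)"
      have uA: "u \<in> A" and u: "u * (1 - c * coeff q 0) = 1"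
        using unit[of "coeff q 0"] q by (auto simp: u_def)
      have "b = (\<Sum>i\<in>{..m}. coeff q i * y ^ i)"
        by (simp add: bq poly_altdef m_def)
      also have "{..m} = insert 0 {1..m}" by auto
      also have "(\<Sum>i\<in>\<dots>. coeff q i * y ^ i) = coeff q 0 + (\<Sum>i=1..m. coeff q i * y ^ i)"
        by simp
      finally have "c * b = c * coeff q 0 + c * (\<Sum>i=1..m. coeff q i * y ^ i)"
        by (simp add: algebra_simps)
      hence "1 - c * coeff q 0 = c * (\<Sum>i=1..m. coeff q i * y ^ i)"
        using bc by (simp add: algebra_simps)
      hence 1: "1 = u * (c * (\<Sum>i=1..m. coeff q i * y ^ i))"
        using u by simp
      have xn: "x ^ n = (\<Sum>i=1..m. u * c * coeff q i * x ^ (n - i))"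
      proof -
        have "x ^ n = x ^ n * (u * (c * (\<Sum>i=1..m. coeff q i * y ^ i)))"
          using 1 by simp
        also have "\<dots> = (\<Sum>i=1..m. x ^ n * (u * (c * (coeff q i * y ^ i))))"
          by (simp add: sum_distrib_left)
        also have "\<dots> = (\<Sum>i=1..m. u * c * coeff q i * x ^ (n - i))"
        proof (rule sum.cong)
          fix i assume "i \<in> {1..m}"
          hence "x ^ n = x ^ (n - i) * x ^ i"
            using le by (simp add: power_add[symmetric] n_def m_def)
          moreover have "x ^ i * y ^ i = 1" using xy by (simp add: power_mult_distrib[symmetric])
          ultimately have "x ^ n * y ^ i = x ^ (n - i)" by (simp add: mult.assoc)
          thus "x ^ n * (u * (c * (coeff q i * y ^ i))) = u * c * coeff q i * x ^ (n - i)"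
            by (metis (no_types, lifting) mult.assoc mult.commute)
        qed simp
        finally show ?thesis .
      qed
      define a where "a = lead_coeff p"
      define s where "s = (\<Sum>i=1..m. monom (a * u * c * coeff q i) (n - i))"
      define p' where "p' = (p - monom a n) + s"
      have "degree s \<le> n - 1" unfolding s_def
        by (intro degree_sum_le) (auto intro: order.trans[OF degree_monom_le])
      moreover have "degree (p - monom a n) \<le> n - 1"
      proof (rule degree_le, intro allI impI)
        fix i assume "i > n - 1"
        show "coeff (p - monom a n) i = 0"
        proof (cases "i = n")
          case True thus ?thesis by (simp add: a_def n_def)
        next
          case False
          with \<open>i > n - 1\<close> show ?thesis by (simp add: n_def coeff_eq_0)
        qed
      qed
      ultimately have "degree p' \<le> n - 1" unfolding p'_def by (rule degree_add_le[rotated])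
      hence lt: "degree p' + degree q < N" using False N by (simp add: n_def)
      have "poly s x = a * x ^ n"
        unfolding s_def xn by (simp add: poly_sum poly_monom sum_distrib_left mult_ac)
      hence bp': "b = poly p' x" using bp by (simp add: p'_def poly_monom)
      have aA: "a \<in> A" using p by (simp add: a_def)
      have p'A: "\<forall>i. coeff p' i \<in> A"
      proof
        fix i
        have "coeff s i \<in> A" unfolding s_def coeff_sum coeff_monom
          using uA A(1,2) q aA by (intro is_subring_sum[OF A(1)]) (auto intro: is_subringD)
        thus "coeff p' i \<in> A" using p aA A(1)
          unfolding p'_def by (auto simp: coeff_monom intro!: is_subringD)
      qed
      show False by (rule less.IH[OF lt xy p'A q refl bp' bq])
    qed
    show False
    proof (cases "degree q \<le> degree p")
      case True thus False using main less.prems by blast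
    next
      case False
      have "y * x = 1" "degree q + degree p = N" using less.prems by (simp_all add: mult.commute add.commute)
      thus False using main[of y x q p] less.prems False by auto
    qed
  qed
  have "x \<in> A \<or> inverse x \<in> A" for x
  proof (rule ccontr)
    assume *: "\<not> (x \<in> A \<or> inverse x \<in> A)"
    hence "x \<noteq> 0" using is_subringD(2)[OF A(1)] by auto
    obtain p where "b = poly p x" "\<forall>i. coeff p i \<in> A" using b_adjoin[of x] * by (auto simp: adjoin_def)
    moreover obtain q where "b = poly q (inverse x)" "\<forall>i. coeff q i \<in> A"
      using b_adjoin[of "inverse x"] * by (auto simp: adjoin_def)
    moreover have "x * inverse x = 1" using \<open>x \<noteq> 0\<close> by simp
    ultimately show False using key by blast
  qed
  hence "valuation_ring A" using A by (simp add: valuation_ring_def)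
  thus ?thesis using that A(3) by blast
qed

text \<open>The integral closure of the integers is an intersection of rings, so closure under sums
  and products is checked in each valuation ring separately.\<close>

lemma algebraic_int_iff_valuation_rings:
  fixes x :: "'a::field_char_0"
  shows "algebraic_int x \<longleftrightarrow> (\<forall>A. valuation_ring A \<longrightarrow> x \<in> A)"
  using valuation_ring_exists algebraic_int_valuation_ring by metis

lemma algebraic_int_add:
  "algebraic_int x \<Longrightarrow> algebraic_int y \<Longrightarrow> algebraic_int (x + y :: 'a::field_char_0)"
  by (auto simp: algebraic_int_iff_valuation_rings valuation_ring_def intro: is_subringD)

lemma algebraic_int_mult:
  "algebraic_int x \<Longrightarrow> algebraic_int y \<Longrightarrow> algebraic_int (x * y :: 'a::field_char_0)"
  by (auto simp: algebraic_int_iff_valuation_rings valuation_ring_def intro: is_subringD)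

lemma algebraic_int_power:
  "algebraic_int x \<Longrightarrow> algebraic_int (x ^ n :: 'a::field_char_0)"
  by (induction n) (auto intro: algebraic_int_mult)

lemma algebraic_int_sum:
  "(\<And>i. i \<in> I \<Longrightarrow> algebraic_int (f i)) \<Longrightarrow> algebraic_int (\<Sum>i\<in>I. f i :: 'a::field_char_0)"
  by (induction I rule: infinite_finite_induct) (auto intro: algebraic_int_add)

lemma algebraic_int_prod:
  "(\<And>i. i \<in> I \<Longrightarrow> algebraic_int (f i)) \<Longrightarrow> algebraic_int (\<Prod>i\<in>I. f i :: 'a::field_char_0)"
  by (induction I rule: infinite_finite_induct) (auto intro: algebraic_int_mult)

text \<open>The multiplier is the absolute value of the leading coefficient a of an integral
  equation. If a x were outside a valuation ring, y = 1/(a x) would be inside, and the equation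
  times (a y)^(n-1) would express a x through a and y.\<close>

lemma algebraic_int_multiple:
  fixes x :: "'a::field_char_0"
  assumes "algebraic x"
  obtains n :: nat where "n > 0" "algebraic_int (of_nat n * x)"
proof -
  obtain p where p: "\<forall>i. coeff p i \<in> \<int>" "p \<noteq> 0" "poly p x = 0"
    using assms by (auto simp: algebraic_def)
  define a where "a = lead_coeff p"
  have a: "a \<noteq> 0" using p by (simp add: a_def)
  have "a * x \<in> A" if A: "valuation_ring A" for A :: "'a set"
  proof (rule ccontr)
    assume ax: "a * x \<notin> A"
    have sA: "is_subring A" using A by (simp add: valuation_ring_def)
    define y where "y = inverse (a * x)"
    have y: "y \<in> A" using ax A by (auto simp: valuation_ring_def y_def)
    have nz: "a * x \<noteq> 0" using ax is_subringD(2)[OF sA] by auto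
    hence "x \<noteq> 0" by auto
    define n where "n = degree p"
    have "n > 0"
    proof (rule ccontr)
      assume "\<not> n > 0"
      then obtain c where "p = [:c:]" by (auto simp: n_def elim!: degree_eq_zeroE)
      thus False using p by auto
    qed
    have aI: "coeff p i \<in> A" for i
      using p(1) by (metis sA Ints_cases is_subring_of_int)
    have aA: "a \<in> A" using aI by (simp add: a_def)
    have "0 = (\<Sum>i<n. coeff p i * x ^ i) + a * x ^ n"
      using p(3) by (simp add: poly_altdef n_def a_def lessThan_Suc_atMost[symmetric])
    hence "a * x ^ n = -(\<Sum>i<n. coeff p i * x ^ i)" by (simp add: eq_neg_iff_add_eq_0 add.commute)
    hence "a ^ (n - 1) * y ^ (n - 1) * (a * x ^ n) = -(\<Sum>i<n. a ^ (n - 1) * y ^ (n - 1) * (coeff p i * x ^ i))"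
      by (simp add: sum_distrib_left)
    also have "a ^ (n - 1) * y ^ (n - 1) * (a * x ^ n) = a * x"
      using \<open>n > 0\<close> nz by (cases n) (simp_all add: y_def power_inverse field_simps)
    also have "(\<Sum>i<n. a ^ (n - 1) * y ^ (n - 1) * (coeff p i * x ^ i)) =
        (\<Sum>i<n. coeff p i * a ^ (n - 1 - i) * y ^ (n - 1 - i))"
    proof (rule sum.cong)
      fix i assume "i \<in> {..<n}"
      hence "n - 1 = i + (n - 1 - i)" by simp
      hence "a ^ (n - 1) * y ^ (n - 1) = a ^ i * a ^ (n - 1 - i) * (y ^ i * y ^ (n - 1 - i))"
        by (metis power_add)
      moreover have "a * y * x = 1"
        using nz by (simp add: y_def field_simps)
      hence "a ^ i * y ^ i * x ^ i = 1"
        by (metis power_mult_distrib power_one)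
      ultimately show "a ^ (n - 1) * y ^ (n - 1) * (coeff p i * x ^ i) = coeff p i * a ^ (n - 1 - i) * y ^ (n - 1 - i)"
        by (simp add: algebra_simps)
    qed simp
    also have "- \<dots> \<in> A"
      by (intro is_subringD[OF sA] is_subring_sum[OF sA] aI aA y)
    finally show False using ax by simp
  qed
  hence ai: "algebraic_int (a * x)" by (simp add: algebraic_int_iff_valuation_rings)
  obtain k where k: "a = of_int k" using p(1) by (auto simp: a_def elim: Ints_cases)
  hence "k \<noteq> 0" using a by auto
  have "algebraic_int (of_nat (nat \<bar>k\<bar>) * x)"
    using ai k by (cases "k \<ge> 0") simp_all
  thus ?thesis using that[of "nat \<bar>k\<bar>"] \<open>k \<noteq> 0\<close> by simp
qed

lemma algebraic_of_multiple:
  fixes x :: "'a::field_char_0"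
  assumes "n > 0" "algebraic_int (of_nat n * x)"
  shows "algebraic x"
proof -
  obtain p where p: "lead_coeff p = 1" "\<forall>i. coeff p i \<in> \<int>" "poly p (of_nat n * x) = 0"
    using assms(2) by (auto simp: algebraic_int.simps)
  define q where "q = pcompose p [:0, of_nat n:]"
  have "poly q x = 0" using p by (simp add: q_def poly_pcompose mult.commute)
  moreover have "coeff q i \<in> \<int>" for i
    using p(2) by (auto simp: q_def coeff_pcompose_linear)
  moreover have "q \<noteq> 0" using p(1) assms(1) by (auto simp: q_def pcompose_eq_0_iff)
  ultimately show ?thesis by (auto simp: algebraic_def)
qed

lemma algebraic_mult:
  fixes x y :: "'a::field_char_0"
  assumes "algebraic x" "algebraic y"
  shows "algebraic (x * y)"
proof -
  obtain n m :: nat where nm: "n > 0" "algebraic_int (of_nat n * x)" "m > 0" "algebraic_int (of_nat m * y)"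
    using algebraic_int_multiple assms by metis
  hence "algebraic_int (of_nat (n * m) * (x * y))"
    using algebraic_int_mult[of "of_nat n * x" "of_nat m * y"] by (simp add: mult_ac)
  thus ?thesis using algebraic_of_multiple[of "n * m"] nm by simp
qed

lemma algebraic_add:
  fixes x y :: "'a::field_char_0"
  assumes "algebraic x" "algebraic y"
  shows "algebraic (x + y)"
proof -
  obtain n m :: nat where nm: "n > 0" "algebraic_int (of_nat n * x)" "m > 0" "algebraic_int (of_nat m * y)"
    using algebraic_int_multiple assms by metis
  have "algebraic_int (of_nat m * (of_nat n * x) + of_nat n * (of_nat m * y))"
    using nm algebraic_int_mult[OF algebraic_int_of_nat] by (intro algebraic_int_add) blast+
  hence "algebraic_int (of_nat (n * m) * (x + y))" by (simp add: algebra_simps)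
  thus ?thesis using algebraic_of_multiple[of "n * m"] nm by simp
qed

section \<open>Absolute values on fields of algebraic numbers\<close>

text \<open>If b < a, then (b/a)^n times a linear factor tends to zero. This removes the factors of
  order n left over when an n-th power is estimated by a binomial or digit expansion.\<close>

lemma le_if_power_le_linear:
  fixes a b C :: real
  assumes "a \<ge> 0" "b \<ge> 0" "\<And>n. a ^ n \<le> C * (real n + 1) * b ^ n"
  shows "a \<le> b"
proof (rule ccontr)
  assume "\<not> a \<le> b"
  hence ab: "b < a" by simp
  hence a: "a > 0" using assms(2) by simp
  define x where "x = b / a"
  have x: "0 \<le> x" "x < 1" using ab a assms(2) by (auto simp: x_def)
  have "(\<lambda>n. real n * x ^ n) \<longlonglongrightarrow> 0"
    using powser_times_n_limit_0[of x] x by simp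
  moreover have "(\<lambda>n. x ^ n) \<longlonglongrightarrow> 0" using x by (intro LIMSEQ_realpow_zero) auto
  ultimately have "(\<lambda>n. C * (real n * x ^ n + x ^ n)) \<longlonglongrightarrow> C * (0 + 0)"
    by (intro tendsto_mult tendsto_add tendsto_const)
  hence "(\<lambda>n. C * (real n * x ^ n + x ^ n)) \<longlonglongrightarrow> 0" by simp
  moreover have "1 \<le> C * (real n * x ^ n + x ^ n)" for n
  proof -
    have "1 = a ^ n / a ^ n" using a by simp
    also have "\<dots> \<le> (C * (real n + 1) * b ^ n) / a ^ n"
      using assms(3)[of n] a by (intro divide_right_mono) auto
    also have "\<dots> = C * (real n * x ^ n + x ^ n)"
      by (simp add: x_def power_divide algebra_simps add_divide_distrib)
    finally show ?thesis .
  qed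
  ultimately have "1 \<le> (0::real)" by (intro LIMSEQ_le_const) auto
  thus False by simp
qed

text \<open>The level at which Ostrowski's theorem and the integrality criterion are proved; finite
  degree enters with \<open>prim_field\<close>.\<close>

locale alg_field =
  fixes K :: "complex set"
  assumes one_K: "1 \<in> K"
    and diff_K: "x \<in> K \<Longrightarrow> y \<in> K \<Longrightarrow> x - y \<in> K"
    and mult_K: "x \<in> K \<Longrightarrow> y \<in> K \<Longrightarrow> x * y \<in> K"
    and inverse_K: "x \<in> K \<Longrightarrow> inverse x \<in> K"
    and algebraic_K: "x \<in> K \<Longrightarrow> algebraic x"
begin

lemma is_subring_K: "is_subring K"
  using one_K diff_K mult_K by (auto simp: is_subring_def)

lemmas K_subring = is_subringD[OF is_subring_K] is_subring_of_nat[OF is_subring_K]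
  is_subring_of_int[OF is_subring_K]

lemma divide_K: "x \<in> K \<Longrightarrow> y \<in> K \<Longrightarrow> x / y \<in> K"
  unfolding divide_inverse by (intro mult_K inverse_K)

lemma of_rat_K: "of_rat q \<in> K"
  by (cases q) (simp add: of_rat_rat divide_K K_subring)

lemma powi_K: "x \<in> K \<Longrightarrow> x powi n \<in> K"
  by (auto simp: power_int_def intro: K_subring inverse_K)

end

locale abs_val = alg_field +
  fixes f :: "complex \<Rightarrow> real"
  assumes f: "f \<in> abs_values K"
begin

lemma f_nonneg: "x \<in> K \<Longrightarrow> f x \<ge> 0"
  and f_eq_0_iff: "x \<in> K \<Longrightarrow> f x = 0 \<longleftrightarrow> x = 0"
  and f_mult: "x \<in> K \<Longrightarrow> y \<in> K \<Longrightarrow> f (x * y) = f x * f y"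
  and f_triangle: "x \<in> K \<Longrightarrow> y \<in> K \<Longrightarrow> f (x + y) \<le> f x + f y"
  using f by (auto simp: abs_values_def)

lemma f_0: "f 0 = 0" using f_eq_0_iff[of 0] K_subring by simp

lemma f_pos: "x \<in> K \<Longrightarrow> x \<noteq> 0 \<Longrightarrow> f x > 0"
  using f_nonneg[of x] f_eq_0_iff[of x] by linarith

lemma f_1: "f 1 = 1"
  using f_mult[OF one_K one_K] f_pos[OF one_K] by simp

lemma f_power: "x \<in> K \<Longrightarrow> f (x ^ n) = f x ^ n"
  by (induction n) (simp_all add: f_1 f_mult K_subring)

lemma f_minus_one: "f (-1) = 1"
proof -
  have "f (-1) * f (-1) = 1" using f_mult[of "-1" "-1"] K_subring f_1 by simp
  hence "(f (-1) - 1) * (f (-1) + 1) = 0" by (simp add: algebra_simps)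
  moreover have "f (-1) \<ge> 0" by (intro f_nonneg K_subring)
  ultimately show ?thesis by simp
qed

lemma f_uminus: "x \<in> K \<Longrightarrow> f (-x) = f x"
  using f_mult[of "-1" x] K_subring f_minus_one by simp

lemma f_inverse: "x \<in> K \<Longrightarrow> f (inverse x) = inverse (f x)"
proof (cases "x = 0")
  case False
  assume x: "x \<in> K"
  have "f x * f (inverse x) = 1"
    using f_mult[OF x inverse_K[OF x]] False f_1 by simp
  thus ?thesis using inverse_unique by metis
qed (simp add: f_0)

lemma f_divide: "x \<in> K \<Longrightarrow> y \<in> K \<Longrightarrow> f (x / y) = f x / f y"
  unfolding divide_inverse by (simp add: f_mult inverse_K f_inverse)

lemma f_sum: "(\<And>i. i \<in> I \<Longrightarrow> g i \<in> K) \<Longrightarrow> f (\<Sum>i\<in>I. g i) \<le> (\<Sum>i\<in>I. f (g i))"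
proof (induction I rule: infinite_finite_induct)
  case (insert i I)
  have "f (g i + (\<Sum>i\<in>I. g i)) \<le> f (g i) + f (\<Sum>i\<in>I. g i)"
    using insert.prems by (intro f_triangle is_subring_sum[OF is_subring_K]) auto
  with insert show ?case by simp
qed (simp_all add: f_0)

lemma f_of_nat_le: "f (of_nat n) \<le> real n"
proof (induction n)
  case (Suc n)
  have "f (of_nat n + 1) \<le> f (of_nat n) + f 1" by (intro f_triangle K_subring)
  with Suc show ?case by (simp add: f_1 add.commute)
qed (simp add: f_0)

lemma f_of_int: "f (of_int k) = f (of_nat (nat \<bar>k\<bar>))"
proof (cases "k \<ge> 0")
  case False
  hence "(of_int k :: complex) = - of_nat (nat \<bar>k\<bar>)" by simp
  thus ?thesis using f_uminus K_subring(8) by metis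
qed simp

lemma f_binomial:
  assumes "x \<in> K" "y \<in> K"
  shows "f (x + y) ^ n \<le> (\<Sum>k\<le>n. f (of_nat (n choose k)) * f x ^ k * f y ^ (n - k))"
proof -
  have "f (x + y) ^ n = f ((x + y) ^ n)" using assms by (simp add: f_power K_subring)
  also have "\<dots> = f (\<Sum>k\<le>n. of_nat (n choose k) * x ^ k * y ^ (n - k))"
    by (simp add: binomial_ring)
  also have "\<dots> \<le> (\<Sum>k\<le>n. f (of_nat (n choose k) * x ^ k * y ^ (n - k)))"
    using assms by (intro f_sum K_subring) auto
  also have "\<dots> = (\<Sum>k\<le>n. f (of_nat (n choose k)) * f x ^ k * f y ^ (n - k))"
    using assms by (intro sum.cong) (simp_all add: f_mult f_power K_subring)
  finally show ?thesis .
qed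

definition ultrametric :: bool where
  "ultrametric \<longleftrightarrow> (\<forall>x\<in>K. \<forall>y\<in>K. f (x + y) \<le> max (f x) (f y))"

text \<open>Binomial coefficients have value at most 1, so f(x + y)^n is at most (n + 1) M^n with M
  the maximum of f(x) and f(y); n-th roots give the claim.\<close>

lemma ultrametricI:
  assumes "\<And>n. f (of_nat n) \<le> 1"
  shows ultrametric
  unfolding ultrametric_def
proof (intro ballI)
  fix x y assume xy: "x \<in> K" "y \<in> K"
  define M where "M = max (f x) (f y)"
  have M: "M \<ge> 0" "f x \<le> M" "f y \<le> M" using f_nonneg[OF xy(1)] by (auto simp: M_def)
  show "f (x + y) \<le> max (f x) (f y)"
    unfolding M_def[symmetric]
  proof (rule le_if_power_le_linear[where C = 1])
    show "f (x + y) \<ge> 0" using xy by (intro f_nonneg K_subring)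
    fix n
    have "f (x + y) ^ n \<le> (\<Sum>k\<le>n. f (of_nat (n choose k)) * f x ^ k * f y ^ (n - k))"
      by (rule f_binomial[OF xy])
    also have "\<dots> \<le> (\<Sum>k\<le>n. 1 * M ^ k * M ^ (n - k))"
      using M xy assms by (intro sum_mono mult_mono power_mono) (auto intro!: f_nonneg K_subring mult_nonneg_nonneg zero_le_power)
    also have "\<dots> = (\<Sum>k\<le>n. M ^ n)" by (intro sum.cong) (simp_all add: power_add[symmetric])
    finally show "f (x + y) ^ n \<le> 1 * (real n + 1) * M ^ n" by (simp add: add.commute)
  qed fact
qed

lemma ultrametricD:
  assumes ultrametric "x \<in> K" "y \<in> K"
  shows "f (x + y) \<le> max (f x) (f y)"
  using assms by (auto simp: ultrametric_def)

lemma ultrametric_of_nat: "ultrametric \<Longrightarrow> f (of_nat n) \<le> 1"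
proof (induction n)
  case (Suc n)
  have "f (of_nat n + 1) \<le> max (f (of_nat n)) (f 1)"
    by (rule ultrametricD) (use Suc in \<open>auto simp: K_subring\<close>)
  with Suc show ?case by (simp add: f_1 add.commute)
qed (simp add: f_0)

lemma ultrametric_of_int: "ultrametric \<Longrightarrow> f (of_int n) \<le> 1"
  unfolding f_of_int[of n] by (rule ultrametric_of_nat)

lemma ultrametric_sum:
  assumes ultrametric "\<And>i. i \<in> I \<Longrightarrow> g i \<in> K" "\<And>i. i \<in> I \<Longrightarrow> f (g i) \<le> M" "M \<ge> 0"
  shows "f (\<Sum>i\<in>I. g i) \<le> M"
  using assms
proof (induction I rule: infinite_finite_induct)
  case (insert i I)
  have "f (g i + (\<Sum>i\<in>I. g i)) \<le> max (f (g i)) (f (\<Sum>i\<in>I. g i))"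
    using insert.prems by (intro ultrametricD is_subring_sum[OF is_subring_K]) auto
  also have "\<dots> \<le> M" using insert by simp
  finally show ?case using insert.hyps by simp
qed (simp_all add: f_0)

text \<open>If f(x) > 1, the leading term would strictly dominate all others in the equation of
  x.\<close>

lemma ultrametric_le_1_of_monic:
  assumes ultrametric "x \<in> K" "p \<noteq> 0" "poly p x = 0" "lead_coeff p = 1"
    and p: "\<And>i. coeff p i \<in> K \<and> f (coeff p i) \<le> 1"
  shows "f x \<le> 1"
proof (rule ccontr)
  assume "\<not> f x \<le> 1"
  hence x: "f x > 1" by simp
  define n where "n = degree p"
  have "n > 0"
  proof (rule ccontr)
    assume "\<not> n > 0"
    then obtain c where "p = [:c:]" by (auto simp: n_def elim!: degree_eq_zeroE)
    thus False using assms by auto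
  qed
  have sK: "(\<Sum>i<n. coeff p i * x ^ i) \<in> K"
    using p assms(2) by (intro is_subring_sum[OF is_subring_K] K_subring) auto
  have "0 = (\<Sum>i<n. coeff p i * x ^ i) + x ^ n"
    using assms by (simp add: poly_altdef n_def[symmetric] lessThan_Suc_atMost[symmetric])
  hence "x ^ n = -(\<Sum>i<n. coeff p i * x ^ i)" by (simp add: eq_neg_iff_add_eq_0 add.commute)
  hence "f x ^ n = f (\<Sum>i<n. coeff p i * x ^ i)"
    using f_power[OF assms(2), of n] f_uminus[OF sK] by simp
  also have "\<dots> \<le> f x ^ (n - 1)"
  proof (rule ultrametric_sum)
    fix i assume i: "i \<in> {..<n}"
    show "coeff p i * x ^ i \<in> K" using p assms by (intro K_subring) auto
    have "f (coeff p i * x ^ i) = f (coeff p i) * f x ^ i"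
      using p assms by (simp add: f_mult f_power K_subring)
    also have "\<dots> \<le> 1 * f x ^ i" using p x by (intro mult_right_mono) auto
    also have "\<dots> \<le> f x ^ (n - 1)" using i x by (auto intro: power_increasing)
    finally show "f (coeff p i * x ^ i) \<le> f x ^ (n - 1)" .
  qed (use x assms in auto)
  finally have "f x ^ n \<le> f x ^ (n - 1)" .
  moreover have "f x ^ (n - 1) < f x ^ n" using x \<open>n > 0\<close> by (intro power_strict_increasing) auto
  ultimately show False by simp
qed

lemma ultrametric_algebraic_int:
  assumes ultrametric "x \<in> K" "algebraic_int x"
  shows "f x \<le> 1"
proof -
  obtain p where p: "lead_coeff p = 1" "\<forall>i. coeff p i \<in> \<int>" "poly p x = 0"
    using assms(3) by (auto simp: algebraic_int.simps)
  have "coeff p i \<in> K \<and> f (coeff p i) \<le> 1" for i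
    using p(2) ultrametric_of_int[OF assms(1)] by (metis Ints_cases K_subring(9))
  moreover have "p \<noteq> 0" using p by auto
  ultimately show ?thesis using ultrametric_le_1_of_monic[OF assms(1,2)] p by blast
qed

text \<open>Expansion in base \<open>n\<close>: there are at most t + 1 digits, each of value at
  most \<open>n\<close>.\<close>

lemma f_digits:
  assumes "n \<ge> 2" "N < n ^ Suc t"
  shows "f (of_nat N) \<le> real (Suc t) * real n * max 1 (f (of_nat n)) ^ t"
  using assms(2)
proof (induction t arbitrary: N)
  case 0
  have "f (of_nat N) \<le> real N" by (rule f_of_nat_le)
  also have "\<dots> \<le> real n" using 0 by simp
  finally show ?case by simp
next
  case (Suc t)
  define M where "M = max 1 (f (of_nat n))"
  have M: "M \<ge> 1" "f (of_nat n) \<le> M" by (auto simp: M_def)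
  have "N div n < n ^ Suc t"
    using Suc.prems assms(1) by (simp add: less_mult_imp_div_less mult.commute)
  hence IH: "f (of_nat (N div n)) \<le> real (Suc t) * real n * M ^ t"
    using Suc.IH by (simp add: M_def)
  have "(of_nat N :: complex) = of_nat (n * (N div n) + N mod n)" by simp
  also have "\<dots> = of_nat n * of_nat (N div n) + of_nat (N mod n)"
    by (simp only: of_nat_add of_nat_mult)
  finally have "f (of_nat N) = f (of_nat n * of_nat (N div n) + of_nat (N mod n))"
    by (rule arg_cong)
  also have "\<dots> \<le> f (of_nat n * of_nat (N div n)) + f (of_nat (N mod n))"
    by (intro f_triangle mult_K K_subring(8))
  also have "f (of_nat n * of_nat (N div n)) = f (of_nat n) * f (of_nat (N div n))"
    by (intro f_mult K_subring(8))
  also have "f (of_nat n) * f (of_nat (N div n)) + f (of_nat (N mod n)) \<le> M * (real (Suc t) * real n * M ^ t) + real n"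
  proof (intro add_mono mult_mono IH M)
    have "f (of_nat (N mod n)) \<le> real (N mod n)" by (rule f_of_nat_le)
    also have "\<dots> \<le> real n" using assms(1) by (simp add: less_imp_le)
    finally show "f (of_nat (N mod n)) \<le> real n" .
    show "0 \<le> M" using M by simp
    show "0 \<le> f (of_nat (N div n))" by (intro f_nonneg K_subring(8))
  qed
  also have "\<dots> \<le> M * (real (Suc t) * real n * M ^ t) + real n * M ^ Suc t"
    using mult_left_mono[OF one_le_power[OF M(1), of "Suc t"], of "real n"] by simp
  also have "\<dots> = real (Suc (Suc t)) * real n * M ^ Suc t" by (simp add: algebra_simps)
  finally show ?case by (simp add: M_def)
qed

text \<open>Ostrowski's comparison: m^k has about k log_n m digits in base \<open>n\<close>, and the
  k-th root of the digit bound tends to the claimed one.\<close>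

lemma f_of_nat_compare:
  assumes "n \<ge> 2" "m \<ge> 1"
  shows "f (of_nat m) \<le> max 1 (f (of_nat n)) powr (log n m)"
proof -
  define M where "M = max 1 (f (of_nat n))"
  define L where "L = log (real n) (real m)"
  have M: "M \<ge> 1" by (simp add: M_def)
  have L: "L \<ge> 0" using assms by (simp add: L_def)
  have "f (of_nat m) \<le> M powr L"
  proof (rule le_if_power_le_linear[where C = "real n * (L + 1)"])
    show "f (of_nat m) \<ge> 0" by (intro f_nonneg K_subring)
    fix k :: nat
    \<comment> \<open>The exponent of the leading digit of m^k, as m^k = n^(k L) < n^(t+1).\<close>
    define t where "t = nat \<lfloor>real k * L\<rfloor>"
    have t: "real t \<le> real k * L" "real k * L < real t + 1" using L by (auto simp: t_def)
    have pp: "(a powr b) ^ k = a powr (real k * b)" if "a > 0" for a b :: real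
      using that by (subst powr_realpow[symmetric]) (simp_all add: powr_powr mult.commute)
    have "real m = real n powr L" using assms by (simp add: L_def)
    hence "real m ^ k = real n powr (real k * L)"
      using assms pp[of "real n" L] by simp
    also have "\<dots> < real n powr (real (Suc t))" using assms t by (intro powr_less_mono) auto
    also have "\<dots> = real n ^ Suc t" using assms by (subst powr_realpow) auto
    finally have "m ^ k < n ^ Suc t" by (metis of_nat_less_iff of_nat_power)
    hence "f (of_nat (m ^ k)) \<le> real (Suc t) * real n * M ^ t"
      unfolding M_def by (intro f_digits assms)
    also have "\<dots> \<le> ((L + 1) * (real k + 1)) * real n * (M powr L) ^ k"
    proof (intro mult_mono)
      have "real k * L \<le> (real k + 1) * (L + 1) - 1" using L by (simp add: algebra_simps)
      thus "real (Suc t) \<le> (L + 1) * (real k + 1)" using t by (simp add: mult.commute)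
      have "M ^ t = M powr real t" using M by (simp add: powr_realpow)
      also have "\<dots> \<le> M powr (real k * L)" using t M by (intro powr_mono) auto
      also have "\<dots> = (M powr L) ^ k" using M by (simp add: pp)
      finally show "M ^ t \<le> (M powr L) ^ k" .
    qed (use L M in auto)
    finally show "f (of_nat m) ^ k \<le> real n * (L + 1) * (real k + 1) * (M powr L) ^ k"
      by (simp add: f_power K_subring mult_ac)
  qed auto
  thus ?thesis by (simp add: M_def L_def)
qed

text \<open>If f(n) were at most 1 for some n above 1, the comparison would bound f by 1 on all
  naturals. Used in both directions, it then shows that ln f(n) / ln n is the same for all such n;
  this constant is \<open>s\<close>.\<close>

lemma archimedean_f_of_nat:
  assumes "f (of_nat m) > 1"
  obtains s where "s > 0" "\<And>n. f (of_nat n) = real n powr s"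
proof -
  have m: "m \<ge> 2" using assms f_0 f_1 by (cases m; cases "m - 1") auto
  have gt: "f (of_nat n) > 1" if "n \<ge> 2" for n
  proof (rule ccontr)
    assume "\<not> f (of_nat n) > 1"
    hence "max 1 (f (of_nat n)) = 1" by simp
    thus False using f_of_nat_compare[OF that, of m] m assms by simp
  qed
  define s where "s = ln (f (of_nat 2)) / ln 2"
  have le: "ln (f (of_nat m)) / ln (real m) \<le> ln (f (of_nat n)) / ln (real n)" if "m \<ge> 2" "n \<ge> 2" for m n
  proof -
    have "f (of_nat m) \<le> f (of_nat n) powr (log n m)"
      using f_of_nat_compare[OF that(2), of m] that gt[OF that(2)] by simp
    hence "ln (f (of_nat m)) \<le> ln (f (of_nat n) powr (log n m))"
      using gt[OF that(1)] by (intro ln_mono) auto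
    hence "ln (f (of_nat m)) \<le> log n m * ln (f (of_nat n))"
      using gt[OF that(2)] by (simp add: ln_powr)
    thus ?thesis using that by (simp add: log_def field_simps)
  qed
  have eq: "f (of_nat n) = real n powr s" if "n \<ge> 2" for n
  proof -
    have "ln (f (of_nat n)) / ln (real n) = s"
      using le[of n 2] le[of 2 n] that by (simp add: s_def)
    hence "ln (f (of_nat n)) = s * ln (real n)" using that by (simp add: field_simps)
    hence "f (of_nat n) = exp (s * ln (real n))" using gt[OF that] by (metis exp_ln less_trans zero_less_one)
    thus ?thesis using that by (simp add: powr_def)
  qed
  have "f (of_nat n) = real n powr s" for n
  proof -
    consider "n = 0" | "n = 1" | "n \<ge> 2" by linarith
    thus ?thesis using eq[of n] f_0 f_1 by cases auto
  qed
  moreover have "s > 0" using gt[of 2] by (simp add: s_def)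
  ultimately show ?thesis using that by blast
qed

text \<open>The triangle inequality for \<open>f\<close>, applied to the binomial expansion of \<open>(x + y)\<^sup>n\<close>, gives the one
  for \<open>f\<^bsup>1/s\<^esup>\<close> up to a factor of order \<open>n\<close>, which disappears in the limit of \<open>n\<close>-th roots.\<close>
lemma archimedean_powr_triangle:
  assumes s: "s > 0" "\<And>n. f (of_nat n) = real n powr s" and xy: "x \<in> K" "y \<in> K"
  shows "f (x + y) powr (1 / s) \<le> f x powr (1 / s) + f y powr (1 / s)"
proof -
  define g where "g = (\<lambda>x. f x powr (1 / s))"
  have gs: "f x = g x powr s" if "x \<in> K" for x
    using f_nonneg[OF that] s by (simp add: g_def powr_powr)
  have g0: "g x \<ge> 0" for x by (simp add: g_def)
  have "f (x + y) \<le> (g x + g y) powr s"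
  proof (rule le_if_power_le_linear[where C = 1])
    show "f (x + y) \<ge> 0" using xy by (intro f_nonneg K_subring)
    fix n
    have pw: "(a powr s) ^ k = (a ^ k) powr s" if "a \<ge> 0" for a :: real and k
      using that by (induction k) (simp_all add: powr_mult)
    have "f (x + y) ^ n \<le> (\<Sum>k\<le>n. f (of_nat (n choose k)) * f x ^ k * f y ^ (n - k))"
      by (rule f_binomial[OF xy])
    also have "\<dots> = (\<Sum>k\<le>n. (real (n choose k) * g x ^ k * g y ^ (n - k)) powr s)"
      using g0 by (intro sum.cong) (simp_all add: s gs[OF xy(1)] gs[OF xy(2)] pw powr_mult)
    \<comment> \<open>Each single binomial term is bounded by the whole binomial sum, which costs
      only the factor n + 1.\<close>
    also have "\<dots> \<le> (\<Sum>k\<le>n. ((g x + g y) ^ n) powr s)"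
    proof (intro sum_mono powr_mono2)
      fix k assume k: "k \<in> {..n}"
      have "real (n choose k) * g x ^ k * g y ^ (n - k) \<le>
          (\<Sum>k\<le>n. real (n choose k) * g x ^ k * g y ^ (n - k))"
        using k g0 by (intro member_le_sum) auto
      thus "real (n choose k) * g x ^ k * g y ^ (n - k) \<le> (g x + g y) ^ n"
        by (simp add: binomial_ring)
    qed (use s g0 in auto)
    also have "\<dots> = 1 * (real n + 1) * ((g x + g y) powr s) ^ n"
      using g0[of x] g0[of y] by (simp add: pw)
    finally show "f (x + y) ^ n \<le> 1 * (real n + 1) * ((g x + g y) powr s) ^ n" .
  qed auto
  hence "g (x + y) powr s \<le> (g x + g y) powr s" using gs[of "x + y"] xy K_subring by simp
  hence "g (x + y) \<le> g x + g y"
    using s g0 by (smt (verit) powr_less_mono2)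
  thus ?thesis by (simp add: g_def)
qed

end

section \<open>Ostrowski's theorem and the normalised absolute value of a place\<close>

definition normalized :: "(complex \<Rightarrow> real) \<Rightarrow> bool" where
  "normalized f \<longleftrightarrow> extends_real_abs f \<or> (\<exists>p::nat. prime p \<and> extends_padic p f)"

lemma padic_abs_of_nat:
  assumes "n \<noteq> 0"
  shows "padic_abs p (of_nat n) = real p powi (- int (multiplicity (int p) (int n)))"
proof -
  have "quotient_of (of_nat n) = (int n, 1)"
    using quotient_of_int[of "int n"] by simp
  thus ?thesis using assms by (simp add: padic_abs_def)
qed

lemma padic_abs_self: "prime p \<Longrightarrow> padic_abs p (of_nat p) = 1 / real p"
  by (subst padic_abs_of_nat) (auto simp: power_int_minus divide_inverse prime_gt_0_nat)

lemma padic_abs_of_nat_le_1: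
  assumes "prime p"
  shows "padic_abs p (of_nat n) \<le> 1"
proof (cases "n = 0")
  case False
  have "real p \<ge> 1" using prime_ge_1_nat[OF assms] by simp
  thus ?thesis using False
    by (simp add: padic_abs_of_nat power_int_minus field_simps one_le_power)
qed (simp add: padic_abs_def)

lemma padic_abs_other_prime:
  assumes "prime p" "prime q" "p \<noteq> q"
  shows "padic_abs p (of_nat q) = 1"
proof -
  have "multiplicity (int p) (int q) = 0"
    using assms by (metis not_dvd_imp_multiplicity_0 primes_dvd_imp_eq int_dvd_int_iff)
  thus ?thesis using assms by (simp add: padic_abs_of_nat prime_gt_0_nat)
qed

lemma extends_real_abs_of_nat: "extends_real_abs f \<Longrightarrow> f (of_nat n) = real n"
  unfolding extends_real_abs_def by (metis of_rat_of_nat_eq abs_of_nat)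

lemma extends_padic_of_nat: "extends_padic p f \<Longrightarrow> f (of_nat n) = padic_abs p (of_nat n)"
  unfolding extends_padic_def by (metis of_rat_of_nat_eq)

lemma not_extends_real_padic:
  "extends_real_abs f \<Longrightarrow> prime p \<Longrightarrow> \<not> extends_padic p f"
  using extends_real_abs_of_nat[of f 2] extends_padic_of_nat[of p f 2] padic_abs_of_nat_le_1[of p 2]
  by auto

text \<open>A positive power keeps values below 1 below 1 and above 1 above 1, so both functions
  extend the same absolute value of the rationals. The exponent is then read off at 2, respectively
  at \<open>p\<close>.\<close>

lemma normalized_powr_eq:
  assumes "normalized f" "normalized g" "s > 0" "\<And>n. g (of_nat n) = f (of_nat n) powr s"
  shows "s = 1"
proof -
  consider "extends_real_abs f" | p where "prime p" "extends_padic p f"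
    using assms(1) by (auto simp: normalized_def)
  thus ?thesis
  proof cases
    case 1
    have g2: "g (of_nat 2) = 2 powr s"
      using assms(4)[of 2] extends_real_abs_of_nat[OF 1, of 2] by simp
    have "extends_real_abs g"
    proof (rule ccontr)
      assume "\<not> extends_real_abs g"
      then obtain p where "prime p" "extends_padic p g"
        using assms(2) by (auto simp: normalized_def)
      hence "g (of_nat 2) \<le> 1" using extends_padic_of_nat padic_abs_of_nat_le_1 by metis
      moreover have "2 powr s > 1" using assms(3) by simp
      ultimately show False using g2 by simp
    qed
    hence "2 powr s = 2 powr 1" using g2 extends_real_abs_of_nat[of g 2] by simp
    thus ?thesis by (subst (asm) powr_inj) auto
  next
    case 2
    have p1: "real p > 1" using prime_gt_1_nat[OF 2(1)] by simp
    have gp: "g (of_nat p) = real p powr (- s)"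
      using assms(4)[of p] extends_padic_of_nat[OF 2(2), of p] padic_abs_self[OF 2(1)] p1
      by (simp add: powr_minus powr_divide inverse_eq_divide)
    hence lt: "g (of_nat p) < 1" using p1 assms(3) by (simp add: powr_less_one)
    have "\<not> extends_real_abs g" using lt p1 extends_real_abs_of_nat[of g p] by auto
    then obtain q where q: "prime q" "extends_padic q g"
      using assms(2) by (auto simp: normalized_def)
    have "q = p"
    proof (rule ccontr)
      assume "q \<noteq> p"
      hence "g (of_nat p) = 1"
        using padic_abs_other_prime[OF q(1) 2(1)] extends_padic_of_nat[OF q(2)] by simp
      with lt show False by simp
    qed
    hence "real p powr (- s) = real p powr (- 1)"
      using gp extends_padic_of_nat[OF q(2), of p] padic_abs_self[OF 2(1)] p1
      by (simp add: powr_minus inverse_eq_divide)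
    thus ?thesis using p1 by (subst (asm) powr_inj) auto
  qed
qed

context abs_val
begin

text \<open>Positive powers commute with the maximum, so here every positive exponent is
  allowed.\<close>

lemma ultrametric_powr:
  assumes ultrametric "s > 0"
  shows "(\<lambda>x\<in>K. f x powr s) \<in> abs_values K"
  unfolding abs_values_def
proof (intro CollectI conjI ballI)
  fix x y assume xy: "x \<in> K" "y \<in> K"
  hence "f (x + y) powr s \<le> max (f x) (f y) powr s"
    using assms by (intro powr_mono2 ultrametricD f_nonneg K_subring) auto
  also have "\<dots> \<le> f x powr s + f y powr s" by (auto simp: max_def)
  finally show "(\<lambda>x\<in>K. f x powr s) (x + y) \<le> (\<lambda>x\<in>K. f x powr s) x + (\<lambda>x\<in>K. f x powr s) y"
    using xy by (simp add: K_subring)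
qed (auto simp: f_eq_0_iff f_mult f_nonneg powr_mult mult_K)

lemma archimedean_powr:
  assumes "s > 0" "\<And>n. f (of_nat n) = real n powr s"
  shows "(\<lambda>x\<in>K. f x powr (1 / s)) \<in> abs_values K"
  unfolding abs_values_def
proof (intro CollectI conjI ballI)
  fix x y assume xy: "x \<in> K" "y \<in> K"
  show "(\<lambda>x\<in>K. f x powr (1 / s)) (x + y) \<le> (\<lambda>x\<in>K. f x powr (1 / s)) x + (\<lambda>x\<in>K. f x powr (1 / s)) y"
    using xy archimedean_powr_triangle[OF assms xy] by (simp add: K_subring)
qed (auto simp: f_eq_0_iff f_mult f_nonneg powr_mult mult_K)

lemma f_of_rat:
  "f (of_rat q) = f (of_int (fst (quotient_of q))) / f (of_int (snd (quotient_of q)))"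
proof -
  have "q = of_int (fst (quotient_of q)) / of_int (snd (quotient_of q))"
    by (rule quotient_of_div) simp
  hence "(of_rat q :: complex) = of_int (fst (quotient_of q)) / of_int (snd (quotient_of q))"
    by (metis of_rat_divide of_rat_of_int_eq)
  thus ?thesis by (simp only: f_divide[OF K_subring(9) K_subring(9)])
qed

lemma archimedean_extends_real:
  assumes "s > 0" "\<And>n. f (of_nat n) = real n powr s"
  shows "extends_real_abs (\<lambda>x\<in>K. f x powr (1 / s))"
  unfolding extends_real_abs_def
proof
  fix q :: rat
  define a b where "a = fst (quotient_of q)" and "b = snd (quotient_of q)"
  have b: "b > 0" by (simp add: b_def quotient_of_denom_pos')
  have q: "q = of_int a / of_int b" unfolding a_def b_def by (rule quotient_of_div) simp
  have fi: "f (of_int k) powr (1 / s) = of_int \<bar>k\<bar>" for k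
    unfolding f_of_int[of k] assms(2) using assms(1) by (simp add: powr_powr)
  have "f (of_rat q) powr (1 / s) = (f (of_int a) / f (of_int b)) powr (1 / s)"
    unfolding f_of_rat[of q] a_def b_def ..
  also have "\<dots> = f (of_int a) powr (1 / s) / f (of_int b) powr (1 / s)"
    by (rule powr_divide)
  also have "\<dots> = \<bar>of_rat q\<bar>"
    using b by (simp add: fi q of_rat_divide)
  finally show "(\<lambda>x\<in>K. f x powr (1 / s)) (of_rat q) = \<bar>of_rat q\<bar>" by (simp add: of_rat_K)
qed

text \<open>If all primes had value 1, so would all positive integers. Every element of
  \<open>K\<close> has an integral multiple by such an integer, so f would be at most 1 on
  \<open>K\<close>, hence trivial on comparing x with its inverse.\<close>

lemma ultrametric_small_prime:
  assumes ultrametric "x \<in> K" "x \<noteq> 0" "f x \<noteq> 1"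
  obtains p where "prime (p::nat)" "f (of_nat p) < 1"
proof -
  have "\<exists>p. prime (p::nat) \<and> f (of_nat p) < 1"
  proof (rule ccontr)
    assume none: "\<not> ?thesis"
    have *: "f (of_nat p) = 1" if "prime p" for p :: nat
    proof -
      have "\<not> f (of_nat p) < 1" using none that by blast
      thus ?thesis using ultrametric_of_nat[OF assms(1), of p] by simp
    qed
    have 1: "f (of_nat n) = 1" if "n > 0" for n
      using that
    proof (induction n rule: less_induct)
      case (less n)
      show ?case
      proof (cases "n = 1")
        case False
        then obtain p where p: "prime p" "p dvd n" using prime_factor_nat by blast
        then obtain m where m: "n = p * m" by blast
        have "m < n" "m > 0" using m less.prems prime_gt_1_nat[OF p(1)] by auto
        hence "f (of_nat m) = 1" by (rule less.IH)
        thus ?thesis using f_mult[OF K_subring(8) K_subring(8), of p m] *[OF p(1)] by (simp add: m)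
      qed (simp add: f_1)
    qed
    have le: "f y \<le> 1" if "y \<in> K" for y
    proof -
      obtain n :: nat where n: "n > 0" "algebraic_int (of_nat n * y)"
        using algebraic_int_multiple[OF algebraic_K[OF \<open>y \<in> K\<close>]] by blast
      have "f (of_nat n * y) \<le> 1"
        using n \<open>y \<in> K\<close> by (intro ultrametric_algebraic_int assms K_subring)
      thus ?thesis using f_mult[OF K_subring(8) \<open>y \<in> K\<close>] 1[OF n(1)] by simp
    qed
    have "inverse (f x) \<le> 1" using le[OF inverse_K[OF assms(2)]] f_inverse[OF assms(2)] by simp
    moreover have "f x \<le> 1" by (rule le) fact
    moreover have "f x > 0" using f_pos assms by blast
    ultimately have "f x = 1" by (simp add: field_simps)
    with assms show False by simp
  qed
  thus ?thesis using that by blast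
qed

text \<open>For the part \<open>a\<close> prime to \<open>p\<close>, a Bezout relation u a + v p = 1
  would bound f(1) strictly below 1 if f(a) < 1.\<close>

lemma ultrametric_of_int_prime:
  assumes ultrametric "prime (p::nat)" "f (of_nat p) < 1" "k \<noteq> 0"
  shows "f (of_int k) = f (of_nat p) ^ multiplicity (int p) k"
proof -
  have p: "prime (int p)" using assms(2) by simp
  define m where "m = multiplicity (int p) k"
  obtain a where a: "k = int p ^ m * a" "\<not> int p dvd a"
    using multiplicity_decompose'[of k "int p"] assms(4) p unfolding m_def
    by (metis not_prime_unit)
  have "coprime a (int p)" using p a(2) by (metis prime_imp_coprime coprime_commute)
  then obtain u v where uv: "u * a + v * int p = 1"
    using bezout_int[of a "int p"] by (metis coprime_imp_gcd_eq_1)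
  have fa: "f (of_int a) = 1"
  proof (rule ccontr)
    assume "f (of_int a) \<noteq> 1"
    hence lt: "f (of_int a) < 1" using ultrametric_of_int[OF assms(1), of a] by simp
    have "(1::complex) = of_int (u * a + v * int p)" by (simp only: uv of_int_1)
    hence "(1::complex) = of_int u * of_int a + of_int v * of_nat p" by simp
    hence "f 1 \<le> max (f (of_int u * of_int a)) (f (of_int v * of_nat p))"
      using ultrametricD[OF assms(1) mult_K[OF K_subring(9)[of u] K_subring(9)[of a]]
          mult_K[OF K_subring(9)[of v] K_subring(8)[of p]]] by simp
    moreover have "f (of_int u * of_int a) \<le> 1 * f (of_int a)"
      unfolding f_mult[OF K_subring(9)[of u] K_subring(9)[of a]]
      by (intro mult_right_mono ultrametric_of_int assms(1) f_nonneg K_subring)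
    moreover have "f (of_int v * of_nat p) \<le> 1 * f (of_nat p)"
      unfolding f_mult[OF K_subring(9)[of v] K_subring(8)[of p]]
      by (intro mult_right_mono ultrametric_of_int assms(1) f_nonneg K_subring)
    ultimately show False using lt assms(3) f_1 by linarith
  qed
  have "f (of_int k) = f (of_nat p ^ m * of_int a)" by (simp add: a(1))
  also have "\<dots> = f (of_nat p) ^ m"
    by (simp only: f_mult[OF K_subring(7)[OF K_subring(8)] K_subring(9)] f_power[OF K_subring(8)] fa mult_1_right)
  finally show ?thesis by (simp add: m_def)
qed

lemma ultrametric_extends_padic:
  assumes ultrametric "prime (p::nat)" "s > 0" "f (of_nat p) = real p powr (- (1 / s))"
  shows "extends_padic p (\<lambda>x\<in>K. f x powr s)"
  unfolding extends_padic_def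
proof
  fix q :: rat
  define a b where "a = fst (quotient_of q)" and "b = snd (quotient_of q)"
  have b: "b > 0" by (simp add: b_def quotient_of_denom_pos')
  have q: "q = of_int a / of_int b" unfolding a_def b_def by (rule quotient_of_div) simp
  have p1: "real p > 1" using prime_gt_1_nat[OF assms(2)] by simp
  have lt: "f (of_nat p) < 1" using p1 assms by (simp add: powr_less_one)
  show "(\<lambda>x\<in>K. f x powr s) (of_rat q) = padic_abs p q"
  proof (cases "q = 0")
    case True
    thus ?thesis using of_rat_K[of 0] f_0 by (simp add: padic_abs_def)
  next
    case False
    hence a: "a \<noteq> 0" using q by auto
    have fi: "f (of_int k) powr s = real p powr (- real (multiplicity (int p) k))" if "k \<noteq> 0" for k
    proof -
      have "f (of_int k) = (real p powr (- (1 / s))) ^ multiplicity (int p) k"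
        using ultrametric_of_int_prime[OF assms(1,2) lt that] assms(4) by simp
      also have "\<dots> = real p powr (- (1 / s) * real (multiplicity (int p) k))"
        using p1 by (subst powr_realpow[symmetric]) (auto simp: powr_powr)
      finally show ?thesis using assms(3) by (simp add: powr_powr)
    qed
    have "f (of_rat q) powr s = (f (of_int a) / f (of_int b)) powr s"
      unfolding f_of_rat[of q] a_def b_def ..
    also have "\<dots> = f (of_int a) powr s / f (of_int b) powr s"
      by (rule powr_divide)
    also have "\<dots> = real p powr (real_of_int (int (multiplicity (int p) b) - int (multiplicity (int p) a)))"
      using a b by (simp add: fi powr_diff[symmetric])
    also have "\<dots> = padic_abs p q"
      unfolding padic_abs_def a_def[symmetric] b_def[symmetric]
      using False p1 powr_real_of_int'[of "real p" "int (multiplicity (int p) b) - int (multiplicity (int p) a)"]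
      by simp
    finally show ?thesis by (simp add: of_rat_K)
  qed
qed

lemma ostrowski:
  assumes "f \<in> nontrivial_abs_values K"
  obtains s where "s > 0" "(\<lambda>x\<in>K. f x powr s) \<in> abs_values K" "normalized (\<lambda>x\<in>K. f x powr s)"
proof (cases "\<forall>n. f (of_nat n) \<le> 1")
  case True
  hence u: ultrametric by (intro ultrametricI) auto
  obtain x where x: "x \<in> K" "x \<noteq> 0" "f x \<noteq> 1" using assms by (auto simp: nontrivial_abs_values_def)
  obtain p where p: "prime (p::nat)" "f (of_nat p) < 1"
    using ultrametric_small_prime[OF u x] by blast
  have p1: "real p > 1" using prime_gt_1_nat[OF p(1)] by simp
  have f0: "f (of_nat p) > 0" using p1 by (intro f_pos K_subring) auto
  \<comment> \<open>Chosen such that f(p)^s = 1/p.\<close>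
  define s where "s = - ln p / ln (f (of_nat p))"
  have s: "s > 0" using p(2) f0 p1 by (simp add: s_def divide_pos_neg)
  have "f (of_nat p) = real p powr (- (1 / s))"
    using p1 f0 p(2) by (simp add: s_def powr_def)
  from ultrametric_extends_padic[OF u p(1) s this] ultrametric_powr[OF u s] s p(1) that
  show ?thesis unfolding normalized_def by blast
next
  case False
  then obtain m where "f (of_nat m) > 1" by (auto simp: not_le)
  then obtain s where s: "s > 0" "\<And>n. f (of_nat n) = real n powr s"
    using archimedean_f_of_nat by blast
  from archimedean_powr[OF this] archimedean_extends_real[OF this] that[of "1 / s"] s(1)
  show ?thesis unfolding normalized_def by simp
qed

end

section \<open>Places and their normalised absolute values\<close>

context alg_field
begin

lemma abs_valI: "f \<in> abs_values K \<Longrightarrow> abs_val K f"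
  by (simp add: abs_val_def abs_val_axioms_def alg_field_axioms)

lemma normalized_nontrivial:
  assumes "f \<in> abs_values K" "normalized f"
  shows "f \<in> nontrivial_abs_values K"
proof -
  consider "extends_real_abs f" | p where "prime (p::nat)" "extends_padic p f"
    using assms by (auto simp: normalized_def)
  hence "\<exists>n. n > 0 \<and> f (of_nat n) \<noteq> 1"
  proof cases
    case 1
    thus ?thesis using extends_real_abs_of_nat[of f 2] by (intro exI[of _ 2]) auto
  next
    case 2
    moreover have "p > 1" using 2(1) by (rule prime_gt_1_nat)
    ultimately show ?thesis using extends_padic_of_nat[of p f p] padic_abs_self[of p]
      by (intro exI[of _ p]) auto
  qed
  then obtain n where "n > 0" "f (of_nat n) \<noteq> 1" by blast
  thus ?thesis using assms(1) K_subring(8)[of n] unfolding nontrivial_abs_values_def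
    by (intro CollectI conjI bexI[of _ "of_nat n"]) auto
qed

lemma equiv_abs_values: "equiv (nontrivial_abs_values K) (abs_value_equiv K)"
proof (rule equivI)
  show "abs_value_equiv K \<subseteq> nontrivial_abs_values K \<times> nontrivial_abs_values K"
    by (auto simp: abs_value_equiv_def)
  have nn: "f x \<ge> 0" if "f \<in> nontrivial_abs_values K" "x \<in> K" for f x
    using that by (auto simp: nontrivial_abs_values_def abs_values_def)
  show "refl_on (nontrivial_abs_values K) (abs_value_equiv K)"
    using nn by (auto simp: refl_on_def abs_value_equiv_def intro!: exI[of _ 1])
  show "sym (abs_value_equiv K)"
  proof (rule symI)
    fix f g assume "(f, g) \<in> abs_value_equiv K"
    then obtain s where s: "f \<in> nontrivial_abs_values K" "g \<in> nontrivial_abs_values K" "s > 0"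
      "\<forall>x\<in>K. g x = f x powr s" by (auto simp: abs_value_equiv_def)
    hence "\<forall>x\<in>K. f x = g x powr (1 / s)" using nn by (auto simp: powr_powr)
    thus "(g, f) \<in> abs_value_equiv K" using s
      by (auto simp: abs_value_equiv_def intro!: exI[of _ "1 / s"])
  qed
  show "trans (abs_value_equiv K)"
  proof (rule transI)
    fix f g h assume "(f, g) \<in> abs_value_equiv K" "(g, h) \<in> abs_value_equiv K"
    then obtain s t where s: "f \<in> nontrivial_abs_values K" "h \<in> nontrivial_abs_values K" "s > 0" "t > 0"
      "\<forall>x\<in>K. g x = f x powr s" "\<forall>x\<in>K. h x = g x powr t" by (auto simp: abs_value_equiv_def)
    thus "(f, h) \<in> abs_value_equiv K"
      by (auto simp: abs_value_equiv_def powr_powr intro!: exI[of _ "s * t"])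
  qed
qed

lemma normalized_equiv_unique:
  assumes "(f, g) \<in> abs_value_equiv K" "normalized f" "normalized g"
  shows "f = g"
proof -
  obtain s where s: "f \<in> nontrivial_abs_values K" "g \<in> nontrivial_abs_values K" "s > 0"
      "\<forall>x\<in>K. g x = f x powr s" using assms(1) by (auto simp: abs_value_equiv_def)
  have "s = 1"
    using assms s K_subring(8) by (intro normalized_powr_eq[OF assms(2,3)]) auto
  have "f x = g x" if "x \<in> K" for x
  proof -
    have "f x \<ge> 0" using s(1) that by (auto simp: nontrivial_abs_values_def abs_values_def)
    thus ?thesis using s(4) that \<open>s = 1\<close> by simp
  qed
  thus ?thesis using s(1,2)
    by (intro extensionalityI[of _ K]) (auto simp: nontrivial_abs_values_def abs_values_def)
qed

text \<open>The description in \<open>place_norm\<close> is proper: Ostrowski's theorem gives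
  existence, and \<open>normalized_equiv_unique\<close> gives uniqueness within a class.\<close>

lemma place_norm:
  assumes "u \<in> places K"
  shows "place_norm K u \<in> u" "normalized (place_norm K u)" "place_norm K u \<in> abs_values K"
    "u = abs_value_equiv K `` {place_norm K u}"
proof -
  obtain f where fu: "f \<in> nontrivial_abs_values K" "u = abs_value_equiv K `` {f}"
    using assms by (auto simp: places_def elim: quotientE)
  interpret abs_val K f using fu(1) by (intro abs_valI) (simp add: nontrivial_abs_values_def)
  obtain s where s: "s > 0" "(\<lambda>x\<in>K. f x powr s) \<in> abs_values K" "normalized (\<lambda>x\<in>K. f x powr s)"
    using ostrowski[OF fu(1)] by blast
  define g where "g = (\<lambda>x\<in>K. f x powr s)"
  have "g \<in> nontrivial_abs_values K" using s normalized_nontrivial by (simp add: g_def)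
  hence gu: "g \<in> u" using fu s(1) by (auto simp: abs_value_equiv_def g_def)
  have "(THE f. f \<in> u \<and> normalized f) = g"
  proof (rule the_equality)
    show "g \<in> u \<and> normalized g" using gu s by (simp add: g_def)
    fix h assume h: "h \<in> u \<and> normalized h"
    hence "(h, g) \<in> abs_value_equiv K"
      using gu fu equiv_abs_values assms unfolding places_def
      by (meson quotient_eq_iff)
    thus "h = g" using h s by (intro normalized_equiv_unique) (auto simp: g_def)
  qed
  hence eq: "place_norm K u = g" by (simp add: place_norm_def normalized_def)
  show "place_norm K u \<in> u" "normalized (place_norm K u)" "place_norm K u \<in> abs_values K"
    unfolding eq using gu s by (simp_all add: g_def)
  show "u = abs_value_equiv K `` {place_norm K u}"
    unfolding eq using gu fu equiv_class_eq[OF equiv_abs_values] by blast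
qed

lemma place_norm_inj: "u \<in> places K \<Longrightarrow> w \<in> places K \<Longrightarrow> place_norm K u = place_norm K w \<Longrightarrow> u = w"
  using place_norm(4) by metis

lemma place_exists:
  assumes "f \<in> abs_values K" "normalized f"
  obtains u where "u \<in> places K" "place_norm K u = f"
proof -
  have f: "f \<in> nontrivial_abs_values K" using normalized_nontrivial assms by blast
  define u where "u = abs_value_equiv K `` {f}"
  have u: "u \<in> places K" using f by (auto simp: u_def places_def intro: quotientI)
  have "(f, place_norm K u) \<in> abs_value_equiv K"
    using place_norm(1)[OF u] by (simp add: u_def)
  hence "place_norm K u = f"
    using place_norm(2)[OF u] assms(2) normalized_equiv_unique by metis
  thus ?thesis using that u by blast
qed

lemma places_eq: "places K = finite_places K \<union> infinite_places K"
  and finite_infinite_disjoint: "finite_places K \<inter> infinite_places K = {}"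
proof -
  have "u \<in> finite_places K \<or> u \<in> infinite_places K" if "u \<in> places K" for u
    using place_norm(2)[OF that] that by (auto simp: finite_places_def infinite_places_def normalized_def)
  thus "places K = finite_places K \<union> infinite_places K"
    by (auto simp: finite_places_def infinite_places_def)
  show "finite_places K \<inter> infinite_places K = {}"
    using not_extends_real_padic by (auto simp: finite_places_def infinite_places_def)
qed

lemma finite_place_ultrametric:
  assumes "u \<in> finite_places K"
  shows "abs_val K (place_norm K u)" "abs_val.ultrametric K (place_norm K u)"
proof -
  obtain p where u: "u \<in> places K" and p: "prime (p::nat)" "extends_padic p (place_norm K u)"
    using assms by (auto simp: finite_places_def)
  show 1: "abs_val K (place_norm K u)" using place_norm(3)[OF u] by (rule abs_valI)
  show "abs_val.ultrametric K (place_norm K u)"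
    using extends_padic_of_nat[OF p(2)] padic_abs_of_nat_le_1[OF p(1)]
    by (intro abs_val.ultrametricI[OF 1]) simp
qed

end

section \<open>Non-integral elements and finite places\<close>

definition vunit :: "'a::field set \<Rightarrow> 'a \<Rightarrow> bool" where
  "vunit A x \<longleftrightarrow> x \<noteq> 0 \<and> x \<in> A \<and> inverse x \<in> A"

context
  fixes A :: "'a::field_char_0 set"
  assumes A: "valuation_ring A"
begin

lemma vsubring: "is_subring A" using A by (simp add: valuation_ring_def)

lemmas vring = is_subringD[OF vsubring]

lemma v_total: "x \<in> A \<or> inverse x \<in> A" using A by (auto simp: valuation_ring_def)

lemma vunit_1: "vunit A 1" by (simp add: vunit_def vring)

lemma vunit_mult: "vunit A x \<Longrightarrow> vunit A y \<Longrightarrow> vunit A (x * y)"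
  by (auto simp: vunit_def intro: vring)

lemma vunit_inverse: "vunit A x \<Longrightarrow> vunit A (inverse x)"
  by (auto simp: vunit_def)

lemma vunit_power: "vunit A x \<Longrightarrow> vunit A (x ^ n)"
  by (induction n) (auto intro: vunit_1 vunit_mult)

lemma vunit_divide: "vunit A x \<Longrightarrow> vunit A y \<Longrightarrow> vunit A (x / y)"
  unfolding divide_inverse by (intro vunit_mult vunit_inverse)

text \<open>A valuation ring is local. One of x/y and y/x lies in \<open>A\<close>, say x/y; if x +
  y were a unit, 1/y = (x/y + 1)/(x + y) would lie in \<open>A\<close>.\<close>

lemma nonunit_add:
  assumes "x \<in> A" "y \<in> A" "\<not> vunit A x" "\<not> vunit A y"
  shows "\<not> vunit A (x + y)"
proof -
  have *: "\<not> vunit A (x + y)"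
    if xy: "x \<in> A" "y \<in> A" "\<not> vunit A y" "x / y \<in> A" "y \<noteq> 0" for x y
  proof
    assume u: "vunit A (x + y)"
    have "inverse y = (x / y + 1) * inverse (x + y)"
      using u xy(5) by (simp add: vunit_def field_simps)
    also have "\<dots> \<in> A" using u xy vring by (auto simp: vunit_def)
    finally show False using xy by (simp add: vunit_def)
  qed
  consider "x = 0" | "y = 0" | "x \<noteq> 0" "y \<noteq> 0" by blast
  thus ?thesis
  proof cases
    case 3
    have "x / y \<in> A \<or> y / x \<in> A"
      using v_total[of "x / y"] by simp
    thus ?thesis using *[of x y] *[of y x] assms 3 by (auto simp: add.commute)
  qed (use assms in auto)
qed

lemma nonunit_sum:
  "(\<And>i. i \<in> I \<Longrightarrow> t i \<in> A \<and> \<not> vunit A (t i)) \<Longrightarrow> \<not> vunit A (\<Sum>i\<in>I. t i)"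
proof (induction I rule: infinite_finite_induct)
  case (insert i I)
  thus ?case using nonunit_add[of "t i" "\<Sum>i\<in>I. t i"] is_subring_sum[OF vsubring, of I t] by auto
qed (auto simp: vunit_def)

text \<open>Divisibility in a valuation ring is total, so a finite family has a member of least
  valuation.\<close>

lemma dominant_term:
  assumes "finite I" "I \<noteq> {}" "\<And>i. i \<in> I \<Longrightarrow> t i \<noteq> 0"
  shows "\<exists>i\<in>I. \<forall>j\<in>I. t j / t i \<in> A"
  using assms
proof (induction I rule: finite_ne_induct)
  case (singleton i)
  thus ?case by (simp add: vring)
next
  case (insert i I)
  then obtain m where m: "m \<in> I" "\<forall>j\<in>I. t j / t m \<in> A" by blast
  show ?case
  proof (cases "t i / t m \<in> A")
    case True
    thus ?thesis using m by blast
  next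
    case False
    hence mi: "t m / t i \<in> A" using v_total[of "t i / t m"] by simp
    have "t j / t i \<in> A" if "j \<in> I" for j
    proof -
      have "t j / t i = (t j / t m) * (t m / t i)" using insert.prems m by simp
      thus ?thesis using m(2) that mi vring(4) by metis
    qed
    moreover have "t i / t i \<in> A" using insert.prems by (simp add: vring)
    ultimately show ?thesis by blast
  qed
qed

text \<open>After division by a dominant term the remaining terms add up to -1. This is a unit, and
  sums of non-units are non-units, so one of these quotients is a unit: the least valuation occurs
  twice.\<close>

lemma zero_sum_unit_ratio:
  assumes "finite I" "I \<noteq> {}" "\<And>i. i \<in> I \<Longrightarrow> t i \<noteq> 0" "(\<Sum>i\<in>I. t i) = 0"
  obtains i j where "i \<in> I" "j \<in> I" "i \<noteq> j" "vunit A (t i / t j)"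
proof -
  obtain m where m: "m \<in> I" "\<forall>j\<in>I. t j / t m \<in> A" using dominant_term assms by blast
  have "\<exists>i\<in>I - {m}. vunit A (t i / t m)"
  proof (rule ccontr)
    assume none: "\<not> ?thesis"
    have "\<not> vunit A (\<Sum>i\<in>I - {m}. t i / t m)"
      using none m by (intro nonunit_sum) auto
    moreover have "(\<Sum>i\<in>I - {m}. t i / t m) = -1"
    proof -
      have "0 = (\<Sum>i\<in>I. t i / t m)" using assms(4) by (simp add: sum_divide_distrib[symmetric])
      also have "\<dots> = t m / t m + (\<Sum>i\<in>I - {m}. t i / t m)"
        using assms(1) m(1) by (rule sum.remove)
      finally show ?thesis using assms(3)[OF m(1)] by (simp add: eq_neg_iff_add_eq_0 add.commute)
    qed
    ultimately show False using vring(5)[OF vring(1)] by (simp add: vunit_def)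
  qed
  thus ?thesis using that m by blast
qed

lemma valuation_ring_root: "x ^ n \<in> A \<Longrightarrow> n > 0 \<Longrightarrow> x \<in> A"
proof (rule ccontr)
  assume *: "x ^ n \<in> A" "n > 0" "x \<notin> A"
  hence y: "inverse x \<in> A" using v_total by blast
  have "x \<noteq> 0" using * vring(2) by auto
  hence "x = x ^ n * inverse x ^ (n - 1)" using *(2) by (cases n) (simp_all add: power_inverse)
  thus False using * y vring(4,7) by metis
qed

text \<open>If every prime were invertible in \<open>A\<close>, then b, an algebraic integer divided
  by a positive integer, would lie in \<open>A\<close>. The prime found is the residue
  characteristic.\<close>

lemma residue_prime_exists:
  assumes "algebraic b" "b \<notin> A"
  obtains p where "prime (p::nat)" "inverse (of_nat p) \<notin> A"
proof -
  have "\<exists>p. prime (p::nat) \<and> inverse (of_nat p) \<notin> A"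
  proof (rule ccontr)
    assume none: "\<not> ?thesis"
    have inv: "inverse (of_nat n) \<in> A" if "n > 0" for n
      using that
    proof (induction n rule: less_induct)
      case (less n)
      show ?case
      proof (cases "n = 1")
        case False
        then obtain p where p: "prime p" "p dvd n" using prime_factor_nat by blast
        then obtain m where m: "n = p * m" by blast
        have "p > 1" using p(1) by (rule prime_gt_1_nat)
        hence "m < n" "m > 0" using m less.prems by auto
        hence "inverse (of_nat m) \<in> A" by (rule less.IH)
        moreover have "inverse (of_nat p) \<in> A" using none p by blast
        ultimately show ?thesis using vring(4) by (simp add: m)
      qed (simp add: vring)
    qed
    obtain n :: nat where n: "n > 0" "algebraic_int (of_nat n * b)"
      using algebraic_int_multiple[OF assms(1)] by blast
    have "inverse (of_nat n) * (of_nat n * b) \<in> A"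
      using inv[OF n(1)] algebraic_int_valuation_ring[OF A n(2)] by (rule vring(4))
    moreover have "inverse (of_nat n) * (of_nat n * b) = b" using n(1) by simp
    ultimately show False using assms(2) by simp
  qed
  thus ?thesis using that by blast
qed

section \<open>The rational valuation belonging to a residue characteristic\<close>

context
  fixes p :: nat
  assumes p: "prime p" and pA: "inverse (of_nat p) \<notin> A"
begin

lemma p_pos: "(of_nat p :: 'a) \<noteq> 0"
proof -
  have "p > 0" using p by (rule prime_gt_0_nat)
  thus ?thesis by simp
qed

text \<open>Let u k + v p = 1. If k/p were in \<open>A\<close>, then 1/p = u (k/p) + v would be too.
  Hence p/k is in \<open>A\<close>, and so is 1/k = u + v (p/k).\<close>

lemma vunit_coprime:
  assumes "\<not> int p dvd k"
  shows "vunit A (of_int k)"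
proof -
  have k0: "k \<noteq> 0" using assms by auto
  have "coprime k (int p)" using p assms by (metis prime_imp_coprime coprime_commute prime_nat_int_transfer)
  then obtain u v where uv: "u * k + v * int p = 1"
    using bezout_int[of k "int p"] by (metis coprime_imp_gcd_eq_1)
  hence eq: "of_int u * of_int k + of_int v * of_nat p = (1::'a)"
    by (metis of_int_1 of_int_add of_int_mult of_int_of_nat_eq)
  have "of_nat p / of_int k \<in> A"
  proof (rule ccontr)
    assume "of_nat p / of_int k \<notin> A"
    hence kp: "of_int k / of_nat p \<in> A" using v_total[of "of_nat p / of_int k"] by simp
    have "inverse (of_nat p) = of_int u * (of_int k / of_nat p) + (of_int v :: 'a)"
      using eq p_pos by (simp add: field_simps)
    also have "\<dots> \<in> A" using kp by (intro vring(4,6) is_subring_of_int[OF vsubring])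
    finally show False using pA by simp
  qed
  moreover have "inverse (of_int k) = of_int u + of_int v * (of_nat p / of_int k :: 'a)"
    using eq k0 by (simp add: field_simps)
  ultimately have "inverse (of_int k) \<in> A"
    using vring(4,6) is_subring_of_int[OF vsubring] by metis
  thus ?thesis using k0 is_subring_of_int[OF vsubring] by (simp add: vunit_def)
qed

lemma int_decompose:
  assumes "k \<noteq> 0"
  obtains s where "vunit A s" "of_int k = of_nat p ^ multiplicity (int p) k * s"
proof -
  have "prime (int p)" using p by simp
  then obtain a where a: "k = int p ^ multiplicity (int p) k * a" "\<not> int p dvd a"
    using multiplicity_decompose'[of k "int p"] assms by (metis not_prime_unit)
  have "of_int k = of_nat p ^ multiplicity (int p) k * (of_int a :: 'a)"
    by (subst a(1)) simp
  thus ?thesis using that vunit_coprime[OF a(2)] by blast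
qed

lemma vunit_p_powi: 
  assumes "vunit A (of_nat p powi k)"
  shows "k = 0"
proof -
  have *: "\<not> vunit A (of_nat p ^ n)" if n: "n > 0" for n
  proof
    assume u: "vunit A (of_nat p ^ n)"
    have cancel: "inverse c = inverse (c * d) * d" if "c \<noteq> 0" "d \<noteq> 0" for c d :: 'a
      using that by simp
    obtain m where m: "n = Suc m" using n by (cases n) auto
    have "inverse (of_nat p :: 'a) = inverse (of_nat p ^ n) * of_nat p ^ (n - 1)"
      unfolding m power_Suc diff_Suc_1 using p_pos by (intro cancel) simp_all
    also have "\<dots> \<in> A" using u by (intro vring(4,7) is_subring_of_nat[OF vsubring]) (auto simp: vunit_def)
    finally show False using pA by simp
  qed
  show ?thesis
  proof (rule ccontr)
    assume "k \<noteq> 0"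
    thus False
      using *[of "nat k"] *[of "nat (-k)"] assms vunit_inverse[OF assms]
      by (cases "k > 0") (auto simp: power_int_def power_inverse)
  qed
qed

definition vord :: "'a \<Rightarrow> nat \<Rightarrow> int \<Rightarrow> bool" where
  "vord x n k \<longleftrightarrow> n > 0 \<and> vunit A (x ^ n * of_nat p powi (- k))"

text \<open>\<open>vord x n k\<close> says that \<open>x\<close> has valuation \<open>k/n\<close> when \<open>p\<close> has valuation 1. Two terms of an algebraic
  equation for \<open>x\<close> must have the same valuation, so every nonzero algebraic \<open>x\<close> has a rational one.\<close>
lemma vord_exists:
  assumes "algebraic x" "x \<noteq> 0"
  obtains n k where "vord x n k"
proof -
  obtain P where P: "\<forall>i. coeff P i \<in> \<int>" "P \<noteq> 0" "poly P x = 0"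
    using assms(1) by (auto simp: algebraic_def)
  define I where "I = {i. i \<le> degree P \<and> coeff P i \<noteq> 0}"
  have fin: "finite I" by (simp add: I_def)
  have ne: "I \<noteq> {}" using P(2) by (auto simp: I_def intro!: exI[of _ "degree P"])
  have nz: "coeff P i * x ^ i \<noteq> 0" if "i \<in> I" for i using that assms(2) by (simp add: I_def)
  have "(\<Sum>i\<in>I. coeff P i * x ^ i) = (\<Sum>i\<le>degree P. coeff P i * x ^ i)"
    by (rule sum.mono_neutral_left) (auto simp: I_def)
  hence sum0: "(\<Sum>i\<in>I. coeff P i * x ^ i) = 0" using P(3) by (simp add: poly_altdef)
  obtain i j where ij: "i \<in> I" "j \<in> I" "i \<noteq> j" "vunit A (coeff P i * x ^ i / (coeff P j * x ^ j))"
    using zero_sum_unit_ratio[OF fin ne nz sum0] by blast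
  have main: "\<exists>n k. vord x n k"
    if ij: "i \<in> I" "j \<in> I" "i > j" "vunit A (coeff P i * x ^ i / (coeff P j * x ^ j))" for i j
  proof -
    have dec: "\<exists>m s. vunit A s \<and> coeff P i = of_nat p ^ m * s" if "i \<in> I" for i
    proof -
      obtain k where k: "coeff P i = of_int k" using P(1) by (metis Ints_cases)
      hence "k \<noteq> 0" using that by (auto simp: I_def)
      from int_decompose[OF this] k show ?thesis by metis
    qed
    obtain a s b t where ab: "vunit A s" "coeff P i = of_nat p ^ a * s" "vunit A t" "coeff P j = of_nat p ^ b * t"
      using dec ij by meson
    have s0: "s \<noteq> 0" "t \<noteq> 0" using ab by (auto simp: vunit_def)
    have xi: "x ^ i = x ^ (i - j) * x ^ j" using ij(3) by (simp add: power_add[symmetric])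
    \<comment> \<open>With v the valuation of x, equality of the two terms means a + i v = b + j v,
      that is, v = (b - a)/(i - j).\<close>
    have "x ^ (i - j) * of_nat p powi (- (int b - int a)) =
        (coeff P i * x ^ i / (coeff P j * x ^ j)) * (t / s)"
      using s0 p_pos assms(2) unfolding xi ab(2,4)
      by (simp add: power_int_diff field_simps)
    moreover have "vunit A \<dots>" by (intro vunit_mult vunit_divide ij ab)
    ultimately have "vord x (i - j) (int b - int a)" using ij(3) by (simp add: vord_def)
    thus ?thesis by blast
  qed
  consider "i > j" | "j > i" using ij(3) by linarith
  hence "\<exists>n k. vord x n k"
  proof cases
    case 2
    have "vunit A (coeff P j * x ^ j / (coeff P i * x ^ i))"
      using vunit_inverse[OF ij(4)] by simp
    thus ?thesis using main[OF ij(2,1) 2] by blast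
  qed (use main ij in blast)
  thus ?thesis using that by blast
qed

text \<open>Raising the two units to the powers m and n and dividing eliminates x and leaves the
  power l n - k m of p, which is a unit only for exponent zero.\<close>

lemma vord_unique:
  assumes "vord x n k" "vord x m l"
  shows "real_of_int k / real n = real_of_int l / real m"
proof -
  have n: "n > 0" "m > 0" using assms by (auto simp: vord_def)
  have x: "x \<noteq> 0" using assms n by (auto simp: vord_def vunit_def)
  have "vunit A ((x ^ n * of_nat p powi (- k)) ^ m / (x ^ m * of_nat p powi (- l)) ^ n)"
    using assms by (intro vunit_divide vunit_power) (auto simp: vord_def)
  also have "(x ^ n * of_nat p powi (- k)) ^ m / (x ^ m * of_nat p powi (- l)) ^ n =
      of_nat p powi (l * int n - k * int m)"
  proof -
    have pk: "(of_nat p powi a) ^ m = (of_nat p powi (a * int m) :: 'a)" for a m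
      by (simp add: power_int_mult)
    have "(x ^ n) ^ m = (x ^ m) ^ n" by (simp add: power_mult[symmetric] mult.commute)
    thus ?thesis using x p_pos
      by (simp add: power_mult_distrib pk power_int_diff power_int_minus field_simps)
  qed
  finally have "l * int n - k * int m = 0" by (rule vunit_p_powi)
  hence "real_of_int l * real n = real_of_int k * real m" 
    by (metis eq_iff_diff_eq_0 of_int_mult of_int_of_nat_eq)
  thus ?thesis using n by (simp add: field_simps)
qed

lemma vord_mult:
  assumes "vord x n k" "vord y m l"
  shows "vord (x * y) (n * m) (k * int m + l * int n)"
proof -
  have "vunit A ((x ^ n * of_nat p powi (- k)) ^ m * (y ^ m * of_nat p powi (- l)) ^ n)"
    using assms unfolding vord_def by (intro vunit_mult[OF vunit_power vunit_power]) blast+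
  also have "(x ^ n * of_nat p powi (- k)) ^ m * (y ^ m * of_nat p powi (- l)) ^ n =
     (x * y) ^ (n * m) * of_nat p powi (- (k * int m + l * int n))"
  proof -
    have pk: "(of_nat p powi a) ^ m = (of_nat p powi (a * int m) :: 'a)" for a m
      by (simp add: power_int_mult)
    have "- (k * int m + l * int n) = (-k) * int m + (-l) * int n" by simp
    hence "(of_nat p powi (- (k * int m + l * int n)) :: 'a) = of_nat p powi ((-k) * int m) * of_nat p powi ((-l) * int n)"
      using p_pos by (metis power_int_add)
    moreover have "x ^ (n * m) = (x ^ n) ^ m" "y ^ (n * m) = (y ^ m) ^ n"
      by (simp_all add: power_mult[symmetric] mult.commute)
    ultimately show ?thesis
      by (simp only: power_mult_distrib pk mult_ac)
  qed
  finally show ?thesis using assms by (simp add: vord_def)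
qed

lemma vord_mem_iff:
  assumes "vord x n k"
  shows "x \<in> A \<longleftrightarrow> k \<ge> 0"
proof
  have u: "vunit A (x ^ n * of_nat p powi (- k))" "n > 0" using assms by (auto simp: vord_def)
  have xn: "x ^ n = (x ^ n * of_nat p powi (- k)) * of_nat p powi k"
    using p_pos by (simp add: power_int_minus)
  {
    assume "k \<ge> 0"
    hence "of_nat p powi k \<in> A"
      by (auto simp: power_int_def intro!: vring is_subring_of_nat[OF vsubring])
    hence "x ^ n \<in> A" using u vring(4) by (subst xn) (auto simp: vunit_def)
    thus "x \<in> A" using valuation_ring_root u by blast
  }
  {
    assume x: "x \<in> A"
    show "k \<ge> 0"
    proof (rule ccontr)
      assume k: "\<not> k \<ge> 0"
      have x0: "x \<noteq> 0" using u by (auto simp: vunit_def)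
      have "of_nat p powi k = inverse (x ^ n * of_nat p powi (- k)) * x ^ n"
        using x0 p_pos by (simp add: power_int_minus field_simps)
      also have "\<dots> \<in> A" using u x by (intro vring(4,7)) (auto simp: vunit_def)
      finally have "of_nat p powi k \<in> A" .
      moreover have "inverse (of_nat p powi k) \<in> A"
        using k by (auto simp: power_int_def power_inverse intro!: vring is_subring_of_nat[OF vsubring])
      ultimately have "vunit A (of_nat p powi k)" using p_pos by (simp add: vunit_def)
      hence "k = 0" by (rule vunit_p_powi)
      with k show False by simp
    qed
  }
qed

lemma vord_of_rat:
  assumes "q \<noteq> 0"
  shows "vord (of_rat q) 1 (int (multiplicity (int p) (fst (quotient_of q))) - int (multiplicity (int p) (snd (quotient_of q))))"
proof -
  define a b where "a = fst (quotient_of q)" and "b = snd (quotient_of q)"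
  have q: "q = of_int a / of_int b" unfolding a_def b_def by (rule quotient_of_div) simp
  have nz: "a \<noteq> 0" "b \<noteq> 0" using q assms by auto
  obtain s where s: "vunit A s" "of_int a = of_nat p ^ multiplicity (int p) a * s"
    using int_decompose[OF nz(1)] by blast
  obtain t where t: "vunit A t" "of_int b = of_nat p ^ multiplicity (int p) b * t"
    using int_decompose[OF nz(2)] by blast
  have t0: "t \<noteq> 0" using t by (auto simp: vunit_def)
  have "of_rat q * of_nat p powi (- (int (multiplicity (int p) a) - int (multiplicity (int p) b))) = s / t"
    unfolding q of_rat_divide of_rat_of_int_eq s(2) t(2) using p_pos t0
    by (simp add: power_int_diff field_simps)
  thus ?thesis using vunit_divide[OF s(1) t(1)] by (simp add: vord_def a_def b_def)
qed

text \<open>This is p^(-v(x)) for the valuation v encoded by \<open>vord\<close>; the description is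
  proper for nonzero algebraic x by \<open>vord_exists\<close> and
  \<open>vord_unique\<close>.\<close>

definition vabs :: "'a \<Rightarrow> real" where
  "vabs x = (if x = 0 then 0 else real p powr (- (THE r. \<exists>n k. vord x n k \<and> r = real_of_int k / real n)))"

lemma vabs_eq:
  assumes "vord x n k"
  shows "vabs x = real p powr (- (real_of_int k / real n))"
proof -
  have "x \<noteq> 0" using assms by (auto simp: vord_def vunit_def)
  moreover have "(THE r. \<exists>n k. vord x n k \<and> r = real_of_int k / real n) = real_of_int k / real n"
    using assms vord_unique by (intro the_equality) blast+
  ultimately show ?thesis by (simp add: vabs_def)
qed

text \<open>The valuation forgets nothing about \<open>A\<close> on algebraic numbers, so an element
  missing from \<open>A\<close> receives a value above 1.\<close>

lemma vabs_le_1_iff: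
  assumes "algebraic x"
  shows "vabs x \<le> 1 \<longleftrightarrow> x \<in> A"
proof (cases "x = 0")
  case False
  obtain n k where nk: "vord x n k" using vord_exists[OF assms False] by blast
  have n: "n > 0" using nk by (simp add: vord_def)
  have p1: "real p > 1" using prime_gt_1_nat[OF p] by simp
  have "vabs x \<le> 1 \<longleftrightarrow> real p powr (- (real_of_int k / real n)) \<le> real p powr 0"
    using p1 by (simp add: vabs_eq[OF nk])
  also have "\<dots> \<longleftrightarrow> - (real_of_int k / real n) \<le> 0" using p1 by (intro powr_le_cancel_iff)
  also have "\<dots> \<longleftrightarrow> k \<ge> 0" using n by (simp add: zero_le_divide_iff)
  finally show ?thesis using vord_mem_iff[OF nk] by simp
qed (simp add: vabs_def vring)

lemma vabs_mult:
  assumes "algebraic x" "algebraic y"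
  shows "vabs (x * y) = vabs x * vabs y"
proof (cases "x = 0 \<or> y = 0")
  case False
  obtain n k where nk: "vord x n k" using vord_exists[OF assms(1)] False by blast
  obtain m l where ml: "vord y m l" using vord_exists[OF assms(2)] False by blast
  have n: "n > 0" "m > 0" using nk ml by (auto simp: vord_def)
  have "- (real_of_int (k * int m + l * int n) / real (n * m)) = - (real_of_int k / real n) + - (real_of_int l / real m)"
    using n by (simp add: field_simps)
  thus ?thesis by (simp only: vabs_eq[OF nk] vabs_eq[OF ml] vabs_eq[OF vord_mult[OF nk ml]] powr_add)
qed (auto simp: vabs_def)

lemma vabs_pos: "x \<noteq> 0 \<Longrightarrow> vabs x > 0"
  using p by (simp add: vabs_def prime_gt_0_nat)

lemma vabs_add:
  assumes "algebraic x" "algebraic y"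
  shows "vabs (x + y) \<le> max (vabs x) (vabs y)"
proof -
  have *: "vabs (x + y) \<le> vabs y" if "x / y \<in> A" "y \<noteq> 0" "algebraic x" "algebraic y" for x y
  proof -
    have 1: "algebraic (x / y)" unfolding divide_inverse using that by (intro algebraic_mult) auto
    hence 2: "algebraic (x / y + 1)" by (intro algebraic_add) auto
    have "x + y = (x / y + 1) * y" using that by (simp add: distrib_right)
    hence "vabs (x + y) = vabs ((x / y + 1) * y)" by (rule arg_cong)
    also have "\<dots> = vabs (x / y + 1) * vabs y" by (rule vabs_mult) fact+
    also have "\<dots> \<le> 1 * vabs y"
    proof (rule mult_right_mono)
      show "vabs (x / y + 1) \<le> 1" using vabs_le_1_iff[OF 2] vring(6)[OF that(1) vring(1)] by simp
      show "0 \<le> vabs y" using vabs_pos[OF that(2)] by simp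
    qed
    finally show ?thesis by simp
  qed
  have nn: "vabs x \<ge> 0" "vabs y \<ge> 0" by (auto simp: vabs_def)
  show ?thesis
  proof (cases "x = 0 \<or> y = 0")
    case False
    have "x / y \<in> A \<or> y / x \<in> A" using v_total[of "x / y"] by simp
    thus ?thesis using *[of x y] *[of y x] False assms by (auto simp: add.commute le_max_iff_disj)
  qed (use nn in auto)
qed

end

end

section \<open>Integrality detected by finite places\<close>

context alg_field
begin

text \<open>The place comes from a valuation ring that omits \<open>b\<close>: its
  \<open>vabs\<close>, restricted to \<open>K\<close>, extends the p-adic absolute value of the
  residue characteristic p.\<close>

lemma non_integral_finite_place:
  assumes "b \<in> K" "\<not> algebraic_int b"
  obtains u where "u \<in> finite_places K" "place_norm K u b > 1"
proof -
  obtain A where A: "valuation_ring A" "b \<notin> A" using valuation_ring_exists[OF assms(2)] by blast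
  have alg_b: "algebraic b" using assms(1) by (rule algebraic_K)
  obtain p where p: "prime (p::nat)" "inverse (of_nat p) \<notin> A"
    using residue_prime_exists[OF A(1) alg_b A(2)] by blast
  define f where "f = (\<lambda>x\<in>K. vabs A p x)"
  note vabs_mult = vabs_mult[OF A(1) p] and vabs_add = vabs_add[OF A(1) p] and vabs_pos = vabs_pos[OF A(1) p]
  have [simp]: "vabs A p 0 = 0" using vabs_def[OF A(1) p] by simp
  have nn: "vabs A p x \<ge> 0" for x using vabs_pos[of x] by (cases "x = 0") auto
  have "f \<in> abs_values K"
    unfolding abs_values_def
  proof (intro CollectI conjI ballI)
    fix x y assume xy: "x \<in> K" "y \<in> K"
    have "vabs A p (x + y) \<le> max (vabs A p x) (vabs A p y)"
      using xy by (intro vabs_add algebraic_K)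
    also have "\<dots> \<le> vabs A p x + vabs A p y" using nn[of x] nn[of y] by auto
    finally show "f (x + y) \<le> f x + f y" using xy by (simp add: f_def K_subring)
    show "f (x * y) = f x * f y" using xy by (simp add: f_def mult_K vabs_mult algebraic_K)
  next
    fix x assume "x \<in> K"
    thus "0 \<le> f x" "(f x = 0) = (x = 0)" using nn[of x] vabs_pos[of x]
      by (cases "x = 0"; simp add: f_def)+
  qed (simp add: f_def)
  have "extends_padic p f"
    unfolding extends_padic_def
  proof
    fix q :: rat
    show "f (of_rat q) = padic_abs p q"
    proof (cases "q = 0")
      case False
      have "p > 1" using p(1) by (rule prime_gt_1_nat)
      hence "f (of_rat q) = real p powr (real_of_int (int (multiplicity (int p) (snd (quotient_of q))) - int (multiplicity (int p) (fst (quotient_of q)))))"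
        using vabs_eq[OF A(1) p vord_of_rat[OF A(1) p False]] by (simp add: f_def of_rat_K)
      also have "\<dots> = padic_abs p q"
        using False \<open>p > 1\<close> powr_real_of_int'[of "real p" "int (multiplicity (int p) (snd (quotient_of q))) - int (multiplicity (int p) (fst (quotient_of q)))"]
        by (simp add: padic_abs_def)
      finally show ?thesis .
    qed (simp add: padic_abs_def f_def K_subring)
  qed
  hence norm: "normalized f" using p by (auto simp: normalized_def)
  obtain u where u: "u \<in> places K" "place_norm K u = f"
    using place_exists[OF \<open>f \<in> abs_values K\<close> norm] by blast
  hence "u \<in> finite_places K" using p \<open>extends_padic p f\<close> by (auto simp: finite_places_def)
  moreover have "f b > 1" using vabs_le_1_iff[OF A(1) p alg_b] A(2) assms(1) by (simp add: f_def)
  ultimately show ?thesis using that u by blast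
qed

lemma algebraic_int_iff_finite_places:
  assumes "b \<in> K"
  shows "algebraic_int b \<longleftrightarrow> (\<forall>u\<in>finite_places K. place_norm K u b \<le> 1)"
  using non_integral_finite_place[OF assms] finite_place_ultrametric
    abs_val.ultrametric_algebraic_int assms by (metis not_le)

end

section \<open>Primitive elements\<close>

lemma rpoly_pcompose: "rpoly (pcompose p q) x = rpoly p (rpoly q x)"
  by (induction p) (simp_all add: pcompose_pCons rpoly_add rpoly_mult)

text \<open>The ring Q[t], which is the field Q(t) as soon as t is algebraic.\<close>

definition simple_ext :: "complex \<Rightarrow> complex set" where
  "simple_ext t = range (\<lambda>p. rpoly p t)"

lemma rpoly_in_simple_ext: "rpoly p t \<in> simple_ext t"
  by (simp add: simple_ext_def)

lemma self_in_simple_ext: "t \<in> simple_ext t"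
  using rpoly_in_simple_ext[of "[:0, 1:]" t] by simp

lemma of_rat_in_simple_ext: "of_rat q \<in> simple_ext t"
  using rpoly_in_simple_ext[of "[:q:]" t] by simp

lemma is_subring_simple_ext: "is_subring (simple_ext t)"
  unfolding is_subring_def simple_ext_def
proof (intro conjI ballI)
  show "1 \<in> range (\<lambda>p. rpoly p t)" by (metis rangeI rpoly_1)
  fix x y assume "x \<in> range (\<lambda>p. rpoly p t)" "y \<in> range (\<lambda>p. rpoly p t)"
  then obtain p q where "x = rpoly p t" "y = rpoly q t" by blast
  thus "x - y \<in> range (\<lambda>p. rpoly p t)" "x * y \<in> range (\<lambda>p. rpoly p t)"
    by (metis rangeI rpoly_diff, metis rangeI rpoly_mult)
qed

lemmas simple_ext_ring = is_subringD[OF is_subring_simple_ext]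

lemma simple_ext_mono:
  assumes "s \<in> simple_ext t"
  shows "simple_ext s \<subseteq> simple_ext t"
  using assms by (auto simp: simple_ext_def rpoly_pcompose[symmetric])

lemma simple_ext_subset:
  assumes "is_subring R" "t \<in> R" "\<And>q. of_rat q \<in> R"
  shows "simple_ext t \<subseteq> R"
  using assms unfolding simple_ext_def rpoly_altdef
  by (auto intro!: is_subring_sum is_subringD)

lemma algebraic_of_rat: "algebraic (of_rat q :: complex)"
proof -
  obtain a b where q: "b > 0" "q = Rat.Fract a b" by (cases q) auto
  hence "of_nat (nat b) * of_rat q = (of_int a :: complex)" by (simp add: of_rat_rat)
  hence "algebraic_int (of_nat (nat b) * of_rat q :: complex)" by simp
  thus ?thesis using q(1) by (intro algebraic_of_multiple[of "nat b"]) auto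
qed

lemma algebraic_simple_ext:
  assumes "algebraic t" "x \<in> simple_ext t"
  shows "algebraic x"
proof -
  have "algebraic (rpoly p t)" for p
    by (induction p) (auto intro!: algebraic_add algebraic_mult algebraic_of_rat assms)
  thus ?thesis using assms(2) by (auto simp: simple_ext_def)
qed

text \<open>A polynomial that represents a nonzero element is coprime to the minimal polynomial, and
  its Bezout cofactor represents the inverse.\<close>

lemma simple_ext_inverse:
  assumes "algebraic t" "x \<in> simple_ext t"
  shows "inverse x \<in> simple_ext t"
proof (cases "x = 0")
  case False
  obtain P where P: "min_rpoly P t" using min_rpoly_exists[OF assms(1)] .
  obtain p where p: "x = rpoly p t" using assms(2) by (auto simp: simple_ext_def)
  have "\<not> P dvd p" using rpoly_dvd_0[of P p t] P False p by (auto simp: min_rpoly_def)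
  hence "coprime P p"
    using P prime_elem_imp_coprime[of P p] by (simp add: irreducible_imp_prime_elem min_rpoly_def)
  hence "gcd P p = 1" by simp
  hence "fst (bezout_coefficients P p) * P + snd (bezout_coefficients P p) * p = 1"
    by (simp add: bezout_coefficients_fst_snd)
  hence "rpoly (fst (bezout_coefficients P p) * P + snd (bezout_coefficients P p) * p) t = 1"
    by simp
  hence "rpoly (snd (bezout_coefficients P p)) t * x = 1"
    using P p by (simp add: rpoly_add rpoly_mult min_rpoly_def)
  hence "inverse x = rpoly (snd (bezout_coefficients P p)) t"
    using False by (simp add: field_simps)
  thus ?thesis by (simp add: simple_ext_def)
qed (use simple_ext_ring in auto)

text \<open>Polynomial division that does not leave the coefficient ring. It serves twice: over a
  subfield in the primitive element theorem, and over the integers for reduction modulo a minimal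
  polynomial.\<close>

lemma monic_division_in_subring:
  fixes d g :: "'a::field poly"
  assumes A: "is_subring A" and d: "lead_coeff d = 1" "\<And>i. coeff d i \<in> A"
    and g: "\<And>i. coeff g i \<in> A"
  shows "\<exists>q r. (\<forall>i. coeff r i \<in> A) \<and> g = q * d + r \<and> (r = 0 \<or> degree r < degree d)"
  using g
proof (induction "degree g" arbitrary: g rule: less_induct)
  case less
  show ?case
  proof (cases "g = 0 \<or> degree g < degree d")
    case True
    thus ?thesis using less.prems by (intro exI[of _ 0] exI[of _ g]) auto
  next
    case False
    define m where "m = monom (lead_coeff g) (degree g - degree d)"
    define h where "h = g - m * d"
    have hA: "coeff h i \<in> A" for i
      unfolding h_def coeff_diff coeff_mult m_def coeff_monom
      using less.prems d is_subringD(2)[OF A]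
      by (intro is_subringD(3,4)[OF A] is_subring_sum[OF A]) auto
    have dm: "degree (m * d) = degree g" "lead_coeff (m * d) = lead_coeff g"
    proof -
      have "m \<noteq> 0" "d \<noteq> 0" using False d by (auto simp: m_def)
      thus "degree (m * d) = degree g" using False by (simp add: degree_mult_eq m_def degree_monom_eq)
      have "g \<noteq> 0" using False by auto
      thus "lead_coeff (m * d) = lead_coeff g" using d by (simp add: lead_coeff_mult m_def degree_monom_eq)
    qed
    show ?thesis
    proof (cases "h = 0")
      case True
      thus ?thesis using is_subringD(2)[OF A] by (intro exI[of _ m] exI[of _ 0]) (simp add: h_def)
    next
      case h0: False
      show ?thesis
      proof (cases "degree g = 0")
        case True
        hence "degree d = 0" using False by simp
        then obtain c where "d = [:c:]" by (elim degree_eq_zeroE)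
        hence "d = 1" using d by (simp add: one_pCons)
        thus ?thesis using is_subringD(2)[OF A] by (intro exI[of _ g] exI[of _ 0]) simp
      next
        case g0: False
        have "degree h < degree g"
        proof -
          have "coeff h (degree g) = 0" using dm by (simp add: h_def)
          moreover have "degree h \<le> degree g" unfolding h_def using dm by (intro degree_diff_le) auto
          ultimately show ?thesis using h0 by (metis le_neq_implies_less leading_coeff_0_iff)
        qed
        from less.hyps[OF this hA] obtain q r where "\<forall>i. coeff r i \<in> A" "h = q * d + r" "r = 0 \<or> degree r < degree d"
          by blast
        thus ?thesis by (intro exI[of _ "q + m"] exI[of _ r]) (auto simp: h_def algebra_simps)
      qed
    qed
  qed
qed

text \<open>The minimal polynomial of \<open>b\<close> over the field generated by \<open>a + c b\<close> divides both the
  minimal polynomial of \<open>b\<close> over the rationals and \<open>f (a + c b - c X)\<close>, where \<open>f\<close> is the one of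
  \<open>a\<close>. For all but finitely many \<open>c\<close> these two have only the root \<open>b\<close> in common.\<close>
lemma primitive_element_two:
  assumes a: "algebraic a" and b: "algebraic b"
  obtains c where "a \<in> simple_ext (a + of_rat c * b)" "b \<in> simple_ext (a + of_rat c * b)"
proof -
  obtain f where f: "min_rpoly f a" using min_rpoly_exists[OF a] .
  obtain g where g: "min_rpoly g b" using min_rpoly_exists[OF b] .
  have fin: "finite (rroots f)" "finite (rroots g)"
    using f g by (auto intro!: finite_rroots simp: min_rpoly_def)
  \<comment> \<open>The value (x - a)/(b - y) is the c for which a + c b - c y is the root x of
    \<open>f\<close>. Pairs with y = b contribute only 0, by the convention for division by
    zero.\<close>
  define bad where "bad = (\<lambda>(x, y). (x - a) / (b - y)) ` (rroots f \<times> rroots g)"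
  have "finite bad" using fin by (simp add: bad_def)
  moreover have "infinite (range (of_rat :: rat \<Rightarrow> complex))"
    using finite_imageD[of "of_rat :: rat \<Rightarrow> complex" UNIV] infinite_UNIV_char_0
    by (auto simp: inj_on_def)
  ultimately obtain c where c: "of_rat c \<notin> bad"
    by (metis finite_subset image_subset_iff subsetI rangeE)
  define t where "t = a + of_rat c * b"
  have at: "algebraic t" unfolding t_def by (intro algebraic_add algebraic_mult algebraic_of_rat a b)
  define F where "F = simple_ext t"
  have F: "is_subring F" unfolding F_def by (rule is_subring_simple_ext)
  define h where "h = pcompose (map_poly of_rat f) [:t, - of_rat c:]"
  have ratF: "of_rat q \<in> F" for q unfolding F_def by (rule of_rat_in_simple_ext)
  have pcF: "coeff (pcompose p q) i \<in> F" if "\<And>i. coeff p i \<in> F" "\<And>i. coeff q i \<in> F" for p q :: "complex poly" and i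
    using that(1)
  proof (induction p arbitrary: i)
    case (pCons x p)
    have "coeff p i \<in> F" for i using pCons.prems[of "Suc i"] by simp
    hence IH: "coeff (pcompose p q) i \<in> F" for i by (rule pCons.IH)
    have x: "x \<in> F" using pCons.prems[of 0] by simp
    have "coeff [:x:] i \<in> F" for i using x is_subringD(2)[OF F] by (simp add: coeff_pCons split: nat.splits)
    thus ?case unfolding pcompose_pCons coeff_add coeff_mult
      by (intro is_subringD[OF F] is_subring_sum[OF F] IH that(2))
  qed (simp add: is_subringD[OF F])
  have hF: "coeff h i \<in> F" for i
    unfolding h_def
  proof (rule pcF)
    fix i show "coeff (map_poly of_rat f) i \<in> F" by (simp add: coeff_map_poly ratF)
    show "coeff [:t, - of_rat c:] i \<in> F"
      using is_subringD(2)[OF F] ratF[of "-c"] self_in_simple_ext[of t]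
      by (simp add: coeff_pCons F_def of_rat_minus split: nat.splits)
  qed
  define G where "G = (map_poly of_rat g :: complex poly)"
  have GF: "coeff G i \<in> F" for i by (simp add: G_def coeff_map_poly ratF)
  have G0: "G \<noteq> 0" using g by (auto simp: G_def min_rpoly_def map_poly_eq_0_iff)
  have Gb: "poly G b = 0" using g by (simp add: G_def min_rpoly_def rpoly_def)
  have hz: "poly h z = rpoly f (t - of_rat c * z)" for z
    by (simp add: h_def poly_pcompose rpoly_def mult.commute)
  have hb: "poly h b = 0" using f by (simp add: hz t_def min_rpoly_def)
  define S where "S = {d. d \<noteq> 0 \<and> poly d b = 0 \<and> (\<forall>i. coeff d i \<in> F)}"
  have "G \<in> S" using G0 Gb GF by (simp add: S_def)
  \<comment> \<open>A polynomial over \<open>F\<close> of least degree that vanishes at b; made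
    monic, it is the minimal polynomial \<open>d\<close> of b over \<open>F\<close>.\<close>
  then obtain d0 where d0: "d0 \<in> S" "\<And>e. e \<in> S \<Longrightarrow> degree d0 \<le> degree e"
    using ex_has_least_nat[of "\<lambda>d. d \<in> S" G degree] by blast
  define d where "d = smult (inverse (lead_coeff d0)) d0"
  have dF: "coeff d i \<in> F" for i
    using d0 simple_ext_inverse[OF at] by (auto simp: d_def S_def F_def intro!: simple_ext_ring)
  have d1: "lead_coeff d = 1" "degree d = degree d0" "poly d b = 0" using d0 by (auto simp: d_def S_def)
  have dvd: "d dvd e" if e: "\<And>i. coeff e i \<in> F" "poly e b = 0" for e
  proof -
    obtain q r where qr: "\<forall>i. coeff r i \<in> F" "e = q * d + r" "r = 0 \<or> degree r < degree d"
      using monic_division_in_subring[OF F d1(1) dF e(1)] by blast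
    have "poly r b = 0" using qr(2) e(2) d1(3) by simp
    have "r = 0"
    proof (rule ccontr)
      assume "r \<noteq> 0"
      hence "r \<in> S" using \<open>poly r b = 0\<close> qr(1) by (simp add: S_def)
      hence "degree d0 \<le> degree r" by (rule d0(2))
      thus False using qr(3) d1(2) \<open>r \<noteq> 0\<close> by simp
    qed
    thus ?thesis using qr(2) by simp
  qed
  have dG: "d dvd G" using dvd GF Gb by blast
  have dh: "d dvd h" using dvd hF hb by blast
  have root: "z = b" if "poly d z = 0" for z
  proof (rule ccontr)
    assume "z \<noteq> b"
    have "poly G z = 0" "poly h z = 0" using that dG dh by (auto elim!: dvdE)
    hence "z \<in> rroots g" "t - of_rat c * z \<in> rroots f"
      by (simp_all add: rroots_def G_def rpoly_def[symmetric] hz)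
    hence "(t - of_rat c * z - a) / (b - z) \<in> bad" unfolding bad_def by force
    moreover have "t - of_rat c * z - a = of_rat c * (b - z)" by (simp add: t_def algebra_simps)
    ultimately show False using c \<open>z \<noteq> b\<close> by simp
  qed
  obtain e where e: "d = [:-b, 1:] * e" using d1(3) by (metis poly_eq_0_iff_dvd dvdE)
  \<comment> \<open>A root of the cofactor would again be b, and then b would be a double root of
    \<open>G\<close>, against separability. So \<open>d\<close> is linear and its constant
    coefficient puts b into \<open>F\<close>.\<close>
  have "degree e = 0"
  proof (rule ccontr)
    assume "degree e \<noteq> 0"
    then obtain z where "poly e z = 0" using fundamental_theorem_of_algebra by (metis constant_degree)
    hence "poly e b = 0" using root[of z] e by auto
    then obtain e' where "e = [:-b, 1:] * e'" by (metis poly_eq_0_iff_dvd dvdE)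
    then obtain k where "G = [:-b, 1:] * ([:-b, 1:] * k)"
      using dG e by (metis dvdE mult.assoc)
    moreover define l where "l = [:-b, 1:]"
    ultimately have "G = l * (l * k)" and "poly l b = 0" by simp_all
    hence "poly (pderiv G) b = 0" by (simp add: pderiv_mult)
    moreover have "poly (pderiv G) b = rpoly (pderiv g) b" by (simp add: G_def rpoly_def map_poly_of_rat_pderiv)
    ultimately show False using min_rpoly_simple_root[OF g] by simp
  qed
  then obtain k where k: "e = [:k:]" by (elim degree_eq_zeroE)
  have "lead_coeff d = lead_coeff [:-b, 1:] * lead_coeff e" unfolding e by (rule lead_coeff_mult)
  hence "k = 1" using d1(1) k by simp
  hence "d = [:-b, 1:]" using e k by simp
  hence "- b \<in> F" using dF[of 0] by simp
  hence bF: "b \<in> F" using is_subringD(5)[OF F] by fastforce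
  have "a = t - of_rat c * b" by (simp add: t_def)
  also have "\<dots> \<in> F" using bF self_in_simple_ext[of t] ratF unfolding F_def by (intro simple_ext_ring)
  finally show ?thesis using that bF by (simp add: F_def t_def)
qed

lemma primitive_element:
  assumes K: "is_subring K" "\<And>q. of_rat q \<in> K" and "finite U" "U \<subseteq> K" "\<And>x. x \<in> U \<Longrightarrow> algebraic x"
  shows "\<exists>t\<in>K. algebraic t \<and> U \<subseteq> simple_ext t"
  using assms(3-5)
proof (induction U rule: finite_induct)
  case empty
  show ?case using is_subringD(1)[OF K(1)] by (intro bexI[of _ 1]) auto
next
  case (insert x U)
  then obtain t where t: "t \<in> K" "algebraic t" "U \<subseteq> simple_ext t" by auto
  have x: "x \<in> K" "algebraic x" using insert.prems by auto
  obtain c where c: "t \<in> simple_ext (t + of_rat c * x)" "x \<in> simple_ext (t + of_rat c * x)"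
    using primitive_element_two[OF t(2) x(2)] .
  have "t + of_rat c * x \<in> K" using t x K by (intro is_subringD)
  moreover have "algebraic (t + of_rat c * x)"
    using t x by (intro algebraic_add algebraic_mult algebraic_of_rat)
  ultimately show ?case using c t(3) simple_ext_mono[OF c(1)] by blast
qed

section \<open>From finite dimension over the rationals to a simple extension\<close>

lemma complex_ring_simps:
  "carrier complex_ring = UNIV" "\<one>\<^bsub>complex_ring\<^esub> = 1" "\<zero>\<^bsub>complex_ring\<^esub> = 0"
  "x \<otimes>\<^bsub>complex_ring\<^esub> y = x * y" "x \<oplus>\<^bsub>complex_ring\<^esub> y = x + y"
  by (simp_all add: ring_of_type_algebra_def)

lemma field_complex_ring: "field complex_ring" by (rule field_from_type_algebra)

lemma subfield_complex_ring:
  assumes "subfield L complex_ring"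
  shows "is_subring L" "x \<in> L \<Longrightarrow> inverse x \<in> L" "of_rat q \<in> L"
proof -
  interpret C: field complex_ring by (rule field_complex_ring)
  have sr: "subring L complex_ring" using subfieldE(1)[OF assms] .
  have neg: "- y \<in> L" if "y \<in> L" for y
  proof -
    have "\<ominus>\<^bsub>complex_ring\<^esub> y = - y"
      by (rule C.minus_equality) (simp_all add: complex_ring_simps)
    thus ?thesis using subringE(5)[OF sr that] by simp
  qed
  have add: "x + y \<in> L" if "x \<in> L" "y \<in> L" for x y
    using subringE(7)[OF sr that] by (simp add: complex_ring_simps)
  show 1: "is_subring L"
    using subringE(3,6)[OF sr] neg add[of _ "- _"] unfolding is_subring_def by (auto simp: complex_ring_simps)
  show inv: "inverse x \<in> L" if "x \<in> L" for x
  proof (cases "x = 0")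
    case False
    have "inv\<^bsub>complex_ring\<^esub> x = inverse x"
      by (rule C.comm_inv_char) (use False in \<open>simp_all add: complex_ring_simps\<close>)
    thus ?thesis using C.subfield_m_inv(1)[OF assms, of x] that False by (simp add: complex_ring_simps)
  qed (use that in simp)
  obtain a b where ab: "of_rat q = (of_int a / of_int b :: complex)"
    by (cases q) (auto simp: of_rat_rat)
  show "of_rat q \<in> L" unfolding ab divide_inverse
    by (intro is_subringD[OF 1] inv is_subring_of_int[OF 1])
qed

lemma subfield_Rats: "subfield \<rat> complex_ring"
proof -
  interpret C: field complex_ring by (rule field_complex_ring)
  have neg: "\<ominus>\<^bsub>complex_ring\<^esub> y = - y" for y
    by (rule C.minus_equality) (simp_all add: complex_ring_simps)
  have inv: "inv\<^bsub>complex_ring\<^esub> x = inverse x" if "x \<noteq> 0" for x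
    by (rule C.comm_inv_char) (use that in \<open>simp_all add: complex_ring_simps\<close>)
  show ?thesis
    by (rule C.subfieldI', rule C.subringI) (auto simp: complex_ring_simps neg inv)
qed

text \<open>Any ring that contains the rationals and a spanning list contains \<open>K\<close>, so a
  primitive element for the finitely many members of that list generates all of
  \<open>K\<close>.\<close>

lemma number_field_primitive:
  assumes "number_field K"
  obtains t where "algebraic t" "K = simple_ext t"
proof -
  interpret C: field complex_ring by (rule field_complex_ring)
  have sf: "subfield K complex_ring" and "C.finite_dimension \<rat> K"
    using assms by (auto simp: number_field_def)
  then obtain n where dim: "C.dimension n \<rat> K" by (auto simp: C.finite_dimension_def)
  note K = subfield_complex_ring[OF sf]
  obtain Us where Us: "C.Span \<rat> Us = K"
    using C.exists_base[OF subfield_Rats dim] by blast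
  have KUs: "C.Span \<rat> Us \<subseteq> L"
    if "is_subring L" "\<And>q. of_rat q \<in> L" "set Us \<subseteq> L" for L
  proof
    fix x assume "x \<in> C.Span \<rat> Us"
    then obtain Ks where "x = C.combine Ks Us" "set Ks \<subseteq> \<rat>"
      using C.Span_eq_combine_set[OF subfield_Rats, of Us] by (auto simp: complex_ring_simps)
    thus "x \<in> L" using that
    proof (induction Ks Us arbitrary: x rule: C.combine.induct)
      case (1 k Ks u Us)
      have "k \<in> L" using 1 by (auto elim!: Rats_cases)
      thus ?case using 1 by (auto simp: complex_ring_simps intro!: is_subringD(4,6)[OF that(1)])
    qed (auto simp: complex_ring_simps is_subringD(2)[OF that(1)])
  qed
  have alg: "algebraic x" if x: "x \<in> K" for x
  proof -
    \<comment> \<open>These are n + 1 powers in a space of dimension n; the coefficients of a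
      dependence form a polynomial that annihilates x.\<close>
    define Vs where "Vs = map (\<lambda>i. x ^ i) [0..<Suc n]"
    have "set Vs \<subseteq> K" using x K(1) by (auto simp: Vs_def intro: is_subringD)
    hence dep: "\<not> C.independent \<rat> Vs"
      using C.independent_length_le_dimension[OF subfield_Rats dim, of Vs] by (auto simp: Vs_def)
    obtain Ks where Ks: "length Ks = length Vs" "C.combine Ks Vs = 0" "set Ks \<subseteq> \<rat>" "set Ks \<noteq> {0}"
      using C.dependent_imp_non_trivial_combine[OF subfield_Rats _ dep] by (auto simp: complex_ring_simps)
    \<comment> \<open>The starting exponent \<open>m\<close> is general because the induction over
      the coefficient list shifts the powers.\<close>
    have comb: "C.combine Ks (map (\<lambda>i. x ^ i) [m..<m + length Ks]) = x ^ m * poly (Poly Ks) x" for m and Ks :: "complex list"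
    proof (induction Ks arbitrary: m)
      case (Cons k Ks)
      have "[m..<m + length (k # Ks)] = m # [Suc m..<Suc m + length Ks]"
        using upt_conv_Cons[of m "m + length (k # Ks)"] by (simp del: upt_Suc)
      thus ?case using Cons[of "Suc m"] by (simp add: complex_ring_simps algebra_simps)
    qed (simp add: complex_ring_simps)
    have len: "length Ks = Suc n" using Ks(1) by (simp add: Vs_def)
    have "poly (Poly Ks) x = 0" using comb[of Ks 0] Ks(2) len by (simp add: Vs_def)
    moreover have "Poly Ks \<noteq> 0"
    proof
      assume "Poly Ks = 0"
      then obtain m where "Ks = replicate m 0" by (metis Poly_eq_0)
      thus False using Ks(4) len by (cases m) auto
    qed
    moreover have "coeff (Poly Ks) i \<in> \<rat>" for i
      using Ks(3) by (auto simp: nth_default_def)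
    ultimately show ?thesis unfolding algebraic_altdef by (intro exI[of _ "Poly Ks"]) blast
  qed
  have UK: "set Us \<subseteq> K"
  proof -
    have "set Us \<subseteq> C.Span \<rat> Us" by (rule C.Span_base_incl[OF subfield_Rats]) (simp add: complex_ring_simps)
    thus ?thesis using Us by simp
  qed
  obtain t where t: "t \<in> K" "algebraic t" "set Us \<subseteq> simple_ext t"
    using primitive_element[OF K(1,3), of "set Us"] UK alg by auto
  have "K \<subseteq> simple_ext t"
    using KUs[OF is_subring_simple_ext of_rat_in_simple_ext t(3)] Us by simp
  moreover have "simple_ext t \<subseteq> K" by (rule simple_ext_subset[OF K(1) t(1) K(3)])
  ultimately show ?thesis using that t(2) by blast
qed

lemma alg_field_simple_ext:
  assumes "algebraic t"
  shows "alg_field (simple_ext t)"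
  using simple_ext_ring simple_ext_inverse[OF assms] algebraic_simple_ext[OF assms]
  by unfold_locales auto

section \<open>Embeddings and archimedean absolute values\<close>

lemma norm_of_rat: "cmod (of_rat q) = \<bar>of_rat q\<bar>"
proof -
  have "(of_rat q :: complex) = of_real (of_rat q)"
    by (cases q) (simp add: of_rat_rat)
  thus ?thesis by (metis norm_of_real)
qed

text \<open>The roots of \<open>P\<close> index the embeddings of \<open>K\<close> into the complex
  numbers.\<close>

locale prim_field =
  fixes K :: "complex set" and t :: complex and P :: "rat poly"
  assumes P: "min_rpoly P t" and K_eq: "K = simple_ext t"
begin

lemma P_nz: "P \<noteq> 0" using P by (auto simp: min_rpoly_def)

lemma algebraic_t: "algebraic t"
  using P P_nz by (auto simp: algebraic_iff_rpoly min_rpoly_def)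

sublocale alg_field K
  unfolding K_eq by (rule alg_field_simple_ext[OF algebraic_t])

abbreviation R :: "complex set" where "R \<equiv> rroots P"

lemma finite_R: "finite R" by (rule finite_rroots[OF P_nz])

lemma t_in_R: "t \<in> R" using P by (simp add: rroots_def min_rpoly_def)

lemma t_in_K: "t \<in> K" by (simp add: K_eq self_in_simple_ext)

lemma K_cases: "x \<in> K \<Longrightarrow> (\<And>p. x = rpoly p t \<Longrightarrow> Q) \<Longrightarrow> Q"
  by (auto simp: K_eq simple_ext_def)

text \<open>The embedding that sends \<open>t\<close> to \<open>z\<close>; for a conjugate z of t
  the choice of the polynomial is immaterial by \<open>emb_rpoly\<close>.\<close>

definition emb :: "complex \<Rightarrow> complex \<Rightarrow> complex" where
  "emb z x = rpoly (SOME p. rpoly p t = x) z"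

lemma emb_rpoly:
  assumes z: "z \<in> R"
  shows "emb z (rpoly p t) = rpoly p z"
proof -
  define q where "q = (SOME q. rpoly q t = rpoly p t)"
  have "rpoly q t = rpoly p t" unfolding q_def by (rule someI) (rule refl)
  hence "rpoly (q - p) t = 0" by (simp add: rpoly_diff)
  hence "rpoly (q - p) z = 0"
    using irreducible_root_root[of P t z] P z by (simp add: min_rpoly_def rroots_def)
  thus ?thesis by (simp add: emb_def q_def rpoly_diff)
qed

lemma emb_add: "z \<in> R \<Longrightarrow> x \<in> K \<Longrightarrow> y \<in> K \<Longrightarrow> emb z (x + y) = emb z x + emb z y"
  by (elim K_cases) (simp add: emb_rpoly rpoly_add[symmetric])

lemma emb_diff: "z \<in> R \<Longrightarrow> x \<in> K \<Longrightarrow> y \<in> K \<Longrightarrow> emb z (x - y) = emb z x - emb z y"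
  by (elim K_cases) (simp add: emb_rpoly rpoly_diff[symmetric])

lemma emb_mult: "z \<in> R \<Longrightarrow> x \<in> K \<Longrightarrow> y \<in> K \<Longrightarrow> emb z (x * y) = emb z x * emb z y"
  by (elim K_cases) (simp add: emb_rpoly rpoly_mult[symmetric])

lemma emb_of_rat: "z \<in> R \<Longrightarrow> emb z (of_rat q) = of_rat q"
  using emb_rpoly[of z "[:q:]"] by simp

lemma emb_0: "z \<in> R \<Longrightarrow> emb z 0 = 0"
  and emb_1: "z \<in> R \<Longrightarrow> emb z 1 = 1"
  using emb_of_rat[of z 0] emb_of_rat[of z 1] by simp_all

lemma emb_t: "z \<in> R \<Longrightarrow> emb z t = z"
  using emb_rpoly[of z "[:0, 1:]"] by simp

lemma emb_cnj: "z \<in> R \<Longrightarrow> x \<in> K \<Longrightarrow> emb (cnj z) x = cnj (emb z x)"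
  by (elim K_cases) (auto simp: emb_rpoly cnj_rpoly rroots_def simp flip: cnj_rpoly)

lemma cnj_R: "z \<in> R \<Longrightarrow> cnj z \<in> R"
  by (simp add: rroots_def cnj_rpoly[symmetric])

lemma emb_eq_0_iff: "z \<in> R \<Longrightarrow> x \<in> K \<Longrightarrow> emb z x = 0 \<longleftrightarrow> x = 0"
proof
  assume z: "z \<in> R" and x: "x \<in> K" and 0: "emb z x = 0"
  obtain p where p: "x = rpoly p t" using x by (elim K_cases)
  have "rpoly p z = 0" using 0 z by (simp add: p emb_rpoly)
  thus "x = 0" unfolding p
    using irreducible_root_root[of P z t] P z by (simp add: min_rpoly_def rroots_def)
qed (simp add: emb_0)

lemma emb_power: "z \<in> R \<Longrightarrow> x \<in> K \<Longrightarrow> emb z (x ^ n) = emb z x ^ n"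
  by (induction n) (simp_all add: emb_1 emb_mult K_subring)

lemma emb_inverse: "z \<in> R \<Longrightarrow> x \<in> K \<Longrightarrow> emb z (inverse x) = inverse (emb z x)"
proof (cases "x = 0")
  case False
  assume z: "z \<in> R" and x: "x \<in> K"
  have "emb z x * emb z (inverse x) = 1"
    using False emb_mult[OF z x inverse_K[OF x]] by (simp add: emb_1 z)
  thus ?thesis using inverse_unique by metis
qed (simp add: emb_0)

lemma emb_divide: "z \<in> R \<Longrightarrow> x \<in> K \<Longrightarrow> y \<in> K \<Longrightarrow> emb z (x / y) = emb z x / emb z y"
  unfolding divide_inverse by (simp add: emb_mult inverse_K emb_inverse)

lemma emb_rpoly_K:
  assumes "z \<in> R" "x \<in> K"
  shows "emb z (rpoly p x) = rpoly p (emb z x)"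
proof -
  obtain q where q: "x = rpoly q t" using assms(2) by (elim K_cases)
  show ?thesis using assms(1) by (simp add: q emb_rpoly flip: rpoly_pcompose)
qed

lemma emb_algebraic_int:
  assumes "z \<in> R" "x \<in> K" "algebraic_int x"
  shows "algebraic_int (emb z x)"
proof -
  obtain p :: "int poly" where p: "poly (map_poly of_int p) x = 0" "lead_coeff p = 1"
    using assms(3) by (auto simp: algebraic_int_altdef_ipoly)
  have *: "poly (map_poly of_int p) y = rpoly (map_poly of_int p) y" for y
    unfolding rpoly_def by (simp add: map_poly_map_poly o_def)
  have "poly (map_poly of_int p) (emb z x) = emb z (poly (map_poly of_int p) x)"
    unfolding * using emb_rpoly_K[OF assms(1,2)] by simp
  also have "\<dots> = 0" by (simp add: p emb_0 assms)
  finally show ?thesis using p(2) by (auto simp: algebraic_int_altdef_ipoly)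
qed

lemma prod_emb_rational: "x \<in> K \<Longrightarrow> (\<Prod>z\<in>R. emb z x) \<in> \<rat>"
proof (elim K_cases)
  fix p assume "x = rpoly p t"
  hence "(\<Prod>z\<in>R. emb z x) = (\<Prod>z\<in>R. rpoly p z)" by (simp add: emb_rpoly)
  thus "(\<Prod>z\<in>R. emb z x) \<in> \<rat>" using prod_conjugates_rational[OF P] by simp
qed

lemma prod_emb_Ints: "x \<in> K \<Longrightarrow> algebraic_int x \<Longrightarrow> (\<Prod>z\<in>R. emb z x) \<in> \<int>"
  by (intro rational_algebraic_int_is_int algebraic_int_prod emb_algebraic_int prod_emb_rational)

lemma prod_emb_nonzero: "x \<in> K \<Longrightarrow> x \<noteq> 0 \<Longrightarrow> (\<Prod>z\<in>R. emb z x) \<noteq> 0"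
  by (auto simp: finite_R emb_eq_0_iff)

lemma norm_prod_emb_ge_1:
  assumes "x \<in> K" "algebraic_int x" "x \<noteq> 0"
  shows "(\<Prod>z\<in>R. cmod (emb z x)) \<ge> 1"
proof -
  obtain k where k: "(\<Prod>z\<in>R. emb z x) = of_int k" using prod_emb_Ints[OF assms(1,2)] by (elim Ints_cases)
  hence "k \<noteq> 0" using prod_emb_nonzero[OF assms(1,3)] by auto
  hence "cmod (of_int k) \<ge> 1" by simp
  thus ?thesis unfolding prod_norm k by simp
qed

lemma norm_prod_emb_unit:
  assumes "x \<in> integer_units K"
  shows "(\<Prod>z\<in>R. cmod (emb z x)) = 1"
proof -
  have x: "x \<in> K" "x \<noteq> 0" "algebraic_int x" "algebraic_int (inverse x)"
    using assms by (auto simp: integer_units_def)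
  have "(\<Prod>z\<in>R. cmod (emb z (inverse x))) \<ge> 1"
    using x by (intro norm_prod_emb_ge_1 inverse_K) auto
  hence "inverse (\<Prod>z\<in>R. cmod (emb z x)) \<ge> 1"
    using x by (simp add: emb_inverse norm_inverse prod_inversef[symmetric])
  moreover have "(\<Prod>z\<in>R. cmod (emb z x)) \<ge> 1" using x by (intro norm_prod_emb_ge_1)
  ultimately show ?thesis by (simp add: field_simps)
qed

section \<open>Archimedean absolute values and embeddings\<close>

definition absv :: "complex \<Rightarrow> complex \<Rightarrow> real" where
  "absv z = (\<lambda>x\<in>K. cmod (emb z x))"

lemma absv_abs_values: "z \<in> R \<Longrightarrow> absv z \<in> abs_values K"
  by (auto simp: abs_values_def absv_def emb_eq_0_iff emb_mult emb_add norm_mult norm_triangle_ineq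
        K_subring)

lemma absv_extends: "z \<in> R \<Longrightarrow> extends_real_abs (absv z)"
  by (simp add: extends_real_abs_def absv_def of_rat_K emb_of_rat norm_of_rat)

lemma absv_cnj: "z \<in> R \<Longrightarrow> absv (cnj z) = absv z"
  by (auto simp: absv_def emb_cnj)

text \<open>The values at t and t - 1 are the distances of z from 0 and 1, which determine z up to
  reflection in the real axis.\<close>

lemma absv_eq_imp:
  assumes "z \<in> R" "w \<in> R" "absv z = absv w"
  shows "w = z \<or> w = cnj z"
proof -
  have eq: "cmod (z - of_rat q) = cmod (w - of_rat q)" for q
  proof -
    have "absv z (t - of_rat q) = absv w (t - of_rat q)" using assms by simp
    thus ?thesis using assms t_in_K of_rat_K
      by (simp add: absv_def K_subring emb_diff emb_t emb_of_rat)
  qed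
  have *: "(cmod (z - of_rat q))\<^sup>2 = (Re z - of_rat q)\<^sup>2 + (Im z)\<^sup>2" for z q
  proof -
    have "(of_rat q :: complex) = of_real (of_rat q)" by (cases q) (simp add: of_rat_rat)
    thus ?thesis by (simp add: cmod_power2)
  qed
  have 0: "(Re z)\<^sup>2 + (Im z)\<^sup>2 = (Re w)\<^sup>2 + (Im w)\<^sup>2"
    using *[of z 0] *[of w 0] eq[of 0] by simp
  moreover have "(Re z - 1)\<^sup>2 + (Im z)\<^sup>2 = (Re w - 1)\<^sup>2 + (Im w)\<^sup>2"
    using *[of z 1] *[of w 1] eq[of 1] by simp
  ultimately have re: "Re z = Re w" by (simp add: power2_eq_square algebra_simps)
  hence "(Im z)\<^sup>2 = (Im w)\<^sup>2" using 0 by simp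
  hence "Im w = Im z \<or> Im w = - Im z" by (auto simp: power2_eq_iff)
  thus ?thesis using re by (auto simp: complex_eq_iff)
qed

text \<open>The coefficients of a representative of degree less than \<open>degree P\<close> are recovered from the
  conjugates by Lagrange interpolation.\<close>
lemma archimedean_bound:
  assumes f: "f \<in> abs_values K" "extends_real_abs f"
  obtains C where "C \<ge> 0" "\<And>x. x \<in> K \<Longrightarrow> f x \<le> C * (\<Sum>z\<in>R. cmod (emb z x))"
proof -
  interpret F: abs_val K f by (rule abs_valI[OF f(1)])
  define n where "n = degree P"
  have n: "n > 0" using min_rpoly_degree_pos[OF P] by (simp add: n_def)
  have card: "card R = n" using min_rpoly_factor(2)[OF P] by (simp add: n_def)
  define L where "L = (\<lambda>z. \<Prod>w\<in>R - {z}. smult (inverse (z - w)) [:-w, 1:])"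
  have degL: "degree (L z) < n" if "z \<in> R" for z
  proof -
    have "degree (L z) \<le> (\<Sum>w\<in>R - {z}. 1)" unfolding L_def
      by (intro order.trans[OF degree_prod_sum_le] sum_mono order.trans[OF degree_smult_le]) (auto simp: finite_R)
    also have "\<dots> < n" using that finite_R card n by simp
    finally show ?thesis .
  qed
  have Lz: "poly (L z) w = (if w = z then 1 else 0)" if "z \<in> R" "w \<in> R" for z w
  proof -
    have eq: "poly (L z) w = (\<Prod>v\<in>R - {z}. inverse (z - v) * (w - v))"
      by (simp add: L_def poly_prod algebra_simps)
    show ?thesis
    proof (cases "w = z")
      case True
      have "(\<Prod>v\<in>R - {z}. inverse (z - v) * (z - v)) = 1"
        by (intro prod.neutral ballI left_inverse) auto
      thus ?thesis using eq True by simp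
    next
      case False
      thus ?thesis unfolding eq using that finite_R by (auto simp: prod_zero_iff)
    qed
  qed
  define C where "C = (\<Sum>k<n. (\<Sum>z\<in>R. cmod (coeff (L z) k)) * f t ^ k)"
  have ft: "f t \<ge> 0" by (rule F.f_nonneg[OF t_in_K])
  show ?thesis
  proof (rule that)
    show "C \<ge> 0" using ft by (auto simp: C_def intro!: sum_nonneg mult_nonneg_nonneg)
    fix x assume "x \<in> K"
    then obtain p0 where p0: "x = rpoly p0 t" by (elim K_cases)
    \<comment> \<open>Below degree n the polynomial is determined by its values at the n conjugates,
      so its coefficients are linear in the numbers \<open>emb z x\<close>. On these rational
      coefficients f is the usual absolute value.\<close>
    define p where "p = p0 mod P"
    have "degree p < n" using n P_nz unfolding p_def n_def by (metis degree_mod_less' degree_0)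
    have "p0 = p0 div P * P + p" by (simp add: p_def)
    hence xp: "x = rpoly p t" using P p0 by (metis add_0 min_rpoly_def mult_zero_right rpoly_add rpoly_mult)
    define S where "S = (\<Sum>z\<in>R. cmod (emb z x))"
    define G where "G = (map_poly of_rat p :: complex poly)"
    define D where "D = G - (\<Sum>z\<in>R. smult (poly G z) (L z))"
    have "D = 0"
    proof (rule ccontr)
      assume "D \<noteq> 0"
      have "degree D < n" unfolding D_def
        using \<open>degree p < n\<close> n degL
        by (intro degree_diff_less degree_sum_less) (auto simp: G_def degree_map_poly intro: le_less_trans[OF degree_smult_le])
      have "R \<subseteq> {z. poly D z = 0}"
      proof
        fix w assume w: "w \<in> R"
        have "(\<Sum>z\<in>R. poly G z * poly (L z) w) = (\<Sum>z\<in>R. if w = z then poly G z else 0)"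
          using w Lz by (intro sum.cong) auto
        also have "\<dots> = poly G w" using w finite_R by simp
        finally show "w \<in> {z. poly D z = 0}" by (simp add: D_def poly_sum)
      qed
      hence "n \<le> card {z. poly D z = 0}"
        using card_mono[OF poly_roots_finite[OF \<open>D \<noteq> 0\<close>]] card by metis
      also have "\<dots> \<le> degree D" using card_poly_roots_bound[OF \<open>D \<noteq> 0\<close>] .
      finally show False using \<open>degree D < n\<close> by simp
    qed
    hence Geq: "G = (\<Sum>z\<in>R. smult (poly G z) (L z))" by (simp add: D_def)
    have Gz: "poly G z = emb z x" if "z \<in> R" for z
      using emb_rpoly[OF that, of p] by (simp add: xp G_def rpoly_def)
    have cf: "\<bar>of_rat (coeff p k)\<bar> \<le> (\<Sum>z\<in>R. cmod (coeff (L z) k)) * S" for k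
    proof -
      have "\<bar>of_rat (coeff p k)\<bar> = cmod (coeff G k)" by (simp add: G_def coeff_map_poly norm_of_rat)
      also have "\<dots> = cmod (\<Sum>z\<in>R. poly G z * coeff (L z) k)" by (subst Geq) (simp add: coeff_sum)
      also have "\<dots> \<le> (\<Sum>z\<in>R. cmod (poly G z * coeff (L z) k))" by (rule norm_sum)
      also have "\<dots> \<le> (\<Sum>z\<in>R. S * cmod (coeff (L z) k))"
      proof (intro sum_mono)
        fix z assume z: "z \<in> R"
        have "cmod (poly G z) \<le> S" unfolding S_def Gz[OF z]
          using z finite_R by (intro member_le_sum) auto
        thus "cmod (poly G z * coeff (L z) k) \<le> S * cmod (coeff (L z) k)"
          by (simp add: norm_mult mult_right_mono)
      qed
      finally show ?thesis by (simp add: sum_distrib_left mult.commute)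
    qed
    have "x = (\<Sum>k<n. of_rat (coeff p k) * t ^ k)"
      unfolding xp rpoly_altdef using \<open>degree p < n\<close>
      by (intro sum.mono_neutral_left) (auto simp: coeff_eq_0 not_le)
    hence "f x = f (\<Sum>k<n. of_rat (coeff p k) * t ^ k)" by simp
    also have "\<dots> \<le> (\<Sum>k<n. f (of_rat (coeff p k) * t ^ k))"
      by (intro F.f_sum K_subring of_rat_K t_in_K)
    also have "\<dots> = (\<Sum>k<n. \<bar>of_rat (coeff p k)\<bar> * f t ^ k)"
      using f(2) by (simp add: F.f_mult F.f_power of_rat_K t_in_K K_subring extends_real_abs_def)
    also have "\<dots> \<le> (\<Sum>k<n. ((\<Sum>z\<in>R. cmod (coeff (L z) k)) * S) * f t ^ k)"
      using ft by (intro sum_mono mult_right_mono cf) auto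
    also have "\<dots> = C * S" by (simp add: C_def sum_distrib_right sum_distrib_left mult_ac)
    finally show "f x \<le> C * (\<Sum>z\<in>R. cmod (emb z x))" by (simp add: S_def)
  qed
qed

text \<open>The two functions differ at some x, and passing to 1/x if needed makes f the larger one.
  Both are the usual absolute value on the rationals, so division by a rational strictly between the
  two values finishes.\<close>

lemma abs_value_separation:
  assumes f: "f \<in> abs_values K" "extends_real_abs f" and z: "z \<in> R" "f \<noteq> absv z"
  obtains y where "y \<in> K" "f y > 1" "cmod (emb z y) < 1"
proof -
  interpret F: abs_val K f by (rule abs_valI[OF f(1)])
  have main: "\<exists>y\<in>K. f y > 1 \<and> cmod (emb z y) < 1" if x: "x \<in> K" "cmod (emb z x) < f x" for x
  proof -
    obtain r where r: "cmod (emb z x) < of_rat r" "of_rat r < f x"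
      using of_rat_dense[OF x(2)] by blast
    have r0: "(of_rat r :: real) > 0" using r norm_ge_zero[of "emb z x"] by linarith
    define y where "y = x / of_rat r"
    have "f y = f x / of_rat r"
      using f(2) r0 by (simp add: y_def F.f_divide x of_rat_K extends_real_abs_def)
    moreover have "cmod (emb z y) = cmod (emb z x) / of_rat r"
      using r0 by (simp add: y_def emb_divide z x of_rat_K emb_of_rat norm_divide norm_of_rat)
    moreover have "y \<in> K" by (simp add: y_def divide_K x of_rat_K)
    moreover have "f x / of_rat r > 1" "cmod (emb z x) / of_rat r < 1" using r r0 by simp_all
    ultimately show ?thesis by (intro bexI[of _ y]) simp_all
  qed
  have "\<exists>x\<in>K. f x \<noteq> cmod (emb z x)"
  proof (rule ccontr)
    assume "\<not> ?thesis"
    hence "f x = absv z x" if "x \<in> K" for x using that by (auto simp: absv_def)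
    hence "f = absv z" using f(1) by (intro extensionalityI[of _ K]) (auto simp: absv_def abs_values_def)
    with z show False by simp
  qed
  then obtain x where x: "x \<in> K" "f x \<noteq> cmod (emb z x)" by blast
  have "x \<noteq> 0" using x F.f_0 emb_0 z by auto
  hence pos: "f x > 0" "cmod (emb z x) > 0" using F.f_pos x emb_eq_0_iff z by auto
  show ?thesis
  proof (cases "cmod (emb z x) < f x")
    case True
    thus ?thesis using main[OF x(1)] that by blast
  next
    case False
    hence "f x < cmod (emb z x)" using x by simp
    hence "inverse (cmod (emb z x)) < inverse (f x)" using pos by (simp add: less_imp_inverse_less)
    hence "cmod (emb z (inverse x)) < f (inverse x)"
      using x z by (simp add: emb_inverse F.f_inverse norm_inverse)
    thus ?thesis using main[OF inverse_K[OF x(1)]] that by blast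
  qed
qed

text \<open>The Artin-Whaples induction. Let x serve for \<open>S\<close> and let y separate f from
  the new conjugate z. If x is at most 1 at z, then x^n y works for large n, as the powers kill the
  values on \<open>S\<close> and do no harm at z.\<close>

lemma weak_approximation:
  assumes f: "f \<in> abs_values K" "extends_real_abs f" and S: "finite S" "S \<subseteq> R" "f \<notin> absv ` R"
  shows "\<exists>y\<in>K. f y > 1 \<and> (\<forall>z\<in>S. cmod (emb z y) < 1)"
  using S
proof (induction S rule: finite_induct)
  case empty
  show ?case using extends_real_abs_of_nat[OF f(2), of 2] K_subring(8)[of 2]
    by (intro bexI[of _ "of_nat 2"]) auto
next
  case (insert z S)
  interpret F: abs_val K f by (rule abs_valI[OF f(1)])
  obtain x where x: "x \<in> K" "f x > 1" "\<And>w. w \<in> S \<Longrightarrow> cmod (emb w x) < 1" using insert by auto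
  have z: "z \<in> R" and S: "S \<subseteq> R" using insert by auto
  have "f \<noteq> absv z" using insert.prems z by auto
  then obtain y where y: "y \<in> K" "f y > 1" "cmod (emb z y) < 1"
    using abs_value_separation[OF f z] by blast
  have pow0: "(\<lambda>n. cmod (emb w x) ^ n) \<longlonglongrightarrow> 0" if "w \<in> S" for w
    using x(3)[OF that] by (intro LIMSEQ_realpow_zero) auto
  show ?case
  proof (cases "cmod (emb z x) \<le> 1")
    case True
    have "\<forall>w\<in>S. eventually (\<lambda>n. cmod (emb w (x ^ n * y)) < 1) sequentially"
    proof
      fix w assume w: "w \<in> S"
      have "(\<lambda>n. cmod (emb w x) ^ n * cmod (emb w y)) \<longlonglongrightarrow> 0 * cmod (emb w y)"
        by (intro tendsto_mult pow0[OF w] tendsto_const)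
      hence "eventually (\<lambda>n. cmod (emb w x) ^ n * cmod (emb w y) < 1) sequentially"
        by (intro order_tendstoD) auto
      moreover have "w \<in> R" using w S by blast
      ultimately show "eventually (\<lambda>n. cmod (emb w (x ^ n * y)) < 1) sequentially"
        using x y by (simp add: emb_mult emb_power K_subring norm_mult norm_power)
    qed
    hence "eventually (\<lambda>n. \<forall>w\<in>S. cmod (emb w (x ^ n * y)) < 1) sequentially"
      using insert.hyps(1) by (simp add: eventually_ball_finite)
    then obtain n where n: "\<forall>w\<in>S. cmod (emb w (x ^ n * y)) < 1"
      using eventually_happens trivial_limit_sequentially by blast
    have "f (x ^ n * y) = f x ^ n * f y" using x y by (simp add: F.f_mult F.f_power K_subring)
    moreover have "1 * 1 < f x ^ n * f y"
      using x y one_le_power[of "f x" n] by (intro mult_le_less_imp_less) auto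
    moreover have "cmod (emb z (x ^ n * y)) = cmod (emb z x) ^ n * cmod (emb z y)"
      using x y z by (simp add: emb_mult emb_power K_subring norm_mult norm_power)
    moreover have "cmod (emb z x) ^ n * cmod (emb z y) \<le> 1 * cmod (emb z y)"
      using True by (intro mult_right_mono power_le_one) auto
    moreover have "x ^ n * y \<in> K" using x y by (intro K_subring)
    ultimately show ?thesis using n y(3) by (intro bexI[of _ "x ^ n * y"]) auto
  next
    case False
    \<comment> \<open>The factor x^n / (1 + x^n) tends to 0 at the conjugates in \<open>S\<close>,
      where x is small, and its absolute value tends to 1 at z, where x is large. In the limit y
      alone decides at z.\<close>
    define q where "q = (\<lambda>n. x ^ n / (1 + x ^ n) * y)"
    have K: "x ^ n \<in> K" "1 + x ^ n \<in> K" "x ^ n / (1 + x ^ n) \<in> K" "q n \<in> K" for n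
      using x y by (simp_all add: q_def divide_K K_subring)
    have embq: "cmod (emb w (q n)) = cmod (emb w x) ^ n / cmod (1 + emb w x ^ n) * cmod (emb w y)"
      if "w \<in> R" for w n
    proof -
      have "emb w (q n) = emb w (x ^ n / (1 + x ^ n)) * emb w y"
        unfolding q_def by (rule emb_mult[OF that K(3) y(1)])
      also have "emb w (x ^ n / (1 + x ^ n)) = emb w x ^ n / (1 + emb w x ^ n)"
        using K that x(1) by (simp add: emb_divide emb_add emb_1 one_K emb_power)
      finally show ?thesis by (simp add: norm_mult norm_divide norm_power)
    qed
    have fq: "f (q n) = f x ^ n / f (1 + x ^ n) * f y" for n
    proof -
      have "f (q n) = f (x ^ n / (1 + x ^ n)) * f y"
        unfolding q_def by (rule F.f_mult[OF K(3) y(1)])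
      thus ?thesis using K x(1) by (simp add: F.f_divide F.f_power)
    qed
    have "\<forall>w\<in>S. eventually (\<lambda>n. cmod (emb w (q n)) < 1) sequentially"
    proof
      fix w assume w: "w \<in> S"
      hence wR: "w \<in> R" using S by blast
      have "(\<lambda>n. emb w x ^ n) \<longlonglongrightarrow> 0"
        using x(3)[OF w] by (intro LIMSEQ_power_zero) auto
      hence "(\<lambda>n. cmod (emb w x) ^ n / cmod (1 + emb w x ^ n) * cmod (emb w y)) \<longlonglongrightarrow>
          0 / cmod (1 + 0) * cmod (emb w y)"
        by (intro tendsto_mult tendsto_divide tendsto_norm tendsto_add tendsto_const pow0[OF w]) auto
      hence "(\<lambda>n. cmod (emb w x) ^ n / cmod (1 + emb w x ^ n) * cmod (emb w y)) \<longlonglongrightarrow> 0" by simp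
      thus "eventually (\<lambda>n. cmod (emb w (q n)) < 1) sequentially"
        unfolding embq[OF wR] by (rule order_tendstoD(2)) simp
    qed
    hence 1: "eventually (\<lambda>n. \<forall>w\<in>S. cmod (emb w (q n)) < 1) sequentially"
      using insert.hyps(1) by (simp add: eventually_ball_finite)
    have lim1: "(\<lambda>n. inverse a ^ n) \<longlonglongrightarrow> 0" if "norm a > 1" for a :: "'b::real_normed_div_algebra"
      using that by (intro LIMSEQ_power_zero) (simp add: norm_inverse inverse_less_1_iff)
    have 2: "eventually (\<lambda>n. cmod (emb z (q n)) < 1) sequentially"
    proof -
      define a where "a = emb z x"
      have a: "cmod a > 1" using False by (simp add: a_def)
      hence "a \<noteq> 0" by auto
      have "(\<lambda>n. 1 / cmod (inverse a ^ n + 1) * cmod (emb z y)) \<longlonglongrightarrow> 1 / cmod (0 + 1) * cmod (emb z y)"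
        by (intro tendsto_mult tendsto_divide tendsto_norm tendsto_add tendsto_const lim1 a) auto
      moreover have "1 / cmod (inverse a ^ n + 1) = cmod a ^ n / cmod (1 + a ^ n)" for n
      proof -
        have "1 + a ^ n = a ^ n * (inverse a ^ n + 1)"
          using \<open>a \<noteq> 0\<close> by (simp add: algebra_simps power_inverse)
        thus ?thesis using \<open>a \<noteq> 0\<close> by (simp add: norm_mult norm_power)
      qed
      ultimately have "(\<lambda>n. cmod a ^ n / cmod (1 + a ^ n) * cmod (emb z y)) \<longlonglongrightarrow> 1 / cmod (0 + 1) * cmod (emb z y)"
        by simp
      hence "(\<lambda>n. cmod (emb z (q n))) \<longlonglongrightarrow> cmod (emb z y)"
        unfolding embq[OF z] a_def by simp
      thus ?thesis using y(3) by (rule order_tendstoD(2))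
    qed
    \<comment> \<open>For the abstract f a lower bound is enough: the triangle inequality in the
      denominator bounds the factor below by a^n / (1 + a^n), which tends to 1.\<close>
    have 3: "eventually (\<lambda>n. f (q n) > 1) sequentially"
    proof -
      define a where "a = f x"
      have a: "a > 1" using x by (simp add: a_def)
      have "(\<lambda>n. 1 / (inverse a ^ n + 1) * f y) \<longlonglongrightarrow> 1 / (0 + 1) * f y"
        using a by (intro tendsto_mult tendsto_divide tendsto_add tendsto_const lim1) auto
      hence "eventually (\<lambda>n. 1 / (inverse a ^ n + 1) * f y > 1) sequentially"
        using y(2) by (intro order_tendstoD(1)) auto
      thus ?thesis
      proof eventually_elim
        case (elim n)
        have "f (1 + x ^ n) \<le> 1 + a ^ n"
          using F.f_triangle[OF one_K K(1)[of n]] x by (simp add: F.f_1 F.f_power a_def)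
        moreover have "1 + x ^ n \<noteq> 0"
        proof
          assume "1 + x ^ n = 0"
          hence xn: "x ^ n = -1" by (simp add: add_eq_0_iff)
          hence "f x ^ n = 1" using F.f_power[OF x(1), of n] F.f_minus_one by simp
          hence "n = 0" using x(2) by (metis less_irrefl one_less_power neq0_conv)
          with xn show False by simp
        qed
        hence "f (1 + x ^ n) > 0" using F.f_pos K by blast
        ultimately have "a ^ n / (1 + a ^ n) \<le> a ^ n / f (1 + x ^ n)"
          using a by (intro divide_left_mono mult_pos_pos) (auto intro: add_pos_pos)
        moreover have "1 / (inverse a ^ n + 1) = a ^ n / (1 + a ^ n)"
        proof -
          have "1 + a ^ n = a ^ n * (inverse a ^ n + 1)"
            using a by (simp add: algebra_simps power_inverse)
          thus ?thesis using a by simp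
        qed
        ultimately have "1 / (inverse a ^ n + 1) \<le> f x ^ n / f (1 + x ^ n)" by (simp add: a_def)
        hence "1 / (inverse a ^ n + 1) * f y \<le> f (q n)"
          unfolding fq using y(2) by (intro mult_right_mono) auto
        thus ?case using elim by simp
      qed
    qed
    from eventually_conj[OF 1 eventually_conj[OF 2 3]]
    obtain n where "\<forall>w\<in>S. cmod (emb w (q n)) < 1" "cmod (emb z (q n)) < 1" "f (q n) > 1"
      using eventually_happens trivial_limit_sequentially by blast
    thus ?thesis using K(4) by blast
  qed
qed

text \<open>If \<open>f\<close> differed from all \<open>absv z\<close>, weak approximation would give an element whose powers violate
  the bound of \<open>f\<close> by the conjugates.\<close>
lemma archimedean_classification:
  assumes f: "f \<in> abs_values K" "extends_real_abs f"
  shows "f \<in> absv ` R"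
proof (rule ccontr)
  assume *: "f \<notin> absv ` R"
  interpret F: abs_val K f by (rule abs_valI[OF f(1)])
  obtain y where y: "y \<in> K" "f y > 1" "\<And>z. z \<in> R \<Longrightarrow> cmod (emb z y) < 1"
    using weak_approximation[OF f finite_R order.refl *] by blast
  obtain C where C: "C \<ge> 0" "\<And>x. x \<in> K \<Longrightarrow> f x \<le> C * (\<Sum>z\<in>R. cmod (emb z x))"
    using archimedean_bound[OF f] by blast
  have "(\<lambda>n. C * (\<Sum>z\<in>R. cmod (emb z y) ^ n)) \<longlonglongrightarrow> C * (\<Sum>z\<in>R. 0)"
    using y(3) by (intro tendsto_mult tendsto_sum tendsto_const LIMSEQ_realpow_zero) auto
  hence "(\<lambda>n. C * (\<Sum>z\<in>R. cmod (emb z y) ^ n)) \<longlonglongrightarrow> 0" by simp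
  moreover have "1 \<le> C * (\<Sum>z\<in>R. cmod (emb z y) ^ n)" for n
  proof -
    have "1 \<le> f y ^ n" using y by (intro one_le_power) auto
    also have "\<dots> = f (y ^ n)" using y by (simp add: F.f_power)
    also have "\<dots> \<le> C * (\<Sum>z\<in>R. cmod (emb z (y ^ n)))" using y by (intro C K_subring)
    finally show ?thesis using y by (simp add: emb_power norm_power)
  qed
  ultimately have "1 \<le> (0::real)" by (intro LIMSEQ_le_const) auto
  thus False by simp
qed

lemma place_norm_infinite: "place_norm K ` infinite_places K = absv ` R"
proof
  show "place_norm K ` infinite_places K \<subseteq> absv ` R"
    using archimedean_classification place_norm(3) by (auto simp: infinite_places_def)
  show "absv ` R \<subseteq> place_norm K ` infinite_places K"
  proof
    fix f assume "f \<in> absv ` R"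
    then obtain z where z: "z \<in> R" "f = absv z" by blast
    have "normalized f" using absv_extends z by (auto simp: normalized_def)
    then obtain u where "u \<in> places K" "place_norm K u = f"
      using place_exists absv_abs_values z by metis
    thus "f \<in> place_norm K ` infinite_places K"
      using absv_extends z by (intro image_eqI[of _ _ u]) (auto simp: infinite_places_def)
  qed
qed

lemma finite_infinite_places: "finite (infinite_places K)"
proof -
  have "inj_on (place_norm K) (infinite_places K)"
    by (intro inj_onI place_norm_inj) (simp_all add: infinite_places_def)
  moreover have "finite (place_norm K ` infinite_places K)"
    unfolding place_norm_infinite using finite_R by simp
  ultimately show ?thesis using finite_imageD by blast
qed

end

section \<open>Local degrees at the archimedean places\<close>

lemma real_rat_limit:
  obtains q where "(\<lambda>n. of_rat (q n) :: complex) \<longlonglongrightarrow> of_real a"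
proof -
  have "\<forall>n. \<exists>r. a < of_rat r \<and> of_rat r < a + inverse (real (Suc n))"
    using of_rat_dense[of a] by (metis less_add_same_cancel1 inverse_positive_iff_positive of_nat_0_less_iff zero_less_Suc)
  then obtain q where q: "\<And>n. a < of_rat (q n)" "\<And>n. of_rat (q n) < a + inverse (real (Suc n))"
    by metis
  have "(\<lambda>n. of_rat (q n)) \<longlonglongrightarrow> a"
  proof (rule tendsto_sandwich)
    show "(\<lambda>n. a) \<longlonglongrightarrow> a" by simp
    show "(\<lambda>n. a + inverse (real (Suc n))) \<longlonglongrightarrow> a"
      using tendsto_add[OF tendsto_const LIMSEQ_inverse_real_of_nat, of a] by simp
  qed (use q in \<open>auto intro!: always_eventually less_imp_le\<close>)
  hence "(\<lambda>n. of_real (of_rat (q n)) :: complex) \<longlonglongrightarrow> of_real a" by (rule tendsto_of_real)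
  moreover have "of_real (of_rat r) = (of_rat r :: complex)" for r
    by (cases r) (simp add: of_rat_rat)
  ultimately show ?thesis using that by simp
qed

lemma Reals_limit:
  assumes "\<And>n. u n \<in> \<real>" "u \<longlonglongrightarrow> (a :: complex)"
  shows "a \<in> \<real>"
proof -
  have "(\<lambda>n. cnj (u n)) \<longlonglongrightarrow> cnj a" using assms(2) by (rule tendsto_cnj)
  moreover have "(\<lambda>n. cnj (u n)) = u" using assms(1) by (auto simp: Reals_cnj_iff)
  ultimately have "cnj a = a" using assms(2) LIMSEQ_unique by metis
  thus ?thesis by (simp add: Reals_cnj_iff)
qed

text \<open>Lets the dimension of a completion, a quotient of a ring of Cauchy sequences, be
  computed in a subfield of the complex numbers.\<close>

lemma dim_via_iso:
  assumes "ring S" "ring R" "h \<in> ring_iso S R" "subfield F S" "\<one>\<^bsub>R\<^esub> \<noteq> \<zero>\<^bsub>R\<^esub>"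
    "ring.dimension S n F (carrier S)"
  shows "ring.dim R (h ` F) (carrier R) = n"
proof -
  interpret R: ring R by fact
  interpret H: ring_hom_ring S R h
    using assms by (intro ring_hom_ringI2) (auto simp: ring_iso_def)
  have bij: "bij_betw h (carrier S) (carrier R)" using assms(3) by (simp add: ring_iso_def)
  have sf: "subfield (h ` F) R" by (rule H.img_is_subfield(2)[OF assms(4,5)])
  have "R.dimension n (h ` F) (h ` carrier S)"
    using bij by (intro H.inj_hom_dimension assms) (auto simp: bij_betw_def)
  hence dim: "R.dimension n (h ` F) (carrier R)" using bij by (simp add: bij_betw_def)
  show ?thesis unfolding R.dim_def
    using dim R.dimension_is_inj[OF sf] by (intro the_equality) blast+
qed

lemma subfield_Reals: "subfield \<real> complex_ring"
proof -
  interpret C: field complex_ring by (rule field_complex_ring)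
  have neg: "\<ominus>\<^bsub>complex_ring\<^esub> y = - y" for y
    by (rule C.minus_equality) (simp_all add: complex_ring_simps)
  have inv: "inv\<^bsub>complex_ring\<^esub> x = inverse x" if "x \<noteq> 0" for x
    by (rule C.comm_inv_char) (use that in \<open>simp_all add: complex_ring_simps\<close>)
  show ?thesis
    by (rule C.subfieldI', rule C.subringI) (auto simp: complex_ring_simps neg inv)
qed

lemma complex_dimension:
  "ring.dimension complex_ring (Suc 1) \<real> UNIV"
proof -
  interpret C: field complex_ring by (rule field_complex_ring)
  have "C.dimension (Suc 1) \<real> (C.line_extension \<real> \<i> \<real>)"
    by (rule C.Suc_dim[OF _ _ C.dimension_one[OF subfield_Reals]])
       (simp_all add: complex_ring_simps complex_is_Real_iff)
  moreover have "C.line_extension \<real> \<i> \<real> = UNIV"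
  proof -
    have "c \<in> C.line_extension \<real> \<i> \<real>" for c
      unfolding C.line_extension_mem_iff complex_ring_simps
      by (intro bexI[of _ "of_real (Im c)"] bexI[of _ "of_real (Re c)"]) (auto simp: complex_eq_iff)
    thus ?thesis by blast
  qed
  ultimately show ?thesis by simp
qed

section \<open>The completion at an embedding, realised inside the complex numbers\<close>

context prim_field
begin

context
  fixes z assumes z: "z \<in> R"
begin

lemma cauchy_seqs_iff:
  "s \<in> cauchy_seqs K (absv z) \<longleftrightarrow> range s \<subseteq> K \<and> Cauchy (\<lambda>n. emb z (s n))"
proof -
  have "absv z (s m - s n) = dist (emb z (s m)) (emb z (s n))" if "range s \<subseteq> K" for m n
  proof -
    have "s m \<in> K" "s n \<in> K" using that by auto
    thus ?thesis by (simp add: absv_def K_subring emb_diff z dist_norm)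
  qed
  thus ?thesis unfolding cauchy_seqs_def Cauchy_def by (auto 4 4)
qed

lemma null_seqs_iff:
  "s \<in> null_seqs K (absv z) \<longleftrightarrow> range s \<subseteq> K \<and> (\<lambda>n. emb z (s n)) \<longlonglongrightarrow> 0"
proof -
  have "absv z (s n) = cmod (emb z (s n))" if "range s \<subseteq> K" for n
    using that by (auto simp: absv_def)
  thus ?thesis unfolding null_seqs_def by (auto simp: tendsto_norm_zero_iff)
qed

text \<open>Sequences are embedded before the limit is taken. On Cauchy sequences this is a ring
  homomorphism whose kernel is the ideal of null sequences.\<close>

definition limv :: "(nat \<Rightarrow> complex) \<Rightarrow> complex" where
  "limv s = lim (\<lambda>n. emb z (s n))"

lemma limv:
  assumes "s \<in> cauchy_seqs K (absv z)"
  shows "(\<lambda>n. emb z (s n)) \<longlonglongrightarrow> limv s"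
  using assms unfolding limv_def cauchy_seqs_iff by (auto simp: Cauchy_convergent_iff convergent_LIMSEQ_iff)

lemma limv_eq:
  assumes "range s \<subseteq> K" "(\<lambda>n. emb z (s n)) \<longlonglongrightarrow> a"
  shows "s \<in> cauchy_seqs K (absv z)" "limv s = a"
  using assms by (auto simp: cauchy_seqs_iff limv_def LIMSEQ_imp_Cauchy limI)

lemma cauchy_closed:
  assumes "s \<in> cauchy_seqs K (absv z)" "r \<in> cauchy_seqs K (absv z)"
  shows "(\<lambda>n. s n + r n) \<in> cauchy_seqs K (absv z)" "limv (\<lambda>n. s n + r n) = limv s + limv r"
    "(\<lambda>n. s n * r n) \<in> cauchy_seqs K (absv z)" "limv (\<lambda>n. s n * r n) = limv s * limv r"
proof -
  have K: "s n \<in> K" "r n \<in> K" for n using assms by (auto simp: cauchy_seqs_def)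
  have "(\<lambda>n. emb z (s n + r n)) \<longlonglongrightarrow> limv s + limv r"
    using tendsto_add[OF limv[OF assms(1)] limv[OF assms(2)]] by (simp add: emb_add z K)
  moreover have "range (\<lambda>n. s n + r n) \<subseteq> K" using K K_subring by auto
  ultimately show "(\<lambda>n. s n + r n) \<in> cauchy_seqs K (absv z)" "limv (\<lambda>n. s n + r n) = limv s + limv r"
    using limv_eq by blast+
  have "(\<lambda>n. emb z (s n * r n)) \<longlonglongrightarrow> limv s * limv r"
    using tendsto_mult[OF limv[OF assms(1)] limv[OF assms(2)]] by (simp add: emb_mult z K)
  moreover have "range (\<lambda>n. s n * r n) \<subseteq> K" using K K_subring by auto
  ultimately show "(\<lambda>n. s n * r n) \<in> cauchy_seqs K (absv z)" "limv (\<lambda>n. s n * r n) = limv s * limv r"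
    using limv_eq by blast+
qed

lemma const_cauchy:
  assumes "x \<in> K"
  shows "(\<lambda>_. x) \<in> cauchy_seqs K (absv z)" "limv (\<lambda>_. x) = emb z x"
  using assms by (auto intro!: limv_eq)

abbreviation CR where "CR \<equiv> cauchy_ring K (absv z)"

lemma CR_simps:
  "carrier CR = cauchy_seqs K (absv z)" "\<one>\<^bsub>CR\<^esub> = (\<lambda>_. 1)" "\<zero>\<^bsub>CR\<^esub> = (\<lambda>_. 0)"
  "s \<otimes>\<^bsub>CR\<^esub> r = (\<lambda>n. s n * r n)" "s \<oplus>\<^bsub>CR\<^esub> r = (\<lambda>n. s n + r n)"
  by (simp_all add: cauchy_ring_def)

lemma ring_CR: "ring CR"
proof (rule ringI)
  show "abelian_group CR"
  proof (rule abelian_groupI)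
    fix s assume s: "s \<in> carrier CR"
    have "(\<lambda>n. -1 * s n) \<in> cauchy_seqs K (absv z)"
      using cauchy_closed(3)[OF const_cauchy(1)[of "-1"]] s K_subring by (simp add: CR_simps)
    thus "\<exists>y\<in>carrier CR. y \<oplus>\<^bsub>CR\<^esub> s = \<zero>\<^bsub>CR\<^esub>"
      by (auto simp: CR_simps intro!: bexI[of _ "\<lambda>n. -1 * s n"])
  qed (auto simp: CR_simps add.assoc add.commute intro: cauchy_closed const_cauchy K_subring)
  show "monoid CR"
    by (rule monoidI) (auto simp: CR_simps mult.assoc intro: cauchy_closed const_cauchy K_subring)
qed (auto simp: CR_simps algebra_simps)

lemma ring_hom_limv: "ring_hom_ring CR complex_ring limv"
proof -
  have "ring complex_ring" by (rule ring_from_type_algebra)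
  thus ?thesis using ring_CR
    by (intro ring_hom_ringI) (auto simp: CR_simps complex_ring_simps cauchy_closed const_cauchy one_K emb_1 z)
qed

lemma kernel_limv: "a_kernel CR complex_ring limv = null_seqs K (absv z)"
proof -
  have "s \<in> null_seqs K (absv z) \<longleftrightarrow> s \<in> cauchy_seqs K (absv z) \<and> limv s = 0" for s
    using limv[of s] limv_eq[of s 0] by (auto simp: null_seqs_iff cauchy_seqs_def)
  thus ?thesis by (auto simp: a_kernel_def' CR_simps complex_ring_simps)
qed

lemma rational_limit:
  obtains s where "s \<in> cauchy_seqs K (absv z)" "range s \<subseteq> \<rat>" "limv s = of_real a"
proof -
  obtain q where q: "(\<lambda>n. of_rat (q n) :: complex) \<longlonglongrightarrow> of_real a" by (rule real_rat_limit)
  have "range (\<lambda>n. of_rat (q n)) \<subseteq> K" using of_rat_K by auto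
  moreover have "(\<lambda>n. emb z (of_rat (q n))) \<longlonglongrightarrow> of_real a" using q by (simp add: emb_of_rat z)
  ultimately show ?thesis using limv_eq by (intro that[of "\<lambda>n. of_rat (q n)"]) auto
qed

lemma limv_rational:
  assumes "s \<in> cauchy_seqs K (absv z)" "range s \<subseteq> \<rat>"
  shows "limv s \<in> \<real>"
proof (rule Reals_limit)
  show "emb z (s n) \<in> \<real>" for n
  proof -
    obtain q where q: "s n = of_rat q" using assms(2) by (meson Rats_cases range_subsetD)
    have "(of_rat q :: complex) \<in> \<real>" by (cases q) (simp add: of_rat_rat)
    thus ?thesis by (simp add: q emb_of_rat z)
  qed
  show "(\<lambda>n. emb z (s n)) \<longlonglongrightarrow> limv s" by (rule limv[OF assms(1)])
qed

text \<open>For real z all embedded values are rational polynomials at a real point, and the reals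
  are closed. For non-real z the numbers 1 and z form a real basis of the complex numbers, and real
  coordinates are limits of rationals.\<close>

lemma image_limv:
  "limv ` carrier CR = (if z \<in> \<real> then \<real> else UNIV)"
proof (cases "z \<in> \<real>")
  case True
  have "limv s \<in> \<real>" if s: "s \<in> cauchy_seqs K (absv z)" for s
  proof (rule Reals_limit)
    show "emb z (s n) \<in> \<real>" for n
    proof -
      have "s n \<in> K" using s by (auto simp: cauchy_seqs_def)
      then obtain p where "s n = rpoly p t" by (elim K_cases)
      hence "emb z (s n) = rpoly p z" using z by (simp add: emb_rpoly)
      also have "cnj \<dots> = \<dots>" using True by (simp add: cnj_rpoly Reals_cnj_iff)
      hence "rpoly p z \<in> \<real>" by (simp add: Reals_cnj_iff)
      finally show ?thesis .
    qed
    show "(\<lambda>n. emb z (s n)) \<longlonglongrightarrow> limv s" by (rule limv[OF s])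
  qed
  moreover have "a \<in> limv ` carrier CR" if "a \<in> \<real>" for a
    using that rational_limit by (metis CR_simps(1) Reals_cases image_eqI)
  ultimately show ?thesis using True by (auto simp: CR_simps)
next
  case False
  have "c \<in> limv ` carrier CR" for c
  proof -
    have im: "Im z \<noteq> 0" using False by (simp add: complex_is_Real_iff)
    \<comment> \<open>Together with \<open>x\<close> below, the real coordinates of \<open>c\<close>
      in the basis 1, z.\<close>
    define y where "y = Im c / Im z"
    define x where "x = Re c - y * Re z"
    have c: "c = of_real x + of_real y * z" using im by (simp add: complex_eq_iff x_def y_def)
    obtain r where r: "r \<in> cauchy_seqs K (absv z)" "limv r = of_real x" using rational_limit by blast
    obtain s where s: "s \<in> cauchy_seqs K (absv z)" "limv s = of_real y" using rational_limit by blast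
    note st = cauchy_closed(3,4)[OF s(1) const_cauchy(1)[OF t_in_K]]
    have "limv (\<lambda>n. r n + s n * t) = c"
      using cauchy_closed(2)[OF r(1) st(1)] st(2) r s const_cauchy(2)[OF t_in_K] by (simp add: c emb_t z)
    thus ?thesis using cauchy_closed(1)[OF r(1) st(1)] by (auto simp: CR_simps)
  qed
  thus ?thesis using False by auto
qed

text \<open>By the first isomorphism theorem the completion is the image of \<open>limv\<close>, and
  the classes of rational sequences correspond to the real numbers. The local degree is thus the
  real dimension of the reals or of the complex numbers.\<close>

lemma local_degree_absv:
  assumes u: "place_norm K u = absv z"
  shows "local_degree K u = (if z \<in> \<real> then 1 else 2)"
proof -
  interpret C: field complex_ring by (rule field_complex_ring)
  interpret L: ring_hom_ring CR complex_ring limv by (rule ring_hom_limv)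
  define T where "T = limv ` carrier CR"
  define S where "S = complex_ring\<lparr>carrier := T\<rparr>"
  have T: "T = (if z \<in> \<real> then \<real> else UNIV)" unfolding T_def by (rule image_limv)
  define Q where "Q = CR Quot null_seqs K (absv z)"
  have Q: "completion K u = Q" by (simp add: completion_def Q_def u)
  have ringQ: "ring Q" unfolding Q_def kernel_limv[symmetric]
    by (rule ideal.quotient_is_ring[OF L.kernel_is_ideal])
  have iso: "(\<lambda>A. the_elem (limv ` A)) \<in> ring_iso Q S"
    using L.FactRing_iso_set_aux unfolding Q_def S_def T_def kernel_limv .
  define g where "g = inv_into (carrier Q) (\<lambda>A. the_elem (limv ` A))"
  have g: "g \<in> ring_iso S Q" unfolding g_def by (rule ring_iso_set_sym[OF ringQ iso])
  have sfT: "subfield T complex_ring"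
    using T subfield_Reals C.carrier_is_subfield by (auto simp: complex_ring_simps)
  have ringS: "ring S" unfolding S_def by (rule C.subring_is_ring[OF subfieldE(1)[OF sfT]])
  have fieldS: "field S" unfolding S_def by (rule C.subfield_iff(2)[OF sfT])
  have dimS: "ring.dimension S (if z \<in> \<real> then 1 else 2) \<real> (carrier S)" and sfS: "subfield \<real> S"
  proof -
    interpret S: field S by (rule fieldS)
    have "ring.dimension S (if z \<in> \<real> then 1 else 2) \<real> (carrier S) \<and> subfield \<real> S"
    proof (cases "z \<in> \<real>")
      case True
      hence c: "carrier S = \<real>" by (simp add: S_def T)
      have "subfield \<real> S" using S.carrier_is_subfield by (simp add: c)
      thus ?thesis using True S.dimension_one[of \<real>] by (simp add: c)
    next
      case False
      hence "S = complex_ring" by (simp add: S_def T ring_of_type_algebra_def)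
      thus ?thesis using False complex_dimension subfield_Reals by (simp add: complex_ring_simps numeral_2_eq_2)
    qed
    thus "ring.dimension S (if z \<in> \<real> then 1 else 2) \<real> (carrier S)" "subfield \<real> S" by blast+
  qed
  have the: "the_elem (limv ` (null_seqs K (absv z) +>\<^bsub>CR\<^esub> s)) = limv s" if "s \<in> carrier CR" for s
    using L.the_elem_simp[OF that] by (simp add: kernel_limv)
  have carQ: "null_seqs K (absv z) +>\<^bsub>CR\<^esub> s \<in> carrier Q" if "s \<in> carrier CR" for s
    using that by (auto simp: Q_def FactRing_def A_RCOSETS_def')
  have inj: "inj_on (\<lambda>A. the_elem (limv ` A)) (carrier Q)"
    using iso by (auto simp: ring_iso_def bij_betw_def)
  have gl: "g (limv s) = null_seqs K (absv z) +>\<^bsub>CR\<^esub> s" if "s \<in> carrier CR" for s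
    unfolding g_def the[OF that, symmetric] by (rule inv_into_f_f[OF inj carQ[OF that]])
  \<comment> \<open>Limits of rational Cauchy sequences are real whatever z is, and every real
    number is such a limit.\<close>
  have ratc: "rat_completion K u = g ` \<real>"
  proof
    show "rat_completion K u \<subseteq> g ` \<real>"
    proof
      fix A assume "A \<in> rat_completion K u"
      then obtain s where s: "A = null_seqs K (absv z) +>\<^bsub>CR\<^esub> s" "s \<in> cauchy_seqs K (absv z)" "range s \<subseteq> \<rat>"
        by (auto simp: rat_completion_def u)
      thus "A \<in> g ` \<real>" using gl[of s] limv_rational[OF s(2,3)] by (auto simp: CR_simps)
    qed
    show "g ` \<real> \<subseteq> rat_completion K u"
    proof
      fix A assume "A \<in> g ` \<real>"
      then obtain a where a: "A = g (of_real a)" by (auto elim: Reals_cases)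
      obtain s where s: "s \<in> cauchy_seqs K (absv z)" "range s \<subseteq> \<rat>" "limv s = of_real a"
        by (rule rational_limit)
      hence "A = null_seqs K (absv z) +>\<^bsub>CR\<^esub> s" using gl[of s] a by (simp add: CR_simps)
      thus "A \<in> rat_completion K u" using s by (auto simp: rat_completion_def u)
    qed
  qed
  have one0: "\<one>\<^bsub>Q\<^esub> \<noteq> \<zero>\<^bsub>Q\<^esub>"
  proof
    assume "\<one>\<^bsub>Q\<^esub> = \<zero>\<^bsub>Q\<^esub>"
    moreover have "(\<lambda>A. the_elem (limv ` A)) \<one>\<^bsub>Q\<^esub> = \<one>\<^bsub>S\<^esub>" using iso by (simp add: ring_iso_def ring_hom_def)
    moreover have "(\<lambda>A. the_elem (limv ` A)) \<zero>\<^bsub>Q\<^esub> = \<zero>\<^bsub>S\<^esub>"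
      using iso ring_hom_zero[OF _ ringQ ringS] by (auto simp: ring_iso_def)
    ultimately show False by (simp add: S_def complex_ring_simps)
  qed
  show ?thesis unfolding local_degree_def Q ratc
    by (rule dim_via_iso[OF ringS ringQ g sfS one0 dimS])
qed

end

text \<open>Both sides are the size of {z, cnj z}.\<close>

lemma local_degree_infinite:
  assumes z: "z \<in> R" and u: "place_norm K u = absv z"
  shows "local_degree K u = card {w \<in> R. absv w = absv z}"
proof -
  have eq: "{w \<in> R. absv w = absv z} = {z, cnj z}"
  proof
    show "{w \<in> R. absv w = absv z} \<subseteq> {z, cnj z}" using absv_eq_imp[OF z] by force
    show "{z, cnj z} \<subseteq> {w \<in> R. absv w = absv z}" using absv_cnj[OF z] cnj_R[OF z] z by simp
  qed
  have "card {z, cnj z} = (if z \<in> \<real> then 1 else 2)"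
    by (auto simp: Reals_cnj_iff card_insert_if)
  thus ?thesis unfolding eq using local_degree_absv[OF z u] by simp
qed

text \<open>Conjugates are grouped by the absolute value that they induce. The local degree is the
  size of a group, so weighted sums over places become plain sums over embeddings.\<close>

lemma sum_infinite_places:
  "(\<Sum>u\<in>infinite_places K. real (local_degree K u) * g (place_norm K u)) = (\<Sum>z\<in>R. g (absv z))"
proof -
  have inj: "inj_on (place_norm K) (infinite_places K)"
    by (intro inj_onI place_norm_inj) (simp_all add: infinite_places_def)
  have ld: "real (local_degree K u) = real (card {w \<in> R. absv w = place_norm K u})"
    if u: "u \<in> infinite_places K" for u
  proof -
    obtain z where z: "z \<in> R" "place_norm K u = absv z"
      using imageI[OF u, of "place_norm K"] unfolding place_norm_infinite by auto
    show ?thesis unfolding local_degree_infinite[OF z] by (simp add: z(2))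
  qed
  have "(\<Sum>z\<in>R. g (absv z)) = (\<Sum>f\<in>absv ` R. \<Sum>z\<in>{w \<in> R. absv w = f}. g (absv z))"
    by (rule sum.image_gen[OF finite_R])
  also have "\<dots> = (\<Sum>f\<in>absv ` R. real (card {w \<in> R. absv w = f}) * g f)"
    by (intro sum.cong refl) simp
  also have "\<dots> = (\<Sum>u\<in>infinite_places K. real (card {w \<in> R. absv w = place_norm K u}) * g (place_norm K u))"
    unfolding place_norm_infinite[symmetric] by (rule sum.reindex_cong[OF inj]) auto
  finally show ?thesis using ld by simp
qed

lemma sum_log_infinite_unit:
  assumes "x \<in> integer_units K"
  shows "(\<Sum>u\<in>infinite_places K. real (local_degree K u) * ln (place_norm K u x)) = 0"
proof -
  have x: "x \<in> K" "x \<noteq> 0" using assms by (auto simp: integer_units_def)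
  have "(\<Sum>u\<in>infinite_places K. real (local_degree K u) * ln (place_norm K u x)) = (\<Sum>z\<in>R. ln (absv z x))"
    by (rule sum_infinite_places[of "\<lambda>f. ln (f x)"])
  also have "\<dots> = ln (\<Prod>z\<in>R. cmod (emb z x))"
    using x by (subst ln_prod) (auto simp: finite_R emb_eq_0_iff absv_def)
  finally show ?thesis by (simp add: norm_prod_emb_unit[OF assms])
qed

end

section \<open>Units that expand a given integer\<close>

lemma nat_root_floor:
  fixes N n :: nat
  assumes "n > 0"
  obtains A where "A ^ n \<le> N" "N < (A + 1) ^ n"
proof -
  define B where "B = (LEAST B. N < B ^ n)"
  have "N < (N + 1) ^ n" using assms self_le_power[of "N + 1" n] by simp
  hence B: "N < B ^ n" unfolding B_def by (rule LeastI)
  have "B \<noteq> 0"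
  proof
    assume "B = 0"
    with B assms show False by (simp add: power_0_left)
  qed
  then obtain A where A: "B = Suc A" by (cases B) auto
  have "\<not> N < A ^ n" using not_less_Least[of A "\<lambda>B. N < B ^ n"] A by (simp add: B_def)
  thus ?thesis using that[of A] B A by simp
qed

lemma coeff_prod_int:
  "finite S \<Longrightarrow> (\<And>z. z \<in> S \<Longrightarrow> algebraic_int z) \<Longrightarrow> algebraic_int (coeff (\<Prod>z\<in>S. [:-z, 1:]) k)"
  for S :: "complex set"
proof (induction S arbitrary: k rule: finite_induct)
  case empty
  show ?case by (cases k) (auto simp: coeff_pCons one_pCons)
next
  case (insert z S)
  have "algebraic_int (coeff [:-z, 1:] i)" for i
    using insert.prems[of z] by (auto simp: coeff_pCons split: nat.splits)
  thus ?case using insert unfolding prod.insert[OF insert.hyps(1,2)] coeff_mult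
    by (intro algebraic_int_sum algebraic_int_mult) auto
qed

text \<open>Here \<open>K\<close> is the field Q(b) of the overview and not the given number field;
  \<open>t\<close> is b itself.\<close>

locale int_generator = prim_field +
  assumes t_int: "algebraic_int t" and t_nz: "t \<noteq> 0" and t_nonunit: "\<not> algebraic_int (inverse t)"
begin

abbreviation n :: nat where "n \<equiv> degree P"

lemma n_pos: "n > 0" by (rule min_rpoly_degree_pos[OF P])

lemma card_R: "card R = n" by (rule min_rpoly_factor(2)[OF P])

lemma root_int: "z \<in> R \<Longrightarrow> algebraic_int z"
  using emb_algebraic_int[of z t] t_int t_in_K by (simp add: emb_t)

lemma coeff_P_int: "of_rat (coeff P k) \<in> (\<int> :: complex set)"
proof (rule rational_algebraic_int_is_int)
  have "of_rat (coeff P k) = coeff (\<Prod>z\<in>R. [:-z, 1:]) k"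
    unfolding min_rpoly_factor(1)[OF P, symmetric] by (simp add: coeff_map_poly)
  thus "algebraic_int (of_rat (coeff P k) :: complex)"
    using coeff_prod_int[OF finite_R root_int] by simp
qed simp

section \<open>The order generated by the integer and its residue classes\<close>

definition Zt :: "complex set" where "Zt = adjoin \<int> t"

lemma is_subring_Zt: "is_subring Zt" unfolding Zt_def by (rule is_subring_adjoin[OF is_subring_Ints])

lemmas Zt_ring = is_subringD[OF is_subring_Zt]

lemma t_in_Zt: "t \<in> Zt" unfolding Zt_def by (rule adjoin_self[OF is_subring_Ints])

lemma Zt_int: "x \<in> Zt \<Longrightarrow> algebraic_int x"
proof -
  assume "x \<in> Zt"
  then obtain p where p: "x = poly p t" "\<And>i. coeff p i \<in> \<int>" by (auto simp: Zt_def adjoin_def)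
  thus ?thesis unfolding p(1) poly_altdef
    by (intro algebraic_int_sum algebraic_int_mult algebraic_int_power t_int int_imp_algebraic_int)
qed

lemma Zt_K: "x \<in> Zt \<Longrightarrow> x \<in> K"
proof -
  assume "x \<in> Zt"
  then obtain p where p: "x = poly p t" "\<And>i. coeff p i \<in> \<int>" by (auto simp: Zt_def adjoin_def)
  have "coeff p i \<in> K" for i using p(2)[of i] K_subring(9) by (auto elim: Ints_cases)
  thus ?thesis unfolding p(1) poly_altdef
    by (intro is_subring_sum[OF is_subring_K] K_subring t_in_K)
qed

lemma Zt_Ints: "of_int k \<in> Zt" by (rule is_subring_of_int[OF is_subring_Zt])

lemma Zt_split:
  assumes "g \<in> Zt"
  obtains k h where "h \<in> Zt" "g = of_int k + t * h"
proof -
  obtain p where p: "g = poly p t" "\<And>i. coeff p i \<in> \<int>" using assms by (auto simp: Zt_def adjoin_def)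
  obtain a q where q: "p = pCons a q" by (cases p)
  have "a \<in> \<int>" using p(2)[of 0] q by simp
  then obtain k where "a = of_int k" by (elim Ints_cases)
  moreover have "poly q t \<in> Zt" unfolding Zt_def
    using p(2)[of "Suc _"] q by (intro adjoinI) simp
  ultimately show ?thesis using that p(1) q by simp
qed

text \<open>The absolute value of the norm of \<open>t\<close>. The floor is exact, as the product
  is an integer.\<close>

definition c :: nat where "c = nat \<lfloor>\<Prod>z\<in>R. cmod z\<rfloor>"

lemma c_eq: "real c = (\<Prod>z\<in>R. cmod z)"
proof -
  obtain k where "(\<Prod>z\<in>R. emb z t) = of_int k" using prod_emb_Ints[OF t_in_K t_int] by (elim Ints_cases)
  hence "(\<Prod>z\<in>R. z) = of_int k" by (simp add: emb_t)
  hence "(\<Prod>z\<in>R. cmod z) = of_int \<bar>k\<bar>" unfolding prod_norm by simp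
  thus ?thesis by (simp add: c_def)
qed

text \<open>The constant coefficient of \<open>P\<close> is the norm up to sign, and P(t) = 0
  exhibits it as a multiple of t. Hence integers need be known only modulo \<open>c\<close> when
  working modulo t.\<close>

lemma t_cofactor: "\<exists>w\<in>Zt. of_nat c = t * w"
proof -
  obtain a Q where Q: "P = pCons a Q" by (cases P)
  have "rpoly P t = 0" using P by (simp add: min_rpoly_def)
  hence eq: "of_rat a = t * (- rpoly Q t)" by (simp add: Q add_eq_0_iff)
  have "rpoly Q t \<in> Zt" unfolding rpoly_def Zt_def
    using coeff_P_int[of "Suc _"] Q by (intro adjoinI) (simp add: coeff_map_poly)
  hence w: "- rpoly Q t \<in> Zt" by (rule Zt_ring)
  have "of_rat a = poly (map_poly of_rat P) (0::complex)" by (simp add: Q map_poly_pCons)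
  also have "\<dots> = (\<Prod>z\<in>R. -z)" unfolding min_rpoly_factor(1)[OF P] by (simp add: poly_prod)
  finally have "cmod (of_rat a) = real c" by (simp add: c_eq prod_norm[symmetric])
  moreover obtain k where k: "of_rat a = (of_int k :: complex)"
    using coeff_P_int[of 0] Q by (auto elim: Ints_cases)
  ultimately have "c = nat \<bar>k\<bar>" by simp
  hence "of_nat c = (of_rat a :: complex) \<or> of_nat c = - (of_rat a :: complex)"
    by (cases "k \<ge> 0") (simp_all add: k)
  thus ?thesis
  proof
    assume "of_nat c = (of_rat a :: complex)"
    thus ?thesis using eq w by (intro bexI[of _ "- rpoly Q t"]) simp_all
  next
    assume "of_nat c = - (of_rat a :: complex)"
    hence "of_nat c = t * (- (- rpoly Q t))" using eq by simp
    thus ?thesis using Zt_ring(5)[OF w] by blast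
  qed
qed

lemma emb_t_self: "x \<in> K \<Longrightarrow> emb t x = x"
  by (elim K_cases) (simp add: emb_rpoly t_in_R)

text \<open>Since t is itself one of the conjugates, the quotient is the product of the other
  conjugates of x.\<close>

lemma norm_cofactor:
  assumes "x \<in> K" "algebraic_int x" "x \<noteq> 0"
  shows "algebraic_int ((\<Prod>z\<in>R. emb z x) / x)"
proof -
  have "(\<Prod>z\<in>R. emb z x) = emb t x * (\<Prod>z\<in>R - {t}. emb z x)"
    by (rule prod.remove[OF finite_R t_in_R])
  hence "(\<Prod>z\<in>R. emb z x) / x = (\<Prod>z\<in>R - {t}. emb z x)"
    using assms by (simp add: emb_t_self)
  also have "algebraic_int \<dots>" using assms by (intro algebraic_int_prod emb_algebraic_int) auto
  finally show ?thesis .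
qed

text \<open>If the norm were 1 or -1, the integral cofactor norm/t would be 1/t up to sign.\<close>

lemma c_ge_2: "c \<ge> 2"
proof -
  have "real c \<ge> 1" using norm_prod_emb_ge_1[OF t_in_K t_int t_nz] by (simp add: c_eq emb_t)
  moreover have "c \<noteq> 1"
  proof
    assume "c = 1"
    have prod: "(\<Prod>z\<in>R. emb z t) = (\<Prod>z\<in>R. z)" by (simp add: emb_t)
    obtain k where k: "(\<Prod>z\<in>R. emb z t) = of_int k" using prod_emb_Ints[OF t_in_K t_int] by (elim Ints_cases)
    have "cmod (of_int k) = 1" unfolding k[symmetric] prod prod_norm[symmetric] c_eq[symmetric] \<open>c = 1\<close> by simp
    hence "k = 1 \<or> k = -1" by (auto simp: abs_if split: if_splits)
    moreover have "algebraic_int (of_int k / t)" using norm_cofactor[OF t_in_K t_int t_nz] k by simp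
    ultimately have "algebraic_int (inverse t)" by (auto simp: divide_inverse)
    with t_nonunit show False by simp
  qed
  ultimately show ?thesis by simp
qed

text \<open>An expansion in base t with digits 0, ..., c - 1: each further power of t costs one
  digit.\<close>

lemma residues_power_t:
  "\<exists>D. finite D \<and> card D \<le> c ^ m \<and> (\<forall>g\<in>Zt. \<exists>d\<in>D. \<exists>h\<in>Zt. g = d + t ^ m * h)"
proof (induction m)
  case 0
  show ?case by (rule exI[of _ "{0}"]) auto
next
  case (Suc m)
  then obtain D where D: "finite D" "card D \<le> c ^ m" "\<And>g. g \<in> Zt \<Longrightarrow> \<exists>d\<in>D. \<exists>h\<in>Zt. g = d + t ^ m * h"
    by blast
  obtain w where w: "w \<in> Zt" "of_nat c = t * w" using t_cofactor by blast
  define D' where "D' = (\<lambda>(d, a). d + t ^ m * of_nat a) ` (D \<times> {..<c})"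
  have "finite D'" using D by (simp add: D'_def)
  moreover have "card D' \<le> card (D \<times> {..<c})" unfolding D'_def using D by (intro card_image_le) simp
  hence "card D' \<le> c ^ Suc m" using D(2) by (simp add: card_cartesian_product) (metis mult.commute mult_le_mono1 order.trans)
  moreover have "\<exists>d\<in>D'. \<exists>h\<in>Zt. g = d + t ^ Suc m * h" if g: "g \<in> Zt" for g
  proof -
    obtain d h where dh: "d \<in> D" "h \<in> Zt" "g = d + t ^ m * h" using D(3)[OF g] by blast
    obtain k h1 where h1: "h1 \<in> Zt" "h = of_int k + t * h1" using Zt_split[OF dh(2)] .
    define a where "a = nat (k mod int c)"
    have c0: "int c > 0" using c_ge_2 by simp
    hence a: "a < c" "int a = k mod int c" by (simp_all add: a_def nat_less_iff)
    have "k = (k div int c) * int c + int a" by (simp add: a)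
    hence "(of_int k :: complex) = of_int (k div int c) * of_nat c + of_nat a"
      by (metis of_int_add of_int_mult of_int_of_nat_eq)
    hence "g = (d + t ^ m * of_nat a) + t ^ Suc m * (of_int (k div int c) * w + h1)"
      by (simp add: dh(3) h1(2) w(2) algebra_simps)
    moreover have "d + t ^ m * of_nat a \<in> D'" using dh(1) a(1) by (force simp: D'_def)
    moreover have "of_int (k div int c) * w + h1 \<in> Zt" by (intro Zt_ring(4,6) Zt_Ints w h1)
    ultimately show ?thesis by blast
  qed
  ultimately show ?case by blast
qed

text \<open>Division by the monic \<open>P\<close> leaves a remainder of degree below n with integer
  coefficients, and these are reduced modulo \<open>M\<close>.\<close>

lemma residues_int:
  assumes "M \<noteq> 0"
  shows "\<exists>D. finite D \<and> (\<forall>g\<in>Zt. \<exists>d\<in>D. \<exists>h\<in>Zt. g = d + of_int M * h)"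
proof -
  define D where "D = (\<lambda>a. \<Sum>i<n. of_int (a i) * t ^ i) ` (PiE {..<n} (\<lambda>_. {0..<\<bar>M\<bar>}))"
  have "finite D" by (auto simp: D_def intro!: finite_PiE)
  moreover have "\<exists>d\<in>D. \<exists>h\<in>Zt. g = d + of_int M * h" if g: "g \<in> Zt" for g
  proof -
    obtain p where p: "g = poly p t" "\<And>i. coeff p i \<in> \<int>" using g by (auto simp: Zt_def adjoin_def)
    let ?P = "map_poly of_rat P :: complex poly"
    have lc: "lead_coeff ?P = 1" using P by (simp add: min_rpoly_def degree_map_poly coeff_map_poly)
    have PI: "coeff ?P i \<in> \<int>" for i using coeff_P_int by (simp add: coeff_map_poly)
    obtain q r where qr: "\<forall>i. coeff r i \<in> \<int>" "p = q * ?P + r" "r = 0 \<or> degree r < degree ?P"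
      using monic_division_in_subring[OF is_subring_Ints lc PI p(2)] by blast
    have "poly ?P t = 0" using P by (simp add: min_rpoly_def rpoly_def)
    hence gr: "g = poly r t" by (simp add: p(1) qr(2))
    have "degree r < n" using qr(3) n_pos by (auto simp: degree_map_poly)
    have "\<forall>i. \<exists>k. coeff r i = of_int k" using qr(1) by (auto elim: Ints_cases)
    then obtain k where k: "\<And>i. coeff r i = of_int (k i)" by metis
    have "g = (\<Sum>i<n. of_int (k i) * t ^ i)"
      unfolding gr poly_altdef k[symmetric] using \<open>degree r < n\<close>
      by (intro sum.mono_neutral_left) (auto simp: coeff_eq_0 not_le)
    also have "\<dots> = (\<Sum>i<n. of_int (k i mod \<bar>M\<bar>) * t ^ i + of_int M * (of_int (sgn M * (k i div \<bar>M\<bar>)) * t ^ i))"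
    proof (rule sum.cong)
      fix i
      \<comment> \<open>\<open>M\<close> will be a norm and may be negative, hence the sign.\<close>
      have "k i = k i mod \<bar>M\<bar> + M * (sgn M * (k i div \<bar>M\<bar>))"
        by (metis abs_sgn mod_mult_div_eq mult.assoc add.commute mult.commute)
      hence "(of_int (k i) :: complex) = of_int (k i mod \<bar>M\<bar>) + of_int M * of_int (sgn M * (k i div \<bar>M\<bar>))"
        by (metis of_int_add of_int_mult)
      thus "of_int (k i) * t ^ i = of_int (k i mod \<bar>M\<bar>) * t ^ i + of_int M * (of_int (sgn M * (k i div \<bar>M\<bar>)) * t ^ i)"
        by (simp only: distrib_right mult.assoc)
    qed simp
    also have "\<dots> = (\<Sum>i<n. of_int (k i mod \<bar>M\<bar>) * t ^ i) + of_int M * (\<Sum>i<n. of_int (sgn M * (k i div \<bar>M\<bar>)) * t ^ i)"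
      by (simp only: sum.distrib sum_distrib_left)
    finally have "g = (\<Sum>i<n. of_int (restrict (\<lambda>i. k i mod \<bar>M\<bar>) {..<n} i) * t ^ i) + of_int M * (\<Sum>i<n. of_int (sgn M * (k i div \<bar>M\<bar>)) * t ^ i)"
      by simp
    moreover have "(\<Sum>i<n. of_int (restrict (\<lambda>i. k i mod \<bar>M\<bar>) {..<n} i) * t ^ i) \<in> D"
    proof -
      have "restrict (\<lambda>i. k i mod \<bar>M\<bar>) {..<n} \<in> PiE {..<n} (\<lambda>_. {0..<\<bar>M\<bar>})"
        unfolding restrict_PiE_iff using assms by simp
      thus ?thesis unfolding D_def by (rule imageI)
    qed
    moreover have "(\<Sum>i<n. of_int (sgn M * (k i div \<bar>M\<bar>)) * t ^ i) \<in> Zt"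
      by (intro is_subring_sum[OF is_subring_Zt] Zt_ring(4,7) Zt_Ints t_in_Zt)
    ultimately show ?thesis by blast
  qed
  ultimately show ?thesis by blast
qed

lemma powers_independent:
  assumes "(\<Sum>i<n. of_int (k i) * t ^ i) = 0" "i < n"
  shows "k i = 0"
proof -
  define q where "q = (\<Sum>i<n. monom (of_int (k i)) i :: rat poly)"
  have "rpoly q t = 0" using assms(1) by (simp add: q_def rpoly_sum rpoly_monom)
  hence "P dvd q" by (rule min_rpoly_dvd[OF P])
  moreover have "degree q < n" unfolding q_def using n_pos
    by (intro degree_sum_less) (auto intro: le_less_trans[OF degree_monom_le])
  ultimately have "q = 0" using dvd_imp_degree_le[of P q] by linarith
  moreover have "coeff q i = of_int (k i)" using assms(2) by (simp add: q_def coeff_sum)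
  ultimately show ?thesis by simp
qed

text \<open>Bounds a polynomial of degree below n at every conjugate by \<open>B\<close> times its
  largest coefficient; the summand 1 makes B at least 1.\<close>

definition B :: real where "B = 1 + (\<Sum>z\<in>R. \<Sum>i<n. cmod z ^ i)"

lemma B_ge_1: "B \<ge> 1" unfolding B_def by (simp add: sum_nonneg)

text \<open>The geometric mean of the absolute values of the conjugates of \<open>t\<close>, hence
  the common growth rate that balanced multiples of t^m can have at all conjugates.\<close>

definition \<rho> :: real where "\<rho> = real c powr (1 / real n)"

lemma rho_gt_1: "\<rho> > 1" using c_ge_2 n_pos by (simp add: \<rho>_def)

lemma rho_power: "\<rho> ^ n = real c"
  using c_ge_2 n_pos unfolding \<rho>_def by (subst powr_realpow[symmetric]) (auto simp: powr_powr)

lemma balanced_element_upper: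
  obtains x where "x \<in> Zt" "x \<noteq> 0" "\<And>z. z \<in> R \<Longrightarrow> cmod (z ^ m * emb z x) \<le> B * \<rho> ^ m"
proof -
  \<comment> \<open>The integer part of c^(m/n): the coefficient vectors with entries 0, ..., A
    number (A + 1)^n > c^m, more than there are residues modulo t^m, while A stays below
    \<rho>^m.\<close>
  obtain A where A: "A ^ n \<le> c ^ m" "c ^ m < (A + 1) ^ n" using nat_root_floor[OF n_pos, of "c ^ m"] .
  have "(real A) ^ n \<le> (\<rho> ^ m) ^ n"
  proof -
    have "(\<rho> ^ m) ^ n = (\<rho> ^ n) ^ m" by (simp add: power_mult[symmetric] mult.commute)
    also have "\<dots> = real (c ^ m)" by (simp add: rho_power)
    finally show ?thesis using A(1) by (metis of_nat_le_iff of_nat_power)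
  qed
  hence A_rho: "real A \<le> \<rho> ^ m" using rho_gt_1 n_pos by (simp add: power_mono_iff)
  obtain D where "finite D \<and> card D \<le> c ^ m \<and> (\<forall>g\<in>Zt. \<exists>d\<in>D. \<exists>h\<in>Zt. g = d + t ^ m * h)"
    using residues_power_t[of m] by (elim exE)
  hence D: "finite D" "card D \<le> c ^ m" "\<And>g. g \<in> Zt \<Longrightarrow> \<exists>d\<in>D. \<exists>h\<in>Zt. g = d + t ^ m * h"
    by auto
  define F where "F = PiE {..<n} (\<lambda>_. {0..int A})"
  define y where "y = (\<lambda>a :: nat \<Rightarrow> int. \<Sum>i<n. of_int (a i) * t ^ i)"
  have yZ: "y a \<in> Zt" for a
    unfolding y_def by (intro is_subring_sum[OF is_subring_Zt] Zt_ring(4,7) Zt_Ints t_in_Zt)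
  have "\<forall>a. \<exists>d. d \<in> D \<and> (\<exists>h\<in>Zt. y a = d + t ^ m * h)" using D(3)[OF yZ] by blast
  then obtain d where d: "\<And>a. d a \<in> D" "\<And>a. \<exists>h\<in>Zt. y a = d a + t ^ m * h" by metis
  have "card F = (A + 1) ^ n" by (simp add: F_def card_PiE nat_add_distrib)
  moreover have "card (d ` F) \<le> card D" using d(1) D(1) by (intro card_mono) auto
  ultimately have "card (d ` F) < card F" using A(2) D(2) by linarith
  hence "\<not> inj_on d F" by (rule pigeonhole)
  then obtain a b where ab: "a \<in> F" "b \<in> F" "a \<noteq> b" "d a = d b" by (auto simp: inj_on_def)
  obtain h h' where h: "h \<in> Zt" "y a = d a + t ^ m * h" "h' \<in> Zt" "y b = d b + t ^ m * h'" using d(2) by meson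
  have diff: "y a - y b = (\<Sum>i<n. of_int (a i - b i) * t ^ i)"
    by (simp add: y_def sum_subtractf[symmetric] algebra_simps)
  have "y a \<noteq> y b"
  proof
    assume "y a = y b"
    hence "(\<Sum>i<n. of_int (a i - b i) * t ^ i) = 0" using diff by simp
    hence "a i = b i" if "i < n" for i using powers_independent[of "\<lambda>i. a i - b i"] that by simp
    hence "a = b" using ab(1,2) by (intro PiE_ext[of a "{..<n}" _ b]) (auto simp: F_def)
    with ab(3) show False by simp
  qed
  have eq: "t ^ m * (h - h') = y a - y b" using h ab(4) by (simp add: algebra_simps)
  show ?thesis
  proof (rule that)
    show "h - h' \<in> Zt" by (intro Zt_ring(3) h)
    show "h - h' \<noteq> 0" using eq \<open>y a \<noteq> y b\<close> by auto
    fix z assume z: "z \<in> R"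
    have hK: "h - h' \<in> K" by (intro Zt_K Zt_ring(3) h)
    define q where "q = (\<Sum>i<n. monom (of_int (a i - b i)) i :: rat poly)"
    have qv: "rpoly q x = (\<Sum>i<n. of_int (a i - b i) * x ^ i)" for x
      unfolding q_def rpoly_sum rpoly_monom of_rat_of_int_eq ..
    have "y a - y b = rpoly q t" unfolding diff qv ..
    hence "emb z (y a - y b) = rpoly q z" using z by (simp add: emb_rpoly)
    hence "z ^ m * emb z (h - h') = (\<Sum>i<n. of_int (a i - b i) * z ^ i)"
      using z hK t_in_K unfolding eq[symmetric]
      by (simp add: emb_mult emb_power emb_t K_subring qv del: of_int_diff)
    hence "cmod (z ^ m * emb z (h - h')) \<le> (\<Sum>i<n. cmod (of_int (a i - b i) * z ^ i))"
      by (simp only: norm_sum)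
    also have "\<dots> \<le> (\<Sum>i<n. real A * cmod z ^ i)"
    proof (rule sum_mono)
      fix i assume i: "i \<in> {..<n}"
      have "a i \<in> {0..int A}" "b i \<in> {0..int A}"
        using PiE_mem[OF ab(1)[unfolded F_def] i] PiE_mem[OF ab(2)[unfolded F_def] i] by blast+
      hence "\<bar>a i - b i\<bar> \<le> int A" unfolding atLeastAtMost_iff by linarith
      hence "real_of_int \<bar>a i - b i\<bar> \<le> real_of_int (int A)" by (simp only: of_int_le_iff)
      hence "cmod (of_int (a i - b i)) \<le> real A" by (simp only: norm_of_int of_int_abs of_int_of_nat_eq)
      thus "cmod (of_int (a i - b i) * z ^ i) \<le> real A * cmod z ^ i"
        unfolding norm_mult norm_power by (intro mult_right_mono) auto
    qed
    also have "\<dots> = (\<Sum>i<n. cmod z ^ i) * real A" by (simp add: sum_distrib_left[symmetric] mult.commute)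
    also have "\<dots> \<le> B * \<rho> ^ m"
    proof (intro mult_mono A_rho)
      have "(\<Sum>i<n. cmod z ^ i) \<le> (\<Sum>z\<in>R. \<Sum>i<n. cmod z ^ i)"
        by (rule member_le_sum[of z R "\<lambda>z. \<Sum>i<n. cmod z ^ i"]) (simp_all add: z finite_R sum_nonneg)
      thus "(\<Sum>i<n. cmod z ^ i) \<le> B" by (simp add: B_def)
    qed (use B_ge_1 in auto)
    finally show "cmod (z ^ m * emb z (h - h')) \<le> B * \<rho> ^ m" .
  qed
qed

text \<open>The product of all |z^m \<open>emb z x\<close>| is c^m times the absolute norm of x,
  hence at least c^m = (\<rho>^m)^n. As n - 1 of the factors are at most B \<rho>^m, the remaining
  one is at least \<rho>^m / B^(n-1).\<close>

lemma balanced_element: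
  obtains x where "x \<in> Zt" "x \<noteq> 0"
    "\<And>z. z \<in> R \<Longrightarrow> cmod (z ^ m * emb z x) \<le> B * \<rho> ^ m"
    "\<And>z. z \<in> R \<Longrightarrow> \<rho> ^ m \<le> B ^ (n - 1) * cmod (z ^ m * emb z x)"
    "(\<Prod>z\<in>R. cmod (emb z x)) \<le> B ^ n"
proof -
  obtain x where x: "x \<in> Zt" "x \<noteq> 0" and up: "\<And>z. z \<in> R \<Longrightarrow> cmod (z ^ m * emb z x) \<le> B * \<rho> ^ m"
    using balanced_element_upper by blast
  define v where "v = (\<lambda>z. cmod (z ^ m * emb z x))"
  have v0: "v z \<ge> 0" for z by (simp add: v_def)
  have rho0: "\<rho> ^ m > 0" using rho_gt_1 by simp
  have rn: "(\<rho> ^ m) ^ n = real c ^ m"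
    by (simp add: rho_power[symmetric] power_mult[symmetric] mult.commute)
  have N1: "(\<Prod>z\<in>R. cmod (emb z x)) \<ge> 1" using x by (intro norm_prod_emb_ge_1 Zt_K Zt_int)
  have prod: "(\<Prod>z\<in>R. v z) = real c ^ m * (\<Prod>z\<in>R. cmod (emb z x))"
    by (simp add: v_def norm_mult norm_power prod.distrib prod_power_distrib[symmetric] c_eq)
  have "(\<Prod>z\<in>R. v z) \<le> (\<Prod>z\<in>R. B * \<rho> ^ m)" using up v0 by (intro prod_mono) (auto simp: v_def)
  also have "\<dots> = B ^ n * real c ^ m" by (simp add: card_R power_mult_distrib rn)
  finally have "real c ^ m * (\<Prod>z\<in>R. cmod (emb z x)) \<le> real c ^ m * B ^ n" by (simp add: prod mult.commute)
  hence bound: "(\<Prod>z\<in>R. cmod (emb z x)) \<le> B ^ n" using c_ge_2 by simp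
  have low: "\<rho> ^ m \<le> B ^ (n - 1) * v z" if z: "z \<in> R" for z
  proof -
    have "\<rho> ^ m * (\<rho> ^ m) ^ (n - 1) = (\<rho> ^ m) ^ n" using n_pos by (cases n) auto
    also have "\<dots> = real c ^ m * 1" by (simp add: rn)
    also have "\<dots> \<le> (\<Prod>z\<in>R. v z)" unfolding prod using N1 by (intro mult_left_mono) auto
    also have "\<dots> = v z * (\<Prod>z\<in>R - {z}. v z)" by (rule prod.remove[OF finite_R z])
    also have "\<dots> \<le> v z * (\<Prod>z\<in>R - {z}. B * \<rho> ^ m)"
      using up v0 by (intro mult_left_mono prod_mono) (auto simp: v_def)
    also have "\<dots> = (B ^ (n - 1) * v z) * (\<rho> ^ m) ^ (n - 1)"
      using z finite_R by (simp add: card_R power_mult_distrib)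
    finally show ?thesis using rho0 by simp
  qed
  show ?thesis using that[OF x up _ bound] low by (simp add: v_def)
qed

lemma expanding_unit:
  obtains m \<epsilon> where "m > 0" "\<epsilon> \<in> integer_units K" "\<forall>z\<in>R. cmod (z ^ m * emb z \<epsilon>) > 1"
proof -
  have "\<forall>m. \<exists>x. x \<in> Zt \<and> x \<noteq> 0 \<and>
      (\<forall>z\<in>R. cmod (z ^ m * emb z x) \<le> B * \<rho> ^ m \<and> \<rho> ^ m \<le> B ^ (n - 1) * cmod (z ^ m * emb z x)) \<and>
      (\<Prod>z\<in>R. cmod (emb z x)) \<le> B ^ n"
    using balanced_element by metis
  then obtain x where x: "\<And>m. x m \<in> Zt" "\<And>m. x m \<noteq> 0"
      and up: "\<And>m z. z \<in> R \<Longrightarrow> cmod (z ^ m * emb z (x m)) \<le> B * \<rho> ^ m"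
      and low: "\<And>m z. z \<in> R \<Longrightarrow> \<rho> ^ m \<le> B ^ (n - 1) * cmod (z ^ m * emb z (x m))"
      and bound: "\<And>m. (\<Prod>z\<in>R. cmod (emb z (x m))) \<le> B ^ n"
    by metis
  have xK: "x m \<in> K" and xint: "algebraic_int (x m)" for m using x Zt_K Zt_int by blast+
  \<comment> \<open>The gap between indices after which growth by \<rho>^s outweighs B^n, the
    product of the loss B in the upper and B^(n-1) in the lower estimate.\<close>
  obtain s where s: "B ^ n < \<rho> ^ s" using real_arch_pow[OF rho_gt_1] by blast
  have "s > 0"
  proof (rule ccontr)
    assume "\<not> s > 0"
    thus False using s one_le_power[OF B_ge_1, of n] by simp
  qed
  have "\<forall>m. \<exists>k. (\<Prod>z\<in>R. emb z (x m)) = of_int k" using prod_emb_Ints[OF xK xint] by (auto elim: Ints_cases)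
  then obtain N where N: "\<And>m. (\<Prod>z\<in>R. emb z (x m)) = of_int (N m)" by metis
  have N0: "N m \<noteq> 0" for m using prod_emb_nonzero[OF xK x(2), of m] N[of m] by auto
  define C where "C = \<lceil>B ^ n\<rceil>"
  have NC: "N m \<in> {-C..C} - {0}" for m
  proof -
    have "\<bar>real_of_int (N m)\<bar> = (\<Prod>z\<in>R. cmod (emb z (x m)))" unfolding prod_norm N by simp
    also have "\<dots> \<le> B ^ n" by (rule bound)
    finally have "\<bar>N m\<bar> \<le> C" unfolding C_def by linarith
    thus ?thesis using N0[of m] by auto
  qed
  obtain D where D: "\<And>M. M \<noteq> 0 \<Longrightarrow> finite (D M)"
      "\<And>M g. M \<noteq> 0 \<Longrightarrow> g \<in> Zt \<Longrightarrow> \<exists>d\<in>D M. \<exists>h\<in>Zt. g = d + of_int M * h"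
    using residues_int by metis
  have "\<forall>m. \<exists>d. d \<in> D (N m) \<and> (\<exists>h\<in>Zt. x m = d + of_int (N m) * h)"
    using D(2)[OF N0 x(1)] by blast
  then obtain d where d: "\<And>m. d m \<in> D (N m)" "\<And>m. \<exists>h\<in>Zt. x m = d m + of_int (N m) * h" by metis
  \<comment> \<open>Only multiples of \<open>s\<close> are compared, so distinct indices are at
    least \<open>s\<close> apart.\<close>
  define key where "key = (\<lambda>j. (N (j * s), d (j * s)))"
  have "range key \<subseteq> Sigma ({-C..C} - {0}) D" using NC d(1) by (auto simp: key_def)
  moreover have "finite (Sigma ({-C..C} - {0}) D)" using D(1) by (intro finite_SigmaI) auto
  ultimately have "finite (range key)" by (rule finite_subset)
  hence "\<not> inj key" using range_inj_infinite by blast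
  then obtain i j where ij: "i < j" "key i = key j"
    by (metis injI linorder_neqE_nat)
  define k l where "k = i * s" and "l = j * s"
  have kl: "k < l" using ij(1) \<open>s > 0\<close> by (simp add: k_def l_def)
  have eqN: "N k = N l" "d k = d l" using ij(2) by (simp_all add: key_def k_def l_def)
  \<comment> \<open>With N the common norm, the quotient is 1 + (N / x_a)(h' - h), and N / x_a is
    integral as the product of the other conjugates. The hypotheses are symmetric in a and b, so the
    inverse quotient is integral as well.\<close>
  have quot: "algebraic_int (x b / x a)" if "N a = N b" "d a = d b" for a b
  proof -
    obtain h where h: "h \<in> Zt" "x a = d a + of_int (N a) * h" using d(2) by blast
    obtain h' where h': "h' \<in> Zt" "x b = d b + of_int (N b) * h'" using d(2) by blast
    have "x b = x a + of_int (N a) * (h' - h)" using h h' that by (simp add: algebra_simps)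
    hence "x b / x a = 1 + (of_int (N a) / x a) * (h' - h)"
      using x(2)[of a] by (simp add: field_simps)
    moreover have "algebraic_int (of_int (N a) / x a)"
      using norm_cofactor[OF xK xint x(2), of a] by (simp add: N)
    moreover have "algebraic_int (h' - h)" using h h' by (intro Zt_int Zt_ring(3))
    ultimately have "algebraic_int (1 + (of_int (N a) / x a) * (h' - h))"
      by (intro algebraic_int_add algebraic_int_mult algebraic_int_1)
    thus ?thesis by (simp only: \<open>x b / x a = _\<close>)
  qed
  define \<epsilon> where "\<epsilon> = x l / x k"
  show ?thesis
  proof (rule that)
    show "l - k > 0" using kl by simp
    have "algebraic_int \<epsilon>" "algebraic_int (inverse \<epsilon>)"
      using quot[of k l] quot[of l k] eqN by (simp_all add: \<epsilon>_def)
    thus "\<epsilon> \<in> integer_units K"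
      using x(2) xK by (auto simp: integer_units_def \<epsilon>_def divide_K)
    show "\<forall>z\<in>R. cmod (z ^ (l - k) * emb z \<epsilon>) > 1"
    proof
      fix z assume z: "z \<in> R"
      have z0: "z \<noteq> 0" using z emb_eq_0_iff[OF z t_in_K] t_nz by (simp add: emb_t)
      define a b where "a = cmod (z ^ k * emb z (x k))" and "b = cmod (z ^ l * emb z (x l))"
      have a0: "a > 0" using z0 z x(2)[of k] xK by (simp add: a_def emb_eq_0_iff)
      have "z ^ (l - k) * emb z \<epsilon> * (z ^ k * emb z (x k)) = (z ^ (l - k) * z ^ k) * emb z (x l)"
        using z xK x(2)[of k] by (simp add: \<epsilon>_def emb_divide emb_eq_0_iff)
      also have "z ^ (l - k) * z ^ k = z ^ l" using kl by (simp add: power_add[symmetric])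
      finally have "cmod (z ^ (l - k) * emb z \<epsilon>) * a = b"
        unfolding a_def b_def norm_mult[symmetric] by (rule arg_cong)
      hence "cmod (z ^ (l - k) * emb z \<epsilon>) = b / a" using a0 by (simp add: field_simps)
      \<comment> \<open>Here a is at most B \<rho>^k and b at least \<rho>^l / B^(n-1), while
        \<rho>^(l-k) > B^n by the choice of \<open>s\<close>.\<close>
      moreover have "a < b"
      proof -
        have "Suc i * s \<le> j * s" using ij(1) by (intro mult_le_mono1) simp
        hence "s \<le> l - k" by (simp add: k_def l_def)
        hence "B ^ n < \<rho> ^ (l - k)" using s rho_gt_1 by (meson less_le_trans power_increasing less_imp_le)
        hence "B ^ n * \<rho> ^ k < \<rho> ^ (l - k) * \<rho> ^ k" using rho_gt_1 by (intro mult_strict_right_mono) auto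
        also have "\<rho> ^ (l - k) * \<rho> ^ k = \<rho> ^ l" using kl by (simp add: power_add[symmetric])
        also have "\<dots> \<le> B ^ (n - 1) * b" using low[OF z] by (simp add: b_def)
        finally have "B ^ (n - 1) * (B * \<rho> ^ k) < B ^ (n - 1) * b"
          using n_pos by (cases n) (auto simp: mult_ac)
        hence "B * \<rho> ^ k < b" using B_ge_1 by simp
        moreover have "a \<le> B * \<rho> ^ k" using up[OF z] by (simp add: a_def)
        ultimately show ?thesis by simp
      qed
      ultimately show "cmod (z ^ (l - k) * emb z \<epsilon>) > 1" using a0 by simp
    qed
  qed
qed

end

context prim_field
begin

text \<open>The unit is found in Q(b). An embedding of \<open>K\<close> sends b to a root w of its
  minimal polynomial, so on Q(b) it agrees with the embedding belonging to w.\<close>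

lemma expanding_unit_infinite_places:
  assumes b: "b \<in> K" "b \<noteq> 0" "algebraic_int b" "\<not> algebraic_int (inverse b)"
  obtains m \<epsilon> where "m > 0" "\<epsilon> \<in> integer_units K"
    "\<forall>u\<in>infinite_places K. place_norm K u (b ^ m * \<epsilon>) > 1"
proof -
  obtain Q where Q: "min_rpoly Q b" using min_rpoly_exists[OF algebraic_K[OF b(1)]] .
  interpret L: int_generator "simple_ext b" b Q
    using Q b by unfold_locales auto
  obtain m \<epsilon> where m: "m > 0" and eps: "\<epsilon> \<in> integer_units (simple_ext b)"
      and big: "\<forall>z\<in>rroots Q. cmod (z ^ m * L.emb z \<epsilon>) > 1"
    by (rule L.expanding_unit)
  have sub: "simple_ext b \<subseteq> K" unfolding K_eq using b(1) K_eq by (intro simple_ext_mono) simp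
  show ?thesis
  proof (rule that[OF m])
    show epsK: "\<epsilon> \<in> integer_units K" using eps sub by (auto simp: integer_units_def)
    show "\<forall>u\<in>infinite_places K. place_norm K u (b ^ m * \<epsilon>) > 1"
    proof
      fix u assume u: "u \<in> infinite_places K"
      obtain z where z: "z \<in> R" "place_norm K u = absv z"
        using imageI[OF u, of "place_norm K"] unfolding place_norm_infinite by auto
      obtain p where p: "\<epsilon> = rpoly p b" using eps by (auto simp: integer_units_def simple_ext_def)
      define w where "w = emb z b"
      have "rpoly Q w = emb z (rpoly Q b)" unfolding w_def using emb_rpoly_K[OF z(1) b(1)] by simp
      hence w: "w \<in> rroots Q" using Q z by (simp add: rroots_def min_rpoly_def emb_0)
      have eK: "\<epsilon> \<in> K" using epsK by (simp add: integer_units_def)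
      have "emb z (b ^ m * \<epsilon>) = w ^ m * rpoly p w"
        using z b eK emb_rpoly_K[OF z(1) b(1), of p] by (simp add: emb_mult emb_power K_subring w_def p)
      also have "rpoly p w = L.emb w \<epsilon>" using w by (simp add: p L.emb_rpoly)
      finally have "cmod (emb z (b ^ m * \<epsilon>)) > 1" using big w by simp
      thus "place_norm K u (b ^ m * \<epsilon>) > 1" using b eK by (simp add: z(2) absv_def K_subring)
    qed
  qed
qed

end

section \<open>Roots modulo torsion\<close>

lemma algebraic_inverse:
  assumes "algebraic (x :: complex)"
  shows "algebraic (inverse x)"
  using algebraic_simple_ext[OF assms simple_ext_inverse[OF assms self_in_simple_ext]] .

lemma algebraic_nth_root:
  assumes "algebraic (x ^ n)" "n > 0"
  shows "algebraic (x :: complex)"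
proof -
  obtain p where p: "p \<noteq> 0" "rpoly p (x ^ n) = 0" using assms(1) by (auto simp: algebraic_iff_rpoly)
  have "rpoly (pcompose p (monom 1 n)) x = 0" using p(2) by (simp add: rpoly_pcompose rpoly_monom)
  moreover have "pcompose p (monom 1 n) \<noteq> 0"
    using p(1) assms(2) by (simp add: pcompose_eq_0_iff degree_monom_eq)
  ultimately show ?thesis by (auto simp: algebraic_iff_rpoly)
qed

lemma Qbar_units_simps:
  "carrier Qbar_units = {x. algebraic x \<and> x \<noteq> 0}"
  "x \<otimes>\<^bsub>Qbar_units\<^esub> y = x * y" "\<one>\<^bsub>Qbar_units\<^esub> = 1"
  by (auto simp: Qbar_units_def complex_ring_simps)

lemma comm_group_Qbar_units: "comm_group Qbar_units"
proof (rule comm_groupI)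
  fix x assume "x \<in> carrier Qbar_units"
  thus "\<exists>y\<in>carrier Qbar_units. y \<otimes>\<^bsub>Qbar_units\<^esub> x = \<one>\<^bsub>Qbar_units\<^esub>"
    by (intro bexI[of _ "inverse x"]) (auto simp: Qbar_units_simps algebraic_inverse)
qed (auto simp: Qbar_units_simps algebraic_mult)

interpretation Q: comm_group Qbar_units by (rule comm_group_Qbar_units)

lemma Qbar_pow: "x [^]\<^bsub>Qbar_units\<^esub> (n::nat) = x ^ n"
  by (induction n) (simp_all add: Qbar_units_simps)

lemma Qbar_inv: "x \<in> carrier Qbar_units \<Longrightarrow> inv\<^bsub>Qbar_units\<^esub> x = inverse x"
  by (rule Q.inv_equality) (auto simp: Qbar_units_simps algebraic_inverse)

lemma Qbar_int_pow:
  assumes "x \<in> carrier Qbar_units"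
  shows "x [^]\<^bsub>Qbar_units\<^esub> (k::int) = x powi k"
proof (cases "k \<ge> 0")
  case True
  then obtain n where "k = int n" by (metis nonneg_int_cases)
  thus ?thesis by (simp add: int_pow_int Qbar_pow)
next
  case False
  then obtain n where n: "k = - int n" by (metis int_cases2 int_nat_eq nat_0_le neg_le_0_iff_le of_nat_0_le_iff order_refl)
  have "x [^]\<^bsub>Qbar_units\<^esub> k = inv\<^bsub>Qbar_units\<^esub> (x [^]\<^bsub>Qbar_units\<^esub> n)"
    unfolding n using Q.int_pow_neg_int[OF assms] .
  also have "\<dots> = inverse (x ^ n)"
    using Qbar_inv[OF Q.nat_pow_closed[OF assms, of n]] by (simp add: Qbar_pow)
  finally show ?thesis by (simp add: n power_int_minus)
qed

lemma Tor_iff: "x \<in> Tor \<longleftrightarrow> algebraic x \<and> x \<noteq> 0 \<and> (\<exists>n>0. x ^ n = 1)"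
  by (auto simp: Tor_def Qbar_pow Qbar_units_simps)

lemma subgroup_Tor: "subgroup Tor Qbar_units"
proof (rule Q.subgroupI)
  show "Tor \<subseteq> carrier Qbar_units" by (auto simp: Tor_def)
  show "Tor \<noteq> {}" using Tor_iff[of 1] by auto
  fix x assume x: "x \<in> Tor"
  hence "x \<in> carrier Qbar_units" by (auto simp: Tor_def)
  thus "inv\<^bsub>Qbar_units\<^esub> x \<in> Tor" using x
    by (auto simp: Qbar_inv Tor_iff algebraic_inverse power_inverse)
  fix y assume y: "y \<in> Tor"
  obtain n m where nm: "n > 0" "m > 0" "x ^ n = 1" "y ^ m = 1" using x y by (auto simp: Tor_iff)
  have "(x * y) ^ (n * m) = (x ^ n) ^ m * (y ^ m) ^ n"
    by (simp add: power_mult_distrib power_mult[symmetric] mult.commute)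
  hence "(x * y) ^ (n * m) = 1" using nm by simp
  thus "x \<otimes>\<^bsub>Qbar_units\<^esub> y \<in> Tor" using x y nm
    by (auto simp: Qbar_units_simps Tor_iff algebraic_mult intro!: exI[of _ "n * m"])
qed

lemma normal_Tor: "Tor \<lhd> Qbar_units"
  by (rule Q.normal_iff_subgroup[THEN iffD2, OF subgroup_Tor])

lemma comm_group_GG: "comm_group GG"
  unfolding GG_def by (rule Q.abelian_FactGroup[OF subgroup_Tor])

interpretation G: comm_group GG by (rule comm_group_GG)

lemma group_hom_cls: "group_hom Qbar_units GG cls"
proof -
  have "cls \<in> hom Qbar_units GG"
    using normal.r_coset_hom_Mod[OF normal_Tor] by (simp add: GG_def cls_def[abs_def])
  thus ?thesis by (simp add: group_hom_def group_hom_axioms_def)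
qed

interpretation cls: group_hom Qbar_units GG cls by (rule group_hom_cls)

lemma carrier_GG: "carrier GG = cls ` carrier Qbar_units"
  by (auto simp: GG_def FactGroup_def RCOSETS_def cls_def)

lemma cls_eq_iff:
  assumes "x \<in> carrier Qbar_units" "y \<in> carrier Qbar_units"
  shows "cls x = cls y \<longleftrightarrow> (\<exists>n>0. x ^ n = y ^ n)"
proof -
  have "cls x = cls y \<longleftrightarrow> x \<otimes>\<^bsub>Qbar_units\<^esub> inv\<^bsub>Qbar_units\<^esub> y \<in> Tor"
  proof -
    have "cls x = cls y \<longleftrightarrow> x \<in> Tor #>\<^bsub>Qbar_units\<^esub> y"
      unfolding cls_def using Q.repr_independence[OF _ assms(2) subgroup_Tor] Q.rcos_self[OF assms(1) subgroup_Tor]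
      by metis
    also have "\<dots> \<longleftrightarrow> x * inverse y \<in> Tor"
    proof
      assume "x \<in> Tor #>\<^bsub>Qbar_units\<^esub> y"
      then obtain h where "h \<in> Tor" "x = h * y" by (auto simp: r_coset_def Qbar_units_simps)
      moreover have "y \<noteq> 0" using assms(2) by (simp add: Qbar_units_simps)
      ultimately show "x * inverse y \<in> Tor" by (simp add: mult.assoc)
    next
      assume *: "x * inverse y \<in> Tor"
      have "y \<noteq> 0" using assms(2) by (simp add: Qbar_units_simps)
      hence "x = (x * inverse y) * y" by (simp add: mult.assoc)
      thus "x \<in> Tor #>\<^bsub>Qbar_units\<^esub> y" using * unfolding r_coset_def Qbar_units_simps by blast
    qed
    finally show ?thesis using assms by (simp add: Qbar_inv Qbar_units_simps(2))
  qed
  also have "\<dots> \<longleftrightarrow> (\<exists>n>0. (x / y) ^ n = 1)"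
    using assms by (auto simp: Qbar_inv Tor_iff Qbar_units_simps algebraic_mult algebraic_inverse divide_inverse)
  also have "\<dots> \<longleftrightarrow> (\<exists>n>0. x ^ n = y ^ n)"
    using assms by (auto simp: power_divide Qbar_units_simps)
  finally show ?thesis .
qed

text \<open>The group is torsion-free: equality of n-th powers modulo torsion means that some higher
  powers of the representatives agree, which is equality of the classes.\<close>

lemma GG_pow_cancel:
  assumes "\<gamma> \<in> carrier GG" "\<delta> \<in> carrier GG" "n > 0" "\<gamma> [^]\<^bsub>GG\<^esub> (n::nat) = \<delta> [^]\<^bsub>GG\<^esub> n"
  shows "\<gamma> = \<delta>"
proof -
  obtain x y where xy: "x \<in> carrier Qbar_units" "\<gamma> = cls x" "y \<in> carrier Qbar_units" "\<delta> = cls y"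
    using assms(1,2) by (auto simp: carrier_GG)
  have "cls (x ^ n) = cls (y ^ n)"
    using assms(4) xy cls.hom_nat_pow by (simp add: Qbar_pow[symmetric])
  hence "\<exists>m>0. (x ^ n) ^ m = (y ^ n) ^ m"
    using cls_eq_iff[of "x ^ n" "y ^ n"] Q.nat_pow_closed[OF xy(1), of n] Q.nat_pow_closed[OF xy(3), of n]
    by (simp add: Qbar_pow)
  then obtain m where "m > 0" "(x ^ n) ^ m = (y ^ n) ^ m" by blast
  hence "\<exists>m>0. x ^ m = y ^ m" using assms(3)
    by (intro exI[of _ "n * m"]) (simp add: power_mult)
  thus ?thesis using cls_eq_iff[OF xy(1,3)] xy by simp
qed

text \<open>The group is divisible, because complex roots of algebraic numbers exist and are
  algebraic.\<close>

lemma GG_root_exists: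
  assumes "\<gamma> \<in> carrier GG" "n > 0"
  obtains \<delta> where "\<delta> \<in> carrier GG" "\<delta> [^]\<^bsub>GG\<^esub> (n::nat) = \<gamma>"
proof -
  obtain x where x: "algebraic x" "x \<noteq> 0" "\<gamma> = cls x" using assms(1) by (auto simp: carrier_GG Qbar_units_simps)
  have "\<exists>y. poly (monom 1 n - [:x:]) y = 0"
  proof (rule fundamental_theorem_of_algebra_alt, rule notI)
    assume "\<exists>a l. a \<noteq> 0 \<and> l = 0 \<and> monom 1 n - [:x:] = pCons a l"
    then obtain a where a: "monom 1 n - [:x:] = [:a:]" by auto
    hence "coeff (monom 1 n - [:x:]) n = coeff [:a:] n" by simp
    thus False using assms(2) by (simp add: coeff_pCons split: nat.splits)
  qed
  then obtain y where y: "y ^ n = x" by (auto simp: poly_monom)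
  have "y \<noteq> 0" using y x assms(2) by auto
  hence yc: "y \<in> carrier Qbar_units" using algebraic_nth_root[of y n] x y assms(2) by (simp add: Qbar_units_simps)
  have "cls y [^]\<^bsub>GG\<^esub> n = \<gamma>" using cls.hom_nat_pow[OF yc, of n] y x by (simp add: Qbar_pow)
  thus ?thesis by (rule that[OF cls.hom_closed[OF yc]])
qed

text \<open>The description in \<open>rat_pow\<close> is proper: divisibility gives existence and
  torsion-freeness gives uniqueness.\<close>

lemma rat_pow:
  assumes "\<beta> \<in> carrier GG"
  shows "rat_pow \<beta> r \<in> carrier GG"
    "rat_pow \<beta> r [^]\<^bsub>GG\<^esub> nat (snd (quotient_of r)) = \<beta> [^]\<^bsub>GG\<^esub> fst (quotient_of r)"
proof -
  define n where "n = nat (snd (quotient_of r))"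
  have n: "n > 0" "snd (quotient_of r) = int n" using quotient_of_denom_pos'[of r] by (simp_all add: n_def)
  obtain \<delta> where d: "\<delta> \<in> carrier GG" "\<delta> [^]\<^bsub>GG\<^esub> n = \<beta> [^]\<^bsub>GG\<^esub> fst (quotient_of r)"
    using GG_root_exists[OF G.int_pow_closed[OF assms] n(1)] .
  have "rat_pow \<beta> r = \<delta>" unfolding rat_pow_def n(2) int_pow_int
  proof (rule the_equality)
    fix \<gamma> assume "\<gamma> \<in> carrier GG \<and> \<gamma> [^]\<^bsub>GG\<^esub> n = \<beta> [^]\<^bsub>GG\<^esub> fst (quotient_of r)"
    thus "\<gamma> = \<delta>" using d(2) by (intro GG_pow_cancel[OF _ d(1) n(1)]) simp_all
  qed (use d in simp)
  thus "rat_pow \<beta> r \<in> carrier GG" "rat_pow \<beta> r [^]\<^bsub>GG\<^esub> n = \<beta> [^]\<^bsub>GG\<^esub> fst (quotient_of r)"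
    using d by simp_all
qed

lemma rat_pow_eqI:
  assumes "\<beta> \<in> carrier GG" "\<gamma> \<in> carrier GG" "n > 0" "\<gamma> [^]\<^bsub>GG\<^esub> (n::nat) = \<beta>"
  shows "rat_pow \<beta> (1 / of_nat n) = \<gamma>"
proof -
  define r where "r = (1 / of_nat n :: rat)"
  define a b where "a = fst (quotient_of r)" and "b = nat (snd (quotient_of r))"
  have b: "b > 0" "snd (quotient_of r) = int b" using quotient_of_denom_pos'[of r] by (simp_all add: b_def)
  have "r = of_int a / of_int (snd (quotient_of r))" unfolding a_def by (rule quotient_of_div) simp
  hence "(of_int (a * int n) :: rat) = of_int (int b)" using b assms(3) by (simp add: r_def field_simps)
  hence an: "a * int n = int b" by (simp only: of_int_eq_iff)
  hence "a * int n > 0" using b by simp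
  hence "a > 0" using assms(3) by (simp add: zero_less_mult_iff)
  then obtain m where m: "a = int m" "m > 0" by (metis zero_less_imp_eq_int)
  have bm: "b = n * m" using an m by (metis mult.commute of_nat_eq_iff of_nat_mult)
  note rp = rat_pow[OF assms(1), of r, folded a_def b_def]
  have "(rat_pow \<beta> r [^]\<^bsub>GG\<^esub> n) [^]\<^bsub>GG\<^esub> m = \<beta> [^]\<^bsub>GG\<^esub> m"
    using rp by (simp add: G.nat_pow_pow bm m int_pow_int)
  hence "rat_pow \<beta> r [^]\<^bsub>GG\<^esub> n = \<beta>"
    using GG_pow_cancel[OF G.nat_pow_closed[OF rp(1)] assms(1) m(2)] by blast
  thus ?thesis unfolding r_def[symmetric]
    using GG_pow_cancel[OF rp(1) assms(2,3)] assms(4) by simp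
qed

text \<open>For a multiplicative group \<open>A\<close> this is the rational span of its classes: a
  common denominator turns a combination into an n-th root of one class. Both \<open>VV\<close> and
  \<open>unit_span\<close> are handled in this form.\<close>

definition root_span :: "complex set \<Rightarrow> complex set set" where
  "root_span A = {\<gamma> \<in> carrier GG. \<exists>n>0. \<exists>x\<in>A. \<gamma> [^]\<^bsub>GG\<^esub> (n::nat) = cls x}"

lemma root_spanI:
  "\<gamma> \<in> carrier GG \<Longrightarrow> n > 0 \<Longrightarrow> x \<in> A \<Longrightarrow> \<gamma> [^]\<^bsub>GG\<^esub> (n::nat) = cls x \<Longrightarrow> \<gamma> \<in> root_span A"
  unfolding root_span_def by blast

lemma cls_power: "x \<in> carrier Qbar_units \<Longrightarrow> cls x [^]\<^bsub>GG\<^esub> (n::nat) = cls (x ^ n)"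
  using cls.hom_nat_pow[of x n] by (simp add: Qbar_pow)

lemma cls_powi: "x \<in> carrier Qbar_units \<Longrightarrow> cls x [^]\<^bsub>GG\<^esub> (k::int) = cls (x powi k)"
  using cls.hom_int_pow[of x k] by (simp add: Qbar_int_pow)

lemma cls_mult: "x \<in> carrier Qbar_units \<Longrightarrow> y \<in> carrier Qbar_units \<Longrightarrow> cls x \<otimes>\<^bsub>GG\<^esub> cls y = cls (x * y)"
  using cls.hom_mult[of x y] by (simp add: Qbar_units_simps)

lemma cls_inverse: "x \<in> carrier Qbar_units \<Longrightarrow> inv\<^bsub>GG\<^esub> cls x = cls (inverse x)"
  using cls.hom_inv[of x] by (simp add: Qbar_inv)

locale mult_subgroup =
  fixes A :: "complex set"
  assumes A_units: "x \<in> A \<Longrightarrow> x \<in> carrier Qbar_units"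
    and A_one: "1 \<in> A"
    and A_mult: "x \<in> A \<Longrightarrow> y \<in> A \<Longrightarrow> x * y \<in> A"
    and A_inverse: "x \<in> A \<Longrightarrow> inverse x \<in> A"
begin

lemma A_power: "x \<in> A \<Longrightarrow> x ^ n \<in> A"
  by (induction n) (auto intro: A_one A_mult)

lemma A_powi: "x \<in> A \<Longrightarrow> x powi k \<in> A"
  by (auto simp: power_int_def intro: A_power A_inverse)

lemma root_span_rat_pow:
  assumes "\<gamma> \<in> root_span A"
  shows "rat_pow \<gamma> r \<in> root_span A"
proof -
  obtain n x where g: "\<gamma> \<in> carrier GG" "n > 0" "x \<in> A" "\<gamma> [^]\<^bsub>GG\<^esub> (n::nat) = cls x"
    using assms by (auto simp: root_span_def)
  define a b where "a = fst (quotient_of r)" and "b = nat (snd (quotient_of r))"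
  have b: "b > 0" using quotient_of_denom_pos'[of r] by (simp add: b_def)
  note rp = rat_pow[OF g(1), of r, folded a_def b_def]
  have "rat_pow \<gamma> r [^]\<^bsub>GG\<^esub> (b * n) = (\<gamma> [^]\<^bsub>GG\<^esub> a) [^]\<^bsub>GG\<^esub> int n"
    using rp by (simp add: G.nat_pow_pow[symmetric] int_pow_int)
  also have "\<dots> = (\<gamma> [^]\<^bsub>GG\<^esub> int n) [^]\<^bsub>GG\<^esub> a"
    using g(1) by (simp add: G.int_pow_pow mult.commute)
  also have "\<dots> = cls (x powi a)" using g A_units by (simp add: int_pow_int cls_powi)
  finally show ?thesis using rp(1) b g A_powi[OF g(3)] by (auto simp: root_span_def intro!: exI[of _ "b * n"])
qed

lemma root_span_mult:
  assumes "\<gamma> \<in> root_span A" "\<delta> \<in> root_span A"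
  shows "\<gamma> \<otimes>\<^bsub>GG\<^esub> \<delta> \<in> root_span A"
proof -
  obtain n x where g: "\<gamma> \<in> carrier GG" "n > 0" "x \<in> A" "\<gamma> [^]\<^bsub>GG\<^esub> (n::nat) = cls x"
    using assms by (auto simp: root_span_def)
  obtain m y where d: "\<delta> \<in> carrier GG" "m > 0" "y \<in> A" "\<delta> [^]\<^bsub>GG\<^esub> (m::nat) = cls y"
    using assms by (auto simp: root_span_def)
  have "(\<gamma> \<otimes>\<^bsub>GG\<^esub> \<delta>) [^]\<^bsub>GG\<^esub> (n * m) = (\<gamma> [^]\<^bsub>GG\<^esub> n) [^]\<^bsub>GG\<^esub> m \<otimes>\<^bsub>GG\<^esub> (\<delta> [^]\<^bsub>GG\<^esub> m) [^]\<^bsub>GG\<^esub> n"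
    using G.nat_pow_distrib[OF g(1) d(1), of "n * m"] G.nat_pow_pow[OF g(1), of n m] G.nat_pow_pow[OF d(1), of m n]
    by (simp only: mult.commute[of m n])
  also have "\<dots> = cls (x ^ m * y ^ n)"
    using g d A_units A_power by (simp add: cls_power cls_mult)
  finally show ?thesis using g d A_power A_mult
    by (auto simp: root_span_def intro!: exI[of _ "n * m"])
qed

lemma root_span_inv:
  assumes "\<gamma> \<in> root_span A"
  shows "inv\<^bsub>GG\<^esub> \<gamma> \<in> root_span A"
proof -
  obtain n x where g: "\<gamma> \<in> carrier GG" "n > 0" "x \<in> A" "\<gamma> [^]\<^bsub>GG\<^esub> (n::nat) = cls x"
    using assms by (auto simp: root_span_def)
  have "(inv\<^bsub>GG\<^esub> \<gamma>) [^]\<^bsub>GG\<^esub> n = cls (inverse x)"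
    using g A_units by (simp add: G.nat_pow_inv cls_inverse)
  thus ?thesis using g A_inverse by (intro root_spanI[OF G.inv_closed, of \<gamma> n "inverse x"]) auto
qed

lemma rat_subspace_root_span: "rat_subspace (root_span A)"
  unfolding rat_subspace_def
proof (intro conjI ballI allI root_span_rat_pow)
  have "\<one>\<^bsub>GG\<^esub> \<in> root_span A"
    using cls.hom_one by (intro root_spanI[of _ 1 1]) (simp_all add: A_one Qbar_units_simps)
  thus "subgroup (root_span A) GG"
  proof (intro G.subgroupI root_span_mult root_span_inv)
    show "root_span A \<subseteq> carrier GG" by (auto simp: root_span_def)
  qed blast+
qed

lemma rat_span_cls: "rat_span (cls ` A) = root_span A"
proof
  have "cls ` A \<subseteq> root_span A"
    using A_units by (auto intro!: root_spanI[of _ 1])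
  thus "rat_span (cls ` A) \<subseteq> root_span A"
    unfolding rat_span_def by (intro hull_minimal rat_subspace_root_span)
  show "root_span A \<subseteq> rat_span (cls ` A)"
  proof
    fix \<gamma> assume "\<gamma> \<in> root_span A"
    then obtain n x where g: "\<gamma> \<in> carrier GG" "n > 0" "x \<in> A" "\<gamma> [^]\<^bsub>GG\<^esub> (n::nat) = cls x"
      by (auto simp: root_span_def)
    have eq: "rat_pow (cls x) (1 / of_nat n) = \<gamma>" using g A_units by (intro rat_pow_eqI) auto
    have "\<gamma> \<in> T" if "rat_subspace T" "cls ` A \<subseteq> T" for T
      using that g(3) eq by (auto simp: rat_subspace_def)
    thus "\<gamma> \<in> rat_span (cls ` A)" by (auto simp: rat_span_def hull_def)
  qed
qed

end

section \<open>The rational spaces of the field and of its units\<close>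

context alg_field
begin

lemma mult_subgroup_K: "mult_subgroup (K - {0})"
  by unfold_locales (auto simp: Qbar_units_simps algebraic_K mult_K inverse_K one_K)

lemma mult_subgroup_units: "mult_subgroup (integer_units K)"
  by unfold_locales
     (auto simp: Qbar_units_simps algebraic_K mult_K inverse_K one_K integer_units_def algebraic_int_mult)

lemma unit_span_eq: "unit_span K = root_span (integer_units K)"
  unfolding unit_span_def by (rule mult_subgroup.rat_span_cls[OF mult_subgroup_units])

lemma VV_eq: "VV K = root_span (K - {0})"
proof
  interpret mult_subgroup "K - {0}" by (rule mult_subgroup_K)
  show "VV K \<subseteq> root_span (K - {0})"
  proof
    fix \<gamma> assume "\<gamma> \<in> VV K"
    then obtain b r where b: "\<gamma> = rat_pow (cls b) r" "b \<in> K - {0}" by (auto simp: VV_def)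
    have "cls b \<in> root_span (K - {0})" using A_units[OF b(2)] b(2)
      by (intro root_spanI[of _ 1 b]) auto
    thus "\<gamma> \<in> root_span (K - {0})" unfolding b(1) by (rule root_span_rat_pow)
  qed
  show "root_span (K - {0}) \<subseteq> VV K"
  proof
    fix \<gamma> assume "\<gamma> \<in> root_span (K - {0})"
    then obtain n x where g: "\<gamma> \<in> carrier GG" "n > 0" "x \<in> K - {0}" "\<gamma> [^]\<^bsub>GG\<^esub> (n::nat) = cls x"
      by (auto simp: root_span_def)
    have "rat_pow (cls x) (1 / of_nat n) = \<gamma>" using g A_units by (intro rat_pow_eqI) auto
    thus "\<gamma> \<in> VV K" using g by (auto simp: VV_def)
  qed
qed

text \<open>Well-definedness: two representations give powers of b and x that agree modulo torsion,
  so further powers agree in \<open>K\<close>. Their absolute values are positive reals, where roots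
  are unique.\<close>

lemma V_norm_eq:
  assumes u: "u \<in> places K" and g: "\<gamma> \<in> carrier GG" "n > 0" "x \<in> K" "x \<noteq> 0" "\<gamma> [^]\<^bsub>GG\<^esub> (n::nat) = cls x"
  shows "V_norm K u \<gamma> = place_norm K u x powr (1 / real n)"
  unfolding V_norm_def
proof (rule the_equality)
  interpret F: abs_val K "place_norm K u" by (rule abs_valI[OF place_norm(3)[OF u]])
  define f where "f = place_norm K u"
  have xu: "x \<in> carrier Qbar_units" using g by (simp add: Qbar_units_simps algebraic_K)
  have "rat_pow (cls x) (1 / of_nat n) = \<gamma>" using g xu by (intro rat_pow_eqI) auto
  moreover have "of_rat (1 / of_nat n) = 1 / real n" by (simp add: of_rat_divide)
  ultimately show "\<exists>b r. b \<in> K \<and> b \<noteq> 0 \<and> \<gamma> = rat_pow (cls b) r \<and>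
      place_norm K u x powr (1 / real n) = place_norm K u b powr of_rat r"
    using g by (intro exI[of _ x] exI[of _ "1 / of_nat n"]) simp
  fix t assume "\<exists>b r. b \<in> K \<and> b \<noteq> 0 \<and> \<gamma> = rat_pow (cls b) r \<and> t = place_norm K u b powr of_rat r"
  then obtain b r where b: "b \<in> K" "b \<noteq> 0" "\<gamma> = rat_pow (cls b) r" "t = f b powr of_rat r"
    by (auto simp: f_def)
  define k m where "k = fst (quotient_of r)" and "m = nat (snd (quotient_of r))"
  have m: "m > 0" "snd (quotient_of r) = int m" using quotient_of_denom_pos'[of r] by (simp_all add: m_def)
  have r: "of_rat r = real_of_int k / real m"
  proof -
    have "r = of_int k / of_int (snd (quotient_of r))" unfolding k_def by (rule quotient_of_div) simp
    thus ?thesis by (simp add: m of_rat_divide)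
  qed
  have bu: "b \<in> carrier Qbar_units" using b by (simp add: Qbar_units_simps algebraic_K)
  have bk: "b powi k \<in> carrier Qbar_units" "(b powi k) \<in> K" "b powi k \<noteq> 0"
    using b powi_K[OF b(1), of k] by (auto simp: Qbar_units_simps algebraic_K)
  have "\<gamma> [^]\<^bsub>GG\<^esub> m = cls (b powi k)"
    using rat_pow(2)[of "cls b" r] bu by (simp add: b(3) k_def m_def cls_powi)
  hence "cls ((b powi k) ^ n) = (\<gamma> [^]\<^bsub>GG\<^esub> m) [^]\<^bsub>GG\<^esub> n" using bk by (simp add: cls_power)
  also have "\<dots> = (\<gamma> [^]\<^bsub>GG\<^esub> n) [^]\<^bsub>GG\<^esub> m" using g(1) by (simp add: G.nat_pow_pow mult.commute)
  also have "\<dots> = cls (x ^ m)" using g xu by (simp add: cls_power)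
  finally obtain l where l: "l > 0" "((b powi k) ^ n) ^ l = (x ^ m) ^ l"
    using cls_eq_iff[of "(b powi k) ^ n" "x ^ m"] bk xu Q.nat_pow_closed[OF bk(1), of n] Q.nat_pow_closed[OF xu, of m]
    by (auto simp: Qbar_pow)
  have fp: "f b > 0" "f x > 0" unfolding f_def using F.f_pos b g by auto
  have fpowi: "f (b powi k) = f b powr of_int k"
  proof -
    have "f (b powi k) = f b powi k"
      unfolding f_def using b by (auto simp: power_int_def F.f_power F.f_inverse inverse_K)
    thus ?thesis using fp by (simp add: powr_real_of_int')
  qed
  have "f (((b powi k) ^ n) ^ l) = f ((x ^ m) ^ l)" using l by simp
  hence "((f b powr of_int k) ^ n) ^ l = (f x ^ m) ^ l"
    unfolding f_def using bk g by (simp add: F.f_power K_subring fpowi[unfolded f_def])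
  hence "(f b powr of_int k) ^ n = f x ^ m" using l(1) fp
    by (subst (asm) power_eq_iff_eq_base) auto
  hence "ln ((f b powr of_int k) ^ n) = ln (f x ^ m)" by simp
  hence "real n * (of_int k * ln (f b)) = real m * ln (f x)"
    using fp by (simp add: ln_realpow ln_powr)
  hence "ln (f x) / real n = of_rat r * ln (f b)" using g(2) m(1) by (simp add: r field_simps)
  thus "t = place_norm K u x powr (1 / real n)"
    using fp by (simp add: b(4) powr_def f_def)
qed

end

section \<open>The minimum over the units\<close>

lemma sum_abs_same_sign:
  fixes g :: "'a \<Rightarrow> real"
  assumes "(\<forall>x\<in>A. g x \<ge> 0) \<or> (\<forall>x\<in>A. g x \<le> 0)"
  shows "(\<Sum>x\<in>A. \<bar>g x\<bar>) = \<bar>\<Sum>x\<in>A. g x\<bar>"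
  using assms
proof
  assume "\<forall>x\<in>A. g x \<ge> 0"
  thus ?thesis by (simp add: sum_nonneg)
next
  assume *: "\<forall>x\<in>A. g x \<le> 0"
  hence "(\<Sum>x\<in>A. \<bar>g x\<bar>) = - (\<Sum>x\<in>A. g x)" by (simp add: sum_negf[symmetric])
  thus ?thesis using * by (simp add: sum_nonpos)
qed

context prim_field
begin

lemma V_norm_pos_ln:
  assumes "u \<in> places K" "\<gamma> \<in> carrier GG" "n > 0" "x \<in> K" "x \<noteq> 0" "\<gamma> [^]\<^bsub>GG\<^esub> (n::nat) = cls x"
  shows "V_norm K u \<gamma> > 0" "ln (V_norm K u \<gamma>) = ln (place_norm K u x) / real n"
proof -
  interpret F: abs_val K "place_norm K u" by (rule abs_valI[OF place_norm(3)[OF assms(1)]])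
  have "place_norm K u x > 0" using F.f_pos assms by blast
  thus "V_norm K u \<gamma> > 0" "ln (V_norm K u \<gamma>) = ln (place_norm K u x) / real n"
    unfolding V_norm_eq[OF assms] by (simp_all add: ln_powr)
qed

lemma finite_place_unit:
  assumes "u \<in> finite_places K" "x \<in> integer_units K"
  shows "place_norm K u x = 1"
proof -
  interpret F: abs_val K "place_norm K u" by (rule finite_place_ultrametric(1)[OF assms(1)])
  note um = F.ultrametric_algebraic_int[OF finite_place_ultrametric(2)[OF assms(1)]]
  have x: "x \<in> K" "x \<noteq> 0" "algebraic_int x" "algebraic_int (inverse x)"
    using assms(2) by (auto simp: integer_units_def)
  have "place_norm K u x \<le> 1" "inverse (place_norm K u x) \<le> 1"
    using um[OF x(1,3)] um[OF inverse_K[OF x(1)] x(4)] F.f_inverse[OF x(1)] by simp_all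
  moreover have "place_norm K u x > 0" using F.f_pos x by blast
  ultimately show ?thesis by (simp add: field_simps)
qed

lemma unit_span_places:
  assumes "\<gamma> \<in> unit_span K"
  shows "\<gamma> \<in> carrier GG" "\<gamma> \<in> VV K"
    "\<And>u. u \<in> finite_places K \<Longrightarrow> ln (V_norm K u \<gamma>) = 0"
    "(\<Sum>u\<in>infinite_places K. real (local_degree K u) * ln (V_norm K u \<gamma>)) = 0"
proof -
  obtain m x where g: "\<gamma> \<in> carrier GG" "m > 0" "x \<in> integer_units K" "\<gamma> [^]\<^bsub>GG\<^esub> (m::nat) = cls x"
    using assms by (auto simp: unit_span_eq root_span_def)
  have x: "x \<in> K" "x \<noteq> 0" using g(3) by (auto simp: integer_units_def)
  have ln: "ln (V_norm K u \<gamma>) = ln (place_norm K u x) / real m" if "u \<in> places K" for u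
    using V_norm_pos_ln(2)[OF that g(1,2) x g(4)] .
  show "\<gamma> \<in> carrier GG" by fact
  show "\<gamma> \<in> VV K" unfolding VV_eq using g x by (intro root_spanI[of _ m x]) auto
  show "ln (V_norm K u \<gamma>) = 0" if "u \<in> finite_places K" for u
  proof -
    have "u \<in> places K" using that places_eq by blast
    thus ?thesis using ln finite_place_unit[OF that g(3)] by simp
  qed
  have "(\<Sum>u\<in>infinite_places K. real (local_degree K u) * ln (V_norm K u \<gamma>)) =
      (\<Sum>u\<in>infinite_places K. real (local_degree K u) * ln (place_norm K u x) / real m)"
    using ln places_eq by (intro sum.cong) auto
  thus "(\<Sum>u\<in>infinite_places K. real (local_degree K u) * ln (V_norm K u \<gamma>)) = 0"
    by (simp only: sum_divide_distrib[symmetric] sum_log_infinite_unit[OF g(3)] div_0)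
qed

text \<open>If \<gamma>^n and \<delta>^m are the classes of x and y, then the power n m of the
  quotient is the class of x^m / y^n.\<close>

lemma ln_V_norm_divide:
  assumes "\<gamma> \<in> VV K" "\<delta> \<in> VV K" "u \<in> places K"
  shows "ln (V_norm K u (\<gamma> \<otimes>\<^bsub>GG\<^esub> inv\<^bsub>GG\<^esub> \<delta>)) = ln (V_norm K u \<gamma>) - ln (V_norm K u \<delta>)"
proof -
  interpret G: comm_group GG by (rule comm_group_GG)
  interpret F: abs_val K "place_norm K u" by (rule abs_valI[OF place_norm(3)[OF assms(3)]])
  obtain n x where g: "\<gamma> \<in> carrier GG" "n > 0" "x \<in> K" "x \<noteq> 0" "\<gamma> [^]\<^bsub>GG\<^esub> (n::nat) = cls x"
    using assms(1) by (auto simp: VV_eq root_span_def)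
  obtain m y where d: "\<delta> \<in> carrier GG" "m > 0" "y \<in> K" "y \<noteq> 0" "\<delta> [^]\<^bsub>GG\<^esub> (m::nat) = cls y"
    using assms(2) by (auto simp: VV_eq root_span_def)
  have xy: "x \<in> carrier Qbar_units" "y \<in> carrier Qbar_units"
    using g d by (simp_all add: Qbar_units_simps algebraic_K)
  have xy': "x ^ m \<in> carrier Qbar_units" "inverse (y ^ n) \<in> carrier Qbar_units" "y ^ n \<in> carrier Qbar_units"
    using g d by (simp_all add: Qbar_units_simps algebraic_K K_subring inverse_K)
  have "(\<gamma> \<otimes>\<^bsub>GG\<^esub> inv\<^bsub>GG\<^esub> \<delta>) [^]\<^bsub>GG\<^esub> (n * m) = \<gamma> [^]\<^bsub>GG\<^esub> (n * m) \<otimes>\<^bsub>GG\<^esub> inv\<^bsub>GG\<^esub> (\<delta> [^]\<^bsub>GG\<^esub> (n * m))"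
    using G.nat_pow_distrib[OF g(1) G.inv_closed[OF d(1)]] G.nat_pow_inv[OF d(1)] by simp
  also have "\<gamma> [^]\<^bsub>GG\<^esub> (n * m) = cls (x ^ m)"
    using G.nat_pow_pow[OF g(1), of n m] g(5) cls_power[OF xy(1)] by simp
  also have "\<delta> [^]\<^bsub>GG\<^esub> (n * m) = cls (y ^ n)"
    using G.nat_pow_pow[OF d(1), of m n] d(5) cls_power[OF xy(2)] by (simp add: mult.commute)
  also have "cls (x ^ m) \<otimes>\<^bsub>GG\<^esub> inv\<^bsub>GG\<^esub> cls (y ^ n) = cls (x ^ m * inverse (y ^ n))"
    using cls_inverse[OF xy'(3)] cls_mult[OF xy'(1,2)] by simp
  finally have pow: "(\<gamma> \<otimes>\<^bsub>GG\<^esub> inv\<^bsub>GG\<^esub> \<delta>) [^]\<^bsub>GG\<^esub> (n * m) = cls (x ^ m * inverse (y ^ n))" .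
  have car: "\<gamma> \<otimes>\<^bsub>GG\<^esub> inv\<^bsub>GG\<^esub> \<delta> \<in> carrier GG" using g d by simp
  have zK: "x ^ m * inverse (y ^ n) \<in> K" "x ^ m * inverse (y ^ n) \<noteq> 0"
    using g d by (simp_all add: K_subring inverse_K)
  have nm: "n * m > 0" using g d by simp
  have fpos: "place_norm K u x > 0" "place_norm K u y > 0" using F.f_pos g d by auto
  have "ln (V_norm K u (\<gamma> \<otimes>\<^bsub>GG\<^esub> inv\<^bsub>GG\<^esub> \<delta>)) = ln (place_norm K u (x ^ m * inverse (y ^ n))) / real (n * m)"
    by (rule V_norm_pos_ln(2)[OF assms(3) car nm zK pow])
  also have "place_norm K u (x ^ m * inverse (y ^ n)) = place_norm K u x ^ m * inverse (place_norm K u y ^ n)"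
    using g d by (simp add: F.f_mult F.f_power F.f_inverse K_subring inverse_K)
  also have "ln \<dots> = real m * ln (place_norm K u x) - real n * ln (place_norm K u y)"
    using fpos by (simp add: ln_mult ln_inverse ln_realpow)
  also have "\<dots> / real (n * m) = ln (place_norm K u x) / real n - ln (place_norm K u y) / real m"
    using g d by (simp add: field_simps)
  also have "\<dots> = ln (V_norm K u \<gamma>) - ln (V_norm K u \<delta>)"
    using V_norm_pos_ln(2)[OF assms(3) g] V_norm_pos_ln(2)[OF assms(3) d] by simp
  finally show ?thesis .
qed

text \<open>Every term outside \<open>v\<close> and the finitely many archimedean places vanishes,
  so the infinite sum is a finite one and summability is automatic.\<close>

lemma h1_eq:
  assumes v: "v \<in> finite_places K"
    and triv: "\<And>w. w \<in> finite_places K \<Longrightarrow> w \<noteq> v \<Longrightarrow> ln (V_norm K w \<gamma>) = 0"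
  shows "h1 K \<gamma> = 1 / real (field_degree K) * (\<bar>real (local_degree K v) * ln (V_norm K v \<gamma>)\<bar> +
      (\<Sum>w\<in>infinite_places K. \<bar>real (local_degree K w) * ln (V_norm K w \<gamma>)\<bar>))"
proof -
  define g where "g = (\<lambda>u. real (local_degree K u) / real (field_degree K) * \<bar>ln (V_norm K u \<gamma>)\<bar>)"
  have "v \<notin> infinite_places K" using v finite_infinite_disjoint by blast
  have "h1 K \<gamma> = infsum g (places K)" by (simp add: h1_def g_def)
  also have "\<dots> = infsum g (insert v (infinite_places K))"
  proof (rule infsum_cong_neutral)
    fix u assume "u \<in> places K - insert v (infinite_places K)"
    hence "u \<in> finite_places K" "u \<noteq> v" using places_eq by auto
    thus "g u = 0" using triv by (simp add: g_def)
  next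
    fix u assume "u \<in> insert v (infinite_places K) - places K"
    thus "g u = 0" using v places_eq by auto
  qed simp
  also have "\<dots> = g v + (\<Sum>u\<in>infinite_places K. g u)"
    using finite_infinite_places \<open>v \<notin> infinite_places K\<close> by simp
  also have "\<dots> = 1 / real (field_degree K) * (\<bar>real (local_degree K v) * ln (V_norm K v \<gamma>)\<bar> +
      (\<Sum>w\<in>infinite_places K. \<bar>real (local_degree K w) * ln (V_norm K w \<gamma>)\<bar>))"
    by (simp add: g_def abs_mult distrib_left sum_distrib_left)
  finally show ?thesis .
qed

text \<open>In the non-trivial cases a suitable power of \<open>\<alpha>\<close> or of its inverse is the class of an algebraic
  integer, which a unit moves into the region where all archimedean norms exceed one.\<close>
lemma unit_span_same_sign:
  assumes v: "v \<in> finite_places K" and \<alpha>: "\<alpha> \<in> VV K"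
    and triv: "\<And>w. w \<in> finite_places K \<Longrightarrow> w \<noteq> v \<Longrightarrow> V_norm K w \<alpha> = 1"
  obtains \<beta> where "\<beta> \<in> unit_span K"
    "(\<forall>w\<in>infinite_places K. ln (V_norm K w \<alpha>) - ln (V_norm K w \<beta>) \<ge> 0) \<or>
     (\<forall>w\<in>infinite_places K. ln (V_norm K w \<alpha>) - ln (V_norm K w \<beta>) \<le> 0)"
proof -
  obtain n a where a: "\<alpha> \<in> carrier GG" "n > 0" "a \<in> K" "a \<noteq> 0" "\<alpha> [^]\<^bsub>GG\<^esub> (n::nat) = cls a"
    using \<alpha> by (auto simp: VV_eq root_span_def)
  have pos: "place_norm K w x > 0" if "w \<in> places K" "x \<in> K" "x \<noteq> 0" for w x
    using abs_val.f_pos[OF abs_valI[OF place_norm(3)[OF that(1)]] that(2,3)] .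
  have inv: "place_norm K w (inverse x) = inverse (place_norm K w x)" if "w \<in> places K" "x \<in> K" for w x
    using abs_val.f_inverse[OF abs_valI[OF place_norm(3)[OF that(1)]] that(2)] .
  have mult: "ln (place_norm K w (x ^ m * y)) = real m * ln (place_norm K w x) + ln (place_norm K w y)"
    if "w \<in> places K" "x \<in> K" "x \<noteq> 0" "y \<in> K" "y \<noteq> 0" for w x y m
  proof -
    interpret F: abs_val K "place_norm K w" by (rule abs_valI[OF place_norm(3)[OF that(1)]])
    have "place_norm K w (x ^ m * y) = place_norm K w x ^ m * place_norm K w y"
      using that by (simp add: F.f_mult F.f_power K_subring)
    thus ?thesis using pos[OF that(1-3)] pos[OF that(1,4,5)] by (simp add: ln_mult ln_realpow)
  qed
  have fin: "w \<in> places K" if "w \<in> finite_places K" for w using that places_eq by blast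
  have infp: "w \<in> places K" if "w \<in> infinite_places K" for w using that places_eq by blast
  have a1: "place_norm K w a = 1" if w: "w \<in> finite_places K" "w \<noteq> v" for w
  proof -
    have "ln (place_norm K w a) / real n = 0"
      using V_norm_pos_ln(2)[OF fin[OF w(1)] a] triv[OF w] by simp
    thus ?thesis using a(2) pos[OF fin[OF w(1)] a(3,4)] by simp
  qed
  have int: "algebraic_int x" if "x \<in> K" "\<And>w. w \<in> finite_places K \<Longrightarrow> place_norm K w x \<le> 1" for x
    using algebraic_int_iff_finite_places[OF that(1)] that(2) by blast
  have nonint: "\<not> algebraic_int x" if "x \<in> K" "place_norm K v x > 1" for x
    using algebraic_int_iff_finite_places[OF that(1)] that(2) v by fastforce
  interpret G: comm_group GG by (rule comm_group_GG)
  have root: "\<exists>\<beta>\<in>unit_span K. \<forall>w\<in>places K. ln (V_norm K w \<beta>) = ln (place_norm K w \<epsilon>) / real m"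
    if m: "m > 0" and \<epsilon>: "\<epsilon> \<in> integer_units K" for m \<epsilon>
  proof -
    have e: "\<epsilon> \<in> K" "\<epsilon> \<noteq> 0" using \<epsilon> by (auto simp: integer_units_def)
    have "cls \<epsilon> \<in> carrier GG" using e by (auto simp: carrier_GG Qbar_units_simps algebraic_K)
    then obtain \<beta> where b: "\<beta> \<in> carrier GG" "\<beta> [^]\<^bsub>GG\<^esub> m = cls \<epsilon>" using GG_root_exists[OF _ m] by blast
    have "\<beta> \<in> unit_span K" unfolding unit_span_eq by (rule root_spanI[OF b(1) m \<epsilon> b(2)])
    moreover have "\<forall>w\<in>places K. ln (V_norm K w \<beta>) = ln (place_norm K w \<epsilon>) / real m"
      using V_norm_pos_ln(2)[OF _ b(1) m e b(2)] by blast
    ultimately show ?thesis by blast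
  qed
  have unit_inv: "inverse \<epsilon> \<in> integer_units K" if "\<epsilon> \<in> integer_units K" for \<epsilon>
    using that inverse_K by (auto simp: integer_units_def)
  consider "place_norm K v a = 1" | "place_norm K v a < 1" | "place_norm K v a > 1" by linarith
  thus ?thesis
  proof cases
    case 1
    have "place_norm K w a = 1" if "w \<in> finite_places K" for w using that 1 a1 by blast
    hence "algebraic_int a" "algebraic_int (inverse a)"
      using a(3) fin inv inverse_K by (auto intro!: int)
    hence "\<alpha> \<in> unit_span K" unfolding unit_span_eq using a
      by (intro root_spanI[of _ n a]) (auto simp: integer_units_def)
    thus ?thesis by (rule that) simp
  next
    case 2
    have "place_norm K w a \<le> 1" if "w \<in> finite_places K" for w using that 2 a1 by force
    hence "algebraic_int a" using a(3) int by blast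
    moreover have "\<not> algebraic_int (inverse a)"
      using 2 pos[OF fin[OF v] a(3,4)] inv[OF fin[OF v] a(3)] by (intro nonint inverse_K a) (simp add: one_less_inverse)
    ultimately obtain m \<epsilon> where m: "m > 0" "\<epsilon> \<in> integer_units K"
        "\<forall>u\<in>infinite_places K. place_norm K u (a ^ m * \<epsilon>) > 1"
      using expanding_unit_infinite_places[OF a(3,4)] by blast
    have e: "\<epsilon> \<in> K" "\<epsilon> \<noteq> 0" using m(2) by (auto simp: integer_units_def)
    have nm: "m * n > 0" using m a by simp
    \<comment> \<open>With \<beta> a root of order m n of the class of 1/\<epsilon>, the quotient of
      \<alpha> by \<beta> is such a root of the class of a^m \<epsilon>, which is large at all
      archimedean places.\<close>
    obtain \<beta> where b: "\<beta> \<in> unit_span K" "\<forall>w\<in>places K. ln (V_norm K w \<beta>) = ln (place_norm K w (inverse \<epsilon>)) / real (m * n)"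
      using root[OF nm unit_inv[OF m(2)]] by blast
    have "ln (V_norm K w \<alpha>) - ln (V_norm K w \<beta>) \<ge> 0" if w: "w \<in> infinite_places K" for w
    proof -
      have wp: "w \<in> places K" using infp[OF w] .
      have "ln (V_norm K w \<alpha>) - ln (V_norm K w \<beta>) = ln (place_norm K w a) / real n + ln (place_norm K w \<epsilon>) / real (m * n)"
        using V_norm_pos_ln(2)[OF wp a] b(2) wp inv[OF wp e(1)] pos[OF wp e] by (simp add: ln_inverse)
      also have "\<dots> = ln (place_norm K w (a ^ m * \<epsilon>)) / real (m * n)"
        unfolding mult[OF wp a(3,4) e] using m(1) a(2) by (simp add: field_simps)
      also have "\<dots> \<ge> 0" using m(3) w by (intro divide_nonneg_nonneg ln_ge_zero) (auto intro: less_imp_le)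
      finally show ?thesis .
    qed
    thus ?thesis using that[OF b(1)] by blast
  next
    case 3
    define c where "c = inverse a"
    have c: "c \<in> K" "c \<noteq> 0" "inverse c = a" using a inverse_K by (simp_all add: c_def)
    have "place_norm K w c \<le> 1" if w: "w \<in> finite_places K" for w
    proof (cases "w = v")
      case True
      thus ?thesis using 3 inv[OF fin[OF v] a(3)] by (simp add: c_def inverse_le_1_iff)
    next
      case False
      thus ?thesis using a1[OF w] inv[OF fin[OF w] a(3)] by (simp add: c_def)
    qed
    hence "algebraic_int c" using c int by blast
    moreover have "\<not> algebraic_int (inverse c)" unfolding c(3) using 3 a(3) nonint by blast
    ultimately obtain m \<epsilon> where m: "m > 0" "\<epsilon> \<in> integer_units K"
        "\<forall>u\<in>infinite_places K. place_norm K u (c ^ m * \<epsilon>) > 1"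
      using expanding_unit_infinite_places[OF c(1,2)] by blast
    have e: "\<epsilon> \<in> K" "\<epsilon> \<noteq> 0" using m(2) by (auto simp: integer_units_def)
    have nm: "m * n > 0" using m a by simp
    \<comment> \<open>Now the quotient of \<alpha> by \<beta> is a root of order m n of the class of
      a^m / \<epsilon>, the inverse of c^m \<epsilon>, so all archimedean logarithms are
      negative.\<close>
    obtain \<beta> where b: "\<beta> \<in> unit_span K" "\<forall>w\<in>places K. ln (V_norm K w \<beta>) = ln (place_norm K w \<epsilon>) / real (m * n)"
      using root[OF nm m(2)] by blast
    have "ln (V_norm K w \<alpha>) - ln (V_norm K w \<beta>) \<le> 0" if w: "w \<in> infinite_places K" for w
    proof -
      have wp: "w \<in> places K" using infp[OF w] .
      have lc: "ln (place_norm K w c) = - ln (place_norm K w a)"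
        using inv[OF wp a(3)] pos[OF wp a(3,4)] by (simp add: c_def ln_inverse)
      have "ln (V_norm K w \<alpha>) - ln (V_norm K w \<beta>) = - (ln (place_norm K w c) / real n + ln (place_norm K w \<epsilon>) / real (m * n))"
        using V_norm_pos_ln(2)[OF wp a] b(2) wp by (simp add: lc)
      also have "\<dots> = - (ln (place_norm K w (c ^ m * \<epsilon>)) / real (m * n))"
        unfolding mult[OF wp c(1,2) e] using m(1) a(2) by (simp add: field_simps)
      also have "\<dots> \<le> 0"
        unfolding neg_le_0_iff_le using m(3) w by (intro divide_nonneg_nonneg ln_ge_zero) (auto intro: less_imp_le)
      finally show ?thesis .
    qed
    thus ?thesis using that[OF b(1)] by blast
  qed
qed

lemma h1_minimum:
  assumes v: "v \<in> finite_places K" and \<alpha>: "\<alpha> \<in> VV K"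
    and triv: "\<And>w. w \<in> finite_places K \<Longrightarrow> w \<noteq> v \<Longrightarrow> V_norm K w \<alpha> = 1"
  defines "F \<equiv> 1 / real (field_degree K) *
        (\<bar>real (local_degree K v) * ln (V_norm K v \<alpha>)\<bar> +
         \<bar>\<Sum>w\<in>infinite_places K. real (local_degree K w) * ln (V_norm K w \<alpha>)\<bar>)"
  shows "\<And>\<gamma>. \<gamma> \<in> unit_span K \<Longrightarrow> F \<le> h1 K (\<alpha> \<otimes>\<^bsub>GG\<^esub> inv\<^bsub>GG\<^esub> \<gamma>)"
    and "\<exists>\<beta>\<in>unit_span K. h1 K (\<alpha> \<otimes>\<^bsub>GG\<^esub> inv\<^bsub>GG\<^esub> \<beta>) = F"
proof -
  have fin: "w \<in> places K" if "w \<in> finite_places K" for w using that places_eq by blast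
  have infp: "w \<in> places K" if "w \<in> infinite_places K" for w using that places_eq by blast
  define d where "d = (\<lambda>w. real (local_degree K w))"
  define l where "l = (\<lambda>w \<gamma>. ln (V_norm K w \<gamma>))"
  have h1: "h1 K (\<alpha> \<otimes>\<^bsub>GG\<^esub> inv\<^bsub>GG\<^esub> \<gamma>) = 1 / real (field_degree K) * (\<bar>d v * l v \<alpha>\<bar> +
      (\<Sum>w\<in>infinite_places K. \<bar>d w * (l w \<alpha> - l w \<gamma>)\<bar>))" if g: "\<gamma> \<in> unit_span K" for \<gamma>
  proof -
    note ld = ln_V_norm_divide[OF \<alpha> unit_span_places(2)[OF g]]
    have fl: "ln (V_norm K w (\<alpha> \<otimes>\<^bsub>GG\<^esub> inv\<^bsub>GG\<^esub> \<gamma>)) = l w \<alpha>" if w: "w \<in> finite_places K" for w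
      using ld[OF fin[OF w]] unit_span_places(3)[OF g w] by (simp add: l_def)
    have "h1 K (\<alpha> \<otimes>\<^bsub>GG\<^esub> inv\<^bsub>GG\<^esub> \<gamma>) = 1 / real (field_degree K) *
        (\<bar>real (local_degree K v) * ln (V_norm K v (\<alpha> \<otimes>\<^bsub>GG\<^esub> inv\<^bsub>GG\<^esub> \<gamma>))\<bar> +
      (\<Sum>w\<in>infinite_places K. \<bar>real (local_degree K w) * ln (V_norm K w (\<alpha> \<otimes>\<^bsub>GG\<^esub> inv\<^bsub>GG\<^esub> \<gamma>))\<bar>))"
      using fl triv by (intro h1_eq v) (simp add: l_def)
    also have "(\<Sum>w\<in>infinite_places K. \<bar>real (local_degree K w) * ln (V_norm K w (\<alpha> \<otimes>\<^bsub>GG\<^esub> inv\<^bsub>GG\<^esub> \<gamma>))\<bar>) =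
        (\<Sum>w\<in>infinite_places K. \<bar>d w * (l w \<alpha> - l w \<gamma>)\<bar>)"
      using ld[OF infp] by (intro sum.cong) (simp_all add: d_def l_def)
    finally show ?thesis using fl[OF v] by (simp add: d_def)
  qed
  have sum: "(\<Sum>w\<in>infinite_places K. d w * (l w \<alpha> - l w \<gamma>)) = (\<Sum>w\<in>infinite_places K. d w * l w \<alpha>)"
    if g: "\<gamma> \<in> unit_span K" for \<gamma>
    using unit_span_places(4)[OF g] by (simp add: right_diff_distrib sum_subtractf d_def l_def)
  have F: "F = 1 / real (field_degree K) * (\<bar>d v * l v \<alpha>\<bar> + \<bar>\<Sum>w\<in>infinite_places K. d w * l w \<alpha>\<bar>)"
    by (simp add: F_def d_def l_def)
  show "F \<le> h1 K (\<alpha> \<otimes>\<^bsub>GG\<^esub> inv\<^bsub>GG\<^esub> \<gamma>)" if g: "\<gamma> \<in> unit_span K" for \<gamma>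
    unfolding F h1[OF g] sum[OF g, symmetric]
    by (intro mult_left_mono add_left_mono sum_abs) auto
  obtain \<beta> where b: "\<beta> \<in> unit_span K"
    "(\<forall>w\<in>infinite_places K. ln (V_norm K w \<alpha>) - ln (V_norm K w \<beta>) \<ge> 0) \<or>
     (\<forall>w\<in>infinite_places K. ln (V_norm K w \<alpha>) - ln (V_norm K w \<beta>) \<le> 0)"
    using unit_span_same_sign[OF v \<alpha> triv] by blast
  have "(\<forall>w\<in>infinite_places K. d w * (l w \<alpha> - l w \<beta>) \<ge> 0) \<or>
     (\<forall>w\<in>infinite_places K. d w * (l w \<alpha> - l w \<beta>) \<le> 0)"
    using b(2) by (auto simp: d_def l_def mult_nonneg_nonneg mult_nonneg_nonpos)
  hence "h1 K (\<alpha> \<otimes>\<^bsub>GG\<^esub> inv\<^bsub>GG\<^esub> \<beta>) = F"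
    unfolding F h1[OF b(1)] sum[OF b(1), symmetric] by (simp only: sum_abs_same_sign)
  thus "\<exists>\<beta>\<in>unit_span K. h1 K (\<alpha> \<otimes>\<^bsub>GG\<^esub> inv\<^bsub>GG\<^esub> \<beta>) = F" using b(1) by blast
qed

end

theorem theorem5:
  fixes K :: "complex set" and v :: "(complex \<Rightarrow> real) set" and \<alpha> :: "complex set"
  assumes "number_field K"
    and "v \<in> finite_places K"
    and "\<alpha> \<in> VV K"
    and "\<And>w. w \<in> finite_places K \<Longrightarrow> w \<noteq> v \<Longrightarrow> V_norm K w \<alpha> = 1"
  shows "\<exists>\<beta>\<in>unit_span K.
    h1 K (\<alpha> \<otimes>\<^bsub>GG\<^esub> inv\<^bsub>GG\<^esub> \<beta>) = (INF \<gamma>\<in>unit_span K. h1 K (\<alpha> \<otimes>\<^bsub>GG\<^esub> inv\<^bsub>GG\<^esub> \<gamma>)) \<and>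
    (INF \<gamma>\<in>unit_span K. h1 K (\<alpha> \<otimes>\<^bsub>GG\<^esub> inv\<^bsub>GG\<^esub> \<gamma>)) =
      1 / real (field_degree K) *
        (\<bar>real (local_degree K v) * ln (V_norm K v \<alpha>)\<bar> +
         \<bar>\<Sum>w\<in>infinite_places K. real (local_degree K w) * ln (V_norm K w \<alpha>)\<bar>)"
proof -
  obtain t where t: "algebraic t" "K = simple_ext t" using number_field_primitive[OF assms(1)] .
  obtain P where P: "min_rpoly P t" using min_rpoly_exists[OF t(1)] .
  interpret prim_field K t P by unfold_locales (fact P, fact t(2))
  let ?h = "\<lambda>\<gamma>. h1 K (\<alpha> \<otimes>\<^bsub>GG\<^esub> inv\<^bsub>GG\<^esub> \<gamma>)"
  define F where "F = 1 / real (field_degree K) *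
        (\<bar>real (local_degree K v) * ln (V_norm K v \<alpha>)\<bar> +
         \<bar>\<Sum>w\<in>infinite_places K. real (local_degree K w) * ln (V_norm K w \<alpha>)\<bar>)"
  have low: "F \<le> ?h \<gamma>" if "\<gamma> \<in> unit_span K" for \<gamma>
    using h1_minimum(1)[OF assms(2-4) that] by (simp add: F_def)
  obtain \<beta> where b: "\<beta> \<in> unit_span K" "?h \<beta> = F"
    using h1_minimum(2)[OF assms(2-4)] unfolding F_def by blast
  have "(INF \<gamma>\<in>unit_span K. ?h \<gamma>) = F"
    using b low by (intro cInf_eq_minimum) auto
  thus ?thesis using b unfolding F_def[symmetric] by (intro bexI[of _ \<beta>]) simp_all
qed

end
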